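(* Let $n\ge1$, $\sigma>0$, $\Pi=[0,2\pi)^n$, $\delta\in(0,1)$, $\alpha=\frac{1-\delta}{2}$, and let $\gamma\in(0,1/4)$. Set $\nu_1=\frac{\alpha}{\alpha+2}$ and $\nu_2=n+1$. There is a constant $C>0$ such that, provided $\varepsilon\in(0,1-2\gamma)$ and $\kappa\in(0,\gamma]$ are sufficiently small, the following holds. Let $D\subset\Pi$ and let $D\ni\omega\mapsto A(\omega)=\mathrm{diag}\{\Lambda_1,\Lambda_2,\Lambda_3,\dots\}$ (with real $\Lambda_i=\Lambda_i(\omega)$) be a $C^1$ map satisfying $$\|A-\mathbb A\|_{\widehat\alpha}^D\le\varepsilon,\qquad \mathbb A:=\mathrm{diag}\{1,3,5,\dots\}.$$ Let $0<\rho'<\rho\le\sigma$, let $P\in\mathcal M_{\widehat\alpha}(D,\rho)$ be Hermitian, and let $K\ge1$. Then there is a subset $D'=D'(\kappa,K)\subset D$ satisfying $$\mathrm{Meas}(D\setminus D')\le C\kappa^{\nu_1}K^{\nu_2}$$ and $C^1$ (in $\omega$) maps $\widetilde A:D'\to\mathcal M_{\widehat\alpha}$ diagonal, $R:D'\times\mathbb T^n_{\rho'}\to\mathcal M_{\widehat\alpha}$ Hermitian, and $S:D'\times\mathbb T^n_{\rho'}\to\mathcal M_{\widehat\alpha+}$ anti-Hermitian, all analytic in $\theta$, such that $$[A,S]-\mathbf i\,\dot S=\widetilde A-P+R .$$ More precisely, $$\|\widetilde A\|_{\widehat\alpha}^{D'}\le\|P\|_{\widehat\alpha}^{D,\rho},$$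 $$\|R\|_{\widehat\alpha}^{D',\rho'}\le\frac{C\exp\left(-\frac K2(\rho-\rho')\right)}{(\rho-\rho')^n}\|P\|_{\widehat\alpha}^{D,\rho},$$ $$\|S\|_{\widehat\alpha+}^{D',\rho'}\le\frac{CK^3}{\kappa^4(\rho-\rho')^n}\|P\|_{\widehat\alpha}^{D,\rho}.$$
   Context: $\mathbb N=\{1,2,\dots\}$, $i\wedge j=\min\{i,j\}$; $\mathbb T^n=\mathbb R^n/(2\pi\mathbb Z)^n$, $\mathbb T^n_\rho=\{a+\mathbf i b\in\mathbb C^n/(2\pi\mathbb Z)^n:|b|<\rho\}$ with $|b|=\max_j|b_j|$. $\dot S:=\sum_{j=1}^n\omega_j\partial_{\theta_j}S$ (the time derivative of $S(\omega,\omega t)$). $[A,S]$ is the commutator, with entries $(\Lambda_i-\Lambda_j)S_i^j$. "Hermitian"/"anti-Hermitian" for a map depending on $\theta$ means that the matrix is Hermitian/anti-Hermitian for real $\theta$. Matrix spaces. For an infinite complex matrix $A=(A_i^j)_{i,j\in\mathbb N}$, acting by $(Au)_i=\sum_jA_i^ju_j$: $\|A\|$ is the operator norm on $\ell^2$, $\mathcal M:=\mathcal B(\ell^2)$, $\mathcal N:=\mathrm{diag}\{1,2,3,\dots\}$ (so $[\mathcal N,A]_i^j=(i-j)A_i^j$), $(\Delta A)_i^j:=A_{i+1}^{j+1}-A_i^j$, $|A|_\alpha:=\sup_{i,j\ge1}(i\wedge j)^\alpha|A_i^j|$. - $\mathcal M_{\widehat\alpha}:=\{A\in\mathcal M:|\Delta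 A|_\alpha<\infty\}$, $\|A\|_{\widehat\alpha}:=\max\{\|A\|,|\Delta A|_\alpha\}$. - $\mathcal M_{\widehat\alpha+}:=\{A\in\mathcal M:\|[\mathcal N,A]\|,|\Delta A|_\alpha,|[\mathcal N,\Delta A]|_\alpha<\infty\}$, $\|A\|_{\widehat\alpha+}:=\max\{\|A\|,\|[\mathcal N,A]\|,|\Delta A|_\alpha,|[\mathcal N,\Delta A]|_\alpha\}$. Parameters. For $D\subset\Pi$ and $\rho\in(0,\sigma]$, $\mathcal M_{\widehat\alpha}(D,\rho)$ is the set of maps $P:D\times\mathbb T^n_\rho\to\mathcal M_{\widehat\alpha}$ that are $C^1$ in $\omega\in D$ (in the sense of Whitney if $D$ is Cantor-like) and real analytic in $\theta\in\mathbb T^n_\rho$, with norm $\|P\|_{\widehat\alpha}^{D,\rho}:=\sup_{|\Im\theta|<\rho,\ \omega\in D,\ l=0,1}\|\partial_\omega^lP(\omega,\theta)\|_{\widehat\alpha}$, where $\|\partial_\omega F\|:=\max_{1\le i\le n}\|\partial_{\omega_i}F\|$. For maps independent of $\theta$, $\|A\|_{\widehat\alpha}^D:=\sup_{\omega\in D,\,l=0,1}\|\partial_\omega^lA(\omega)\|_{\widehat\alpha}$. $\|S\|_{\widehat\alpha+}^{D,\rho}$ is defined in the same way with $\|\cdot\|_{\widehat\alpha+}$ in place of $\|\cdot\|_{\widehat\alpha}$.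
   Formalization: The C¹ norms over D and D' (of A minus diag{1,3,5,…}, P, Ã, R, S) are Whitney norms: they also include the difference quotients in ω between points of the set (no change if it is convex); without this the claim fails for D with gaps. *)

theory Defs
  imports "HOL-Analysis.Analysis"
begin

text \<open>
  Matrix indices are shifted by one: the entry \<open>A i j\<close> stands for the entry of the
  mathematical matrix in row \<open>i + 1\<close> and column \<open>j + 1\<close>. All norms take values in
  \<^typ>\<open>ennreal\<close>, with value \<open>\<infinity>\<close> outside of the space in question; so each space below is the
  set of those matrices (or maps) whose norm is finite.
\<close>

type_synonym imat = "nat \<Rightarrow> nat \<Rightarrow> complex"

definition diag :: "(nat \<Rightarrow> complex) \<Rightarrow> imat" where
  "diag d = (\<lambda>i j. if i = j then d i else 0)"

definition is_diagonal :: "imat \<Rightarrow> bool" where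
  "is_diagonal A \<longleftrightarrow> (\<forall>i j. i \<noteq> j \<longrightarrow> A i j = 0)"

text \<open>The commutator of \<open>diag d\<close> with \<open>A\<close>; \<open>diag d\<close> may be unbounded.\<close>

definition commutator_diag :: "(nat \<Rightarrow> complex) \<Rightarrow> imat \<Rightarrow> imat" where
  "commutator_diag d A = (\<lambda>i j. (d i - d j) * A i j)"

text \<open>The diagonals of \<open>diag {1, 2, 3, \<dots>}\<close> and of \<open>diag {1, 3, 5, \<dots>}\<close>.\<close>

definition num_diag :: "nat \<Rightarrow> complex" where
  "num_diag i = of_nat (i + 1)"

definition odd_diag :: "nat \<Rightarrow> complex" where
  "odd_diag i = of_nat (2 * i + 1)"

definition Delta :: "imat \<Rightarrow> imat" where
  "Delta A = (\<lambda>i j. A (i + 1) (j + 1) - A i j)"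


subsection \<open>Matrix norms\<close>

definition ell2 :: "(nat \<Rightarrow> complex) set" where
  "ell2 = {u. summable (\<lambda>i. (cmod (u i))\<^sup>2)}"

definition ell2_norm :: "(nat \<Rightarrow> complex) \<Rightarrow> real" where
  "ell2_norm u = sqrt (\<Sum>i. (cmod (u i))\<^sup>2)"

definition mat_apply :: "imat \<Rightarrow> (nat \<Rightarrow> complex) \<Rightarrow> nat \<Rightarrow> complex" where
  "mat_apply A u = (\<lambda>i. \<Sum>j. A i j * u j)"

definition acts_on_ell2 :: "imat \<Rightarrow> bool" where
  "acts_on_ell2 A \<longleftrightarrow>
     (\<forall>u\<in>ell2. (\<forall>i. summable (\<lambda>j. A i j * u j)) \<and> mat_apply A u \<in> ell2)"

definition op_norm :: "imat \<Rightarrow> ennreal" where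
  "op_norm A =
     (if acts_on_ell2 A
      then SUP u \<in> {u \<in> ell2. ell2_norm u \<le> 1}. ennreal (ell2_norm (mat_apply A u))
      else \<infinity>)"

definition weight_norm :: "real \<Rightarrow> imat \<Rightarrow> ennreal" where
  "weight_norm \<alpha> A = (SUP i. SUP j. ennreal (real (min i j + 1) powr \<alpha> * cmod (A i j)))"

definition hat_norm :: "real \<Rightarrow> imat \<Rightarrow> ennreal" where
  "hat_norm \<alpha> A = max (op_norm A) (weight_norm \<alpha> (Delta A))"

definition hat_plus_norm :: "real \<Rightarrow> imat \<Rightarrow> ennreal" where
  "hat_plus_norm \<alpha> A =
     Max {op_norm A, op_norm (commutator_diag num_diag A),
          weight_norm \<alpha> (Delta A), weight_norm \<alpha> (commutator_diag num_diag (Delta A))}"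


subsection \<open>Differentiability in the parameter, in the sense of Whitney\<close>

text \<open>
  The set \<open>D\<close> is arbitrary (possibly Cantor-like), so a map of class \<open>C\<^sup>1\<close> on \<open>D\<close> is a jet: the
  map \<open>F\<close> together with its partial derivatives \<open>dF m\<close>, subject to Whitney's condition on the
  first-order Taylor remainder. If \<open>D\<close> is open, this is the usual notion, and \<open>dF\<close> is
  determined by \<open>F\<close>. Continuity and the remainder are measured by the matrix norm \<open>nrm\<close>.
\<close>

definition whitney_C1 ::
  "(imat \<Rightarrow> ennreal) \<Rightarrow> (real^'n) set \<Rightarrow> (real^'n \<Rightarrow> imat) \<Rightarrow> ('n \<Rightarrow> real^'n \<Rightarrow> imat) \<Rightarrow> bool"
where
  "whitney_C1 nrm D F dF \<longleftrightarrow>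
     (\<forall>a\<in>D. nrm (F a) < \<infinity>) \<and>
     (\<forall>a\<in>D. \<forall>m. nrm (dF m a) < \<infinity>) \<and>
     (\<forall>a\<in>D. \<forall>m. \<forall>e>0. \<exists>d>0. \<forall>x\<in>D \<inter> ball a d.
        nrm (\<lambda>i j. dF m x i j - dF m a i j) \<le> ennreal e) \<and>
     (\<forall>a\<in>D. \<forall>e>0. \<exists>d>0. \<forall>x\<in>D \<inter> ball a d. \<forall>y\<in>D \<inter> ball a d.
        nrm (\<lambda>i j. F x i j - F y i j - (\<Sum>m\<in>UNIV. of_real (x $ m - y $ m) * dF m y i j))
          \<le> ennreal (e * norm (x - y)))"

text \<open>
  The norm is the supremum over \<open>D\<close> of the norms of the map and of its partial derivatives.
  As usual for Whitney's \<open>C\<^sup>1\<close> norm, the first-order part also contains the difference quotients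
  between points of \<open>D\<close>: if \<open>D\<close> has gaps, they are not controlled by the derivatives at the
  points of \<open>D\<close>. With the \<open>\<ell>\<^sup>1\<close> distance used here they do not change the norm if \<open>D\<close> is convex;
  see \<open>whitney_norm_convex\<close> below.
\<close>

definition whitney_norm ::
  "(imat \<Rightarrow> ennreal) \<Rightarrow> (real^'n) set \<Rightarrow> (real^'n \<Rightarrow> imat) \<Rightarrow> ('n \<Rightarrow> real^'n \<Rightarrow> imat) \<Rightarrow> ennreal"
where
  "whitney_norm nrm D F dF =
     Max {SUP x\<in>D. nrm (F x),
          SUP x\<in>D. SUP m. nrm (dF m x),
          SUP x\<in>D. SUP y\<in>D - {x}.
            nrm (\<lambda>i j. F x i j - F y i j) / ennreal (\<Sum>m\<in>UNIV. \<bar>x $ m - y $ m\<bar>)}"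

lemma whitney_norm_convex:
  fixes D :: "(real^'n) set"
  assumes conv: "convex D"
    and C1: "whitney_C1 nrm D F dF"
    and tri: "\<And>A B. nrm (\<lambda>i j. A i j + B i j) \<le> nrm A + nrm B"
    and hom: "\<And>c A. nrm (\<lambda>i j. c * A i j) = ennreal (cmod c) * nrm A"
  shows "whitney_norm nrm D F dF
       = max (SUP x\<in>D. nrm (F x)) (SUP x\<in>D. SUP m. nrm (dF m x))"
proof -
  define M where "M = (SUP x\<in>D. SUP m. nrm (dF m x))"
  have nrm0: "nrm (\<lambda>i j. 0) = 0"
    using hom[of 0 "\<lambda>i j. 0"] by simp
  have lin: "nrm (\<lambda>i j. \<Sum>m\<in>J. of_real (h $ m) * dF m y i j)
      \<le> (\<Sum>m\<in>J. ennreal \<bar>h $ m\<bar>) * M" if "y \<in> D" "finite J" for h :: "real^'n" and y J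
    using that(2)
  proof induction
    case empty
    then show ?case by (simp add: nrm0)
  next
    case (insert m J)
    have "nrm (dF m y) \<le> M"
      unfolding M_def using that(1) by (meson SUP_upper SUP_upper2 UNIV_I)
    then have "nrm (\<lambda>i j. of_real (h $ m) * dF m y i j) \<le> ennreal \<bar>h $ m\<bar> * M"
      unfolding hom by (simp add: mult_left_mono)
    then show ?case
      using insert tri[of "\<lambda>i j. of_real (h $ m) * dF m y i j"
                          "\<lambda>i j. \<Sum>m\<in>J. of_real (h $ m) * dF m y i j"]
      by (simp add: distrib_right) (meson add_mono order_trans)
  qed
  have lip: "nrm (\<lambda>i j. F x i j - F y i j) \<le> ennreal (\<Sum>m\<in>UNIV. \<bar>x $ m - y $ m\<bar>) * M"
    if "x \<in> D" "y \<in> D" for x y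
  proof (rule ennreal_le_epsilon)
    fix e :: real assume "e > 0"
    define g where "g t = y + t *\<^sub>R (x - y)" for t
    define c where "c = ennreal (\<Sum>m\<in>UNIV. \<bar>x $ m - y $ m\<bar>) * M + ennreal e"
    define Q where "Q u v \<longleftrightarrow> nrm (\<lambda>i j. F (g v) i j - F (g u) i j) \<le> ennreal (v - u) * c
      \<or> \<not> (0 \<le> u \<and> u \<le> v \<and> v \<le> 1)" for u v :: real
    define e' where "e' = e / (norm (x - y) + 1)"
    have N: "norm (x - y) + 1 > 0"
      by (simp add: add_nonneg_pos)
    have "e' > 0"
      using \<open>e > 0\<close> N by (simp add: e'_def)
    have "e * norm (x - y) \<le> e * (norm (x - y) + 1)"
      using \<open>e > 0\<close> by simp
    then have "e' * norm (x - y) \<le> e"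
      using N by (simp add: e'_def pos_divide_le_eq)
    have gD: "g t \<in> D" if "0 \<le> t" "t \<le> 1" for t
    proof -
      have "g t = (1 - t) *\<^sub>R y + t *\<^sub>R x"
        by (simp add: g_def algebra_simps)
      then show ?thesis
        using conv that \<open>x \<in> D\<close> \<open>y \<in> D\<close> by (simp add: convex_alt)
    qed
    have gdist: "g v - g u = (v - u) *\<^sub>R (x - y)" for u v
      by (simp add: g_def algebra_simps)
    have "(0::real) \<le> 1" by simp
    then have "Q 0 1"
    proof (induction rule: Bolzano)
      case (trans p q r)
      show ?case
      proof (cases "0 \<le> p \<and> r \<le> 1")
        case True
        then have "nrm (\<lambda>i j. F (g q) i j - F (g p) i j) \<le> ennreal (q - p) * c"
          and "nrm (\<lambda>i j. F (g r) i j - F (g q) i j) \<le> ennreal (r - q) * c"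
          using trans by (auto simp: Q_def)
        then have "nrm (\<lambda>i j. F (g r) i j - F (g p) i j)
            \<le> ennreal (q - p) * c + ennreal (r - q) * c"
          using tri[of "\<lambda>i j. F (g q) i j - F (g p) i j" "\<lambda>i j. F (g r) i j - F (g q) i j"]
          by simp (meson add_mono order_trans)
        also have "\<dots> = ennreal (r - p) * c"
          using trans by (simp flip: distrib_right ennreal_plus)
        finally show ?thesis by (simp add: Q_def)
      qed (auto simp: Q_def)
    next
      case (local t)
      then have "g t \<in> D" by (intro gD) auto
      then obtain d where "d > 0" and d: "\<And>a b. a \<in> D \<inter> ball (g t) d \<Longrightarrow> b \<in> D \<inter> ball (g t) d \<Longrightarrow>
          nrm (\<lambda>i j. F a i j - F b i j - (\<Sum>m\<in>UNIV. of_real (a $ m - b $ m) * dF m b i j))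
            \<le> ennreal (e' * norm (a - b))"
        using C1 \<open>e' > 0\<close> unfolding whitney_C1_def by meson
      show ?case
      proof (intro exI[of _ "d / (norm (x - y) + 1)"] conjI allI impI)
        show "0 < d / (norm (x - y) + 1)"
          using \<open>d > 0\<close> N by simp
        fix u v assume uv: "u \<le> t \<and> t \<le> v \<and> v - u < d / (norm (x - y) + 1)"
        show "Q u v"
        proof (cases "0 \<le> u \<and> v \<le> 1")
          case True
          have inb: "g s \<in> D \<inter> ball (g t) d" if "s \<in> {u, v}" for s
          proof -
            have "\<bar>t - s\<bar> \<le> v - u" using that uv by auto
            then have "\<bar>t - s\<bar> * norm (x - y) \<le> (v - u) * (norm (x - y) + 1)"
              by (intro mult_mono) (use uv in auto)
            also have "\<dots> < d"
              using uv N by (simp add: pos_less_divide_eq)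
            finally have "dist (g t) (g s) < d"
              by (simp add: dist_norm gdist)
            then show ?thesis using gD[of s] that True uv by auto
          qed
          have "nrm (\<lambda>i j. F (g v) i j - F (g u) i j)
            \<le> ennreal (e' * norm (g v - g u))
              + (\<Sum>m\<in>UNIV. ennreal \<bar>(g v - g u) $ m\<bar>) * M"
            using tri[of "\<lambda>i j. F (g v) i j - F (g u) i j
                - (\<Sum>m\<in>UNIV. of_real (g v $ m - g u $ m) * dF m (g u) i j)"
                "\<lambda>i j. \<Sum>m\<in>UNIV. of_real (g v $ m - g u $ m) * dF m (g u) i j"]
              d[OF inb[of v] inb[of u]] lin[of "g u" UNIV "g v - g u"] inb[of u]
            by simp (meson add_mono order_trans)
          also have "(\<Sum>m\<in>UNIV. ennreal \<bar>(g v - g u) $ m\<bar>)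
              = ennreal (v - u) * ennreal (\<Sum>m\<in>UNIV. \<bar>x $ m - y $ m\<bar>)"
            using uv unfolding gdist
            by (simp add: abs_mult sum_nonneg flip: ennreal_mult sum_distrib_left)
          also have "ennreal (e' * norm (g v - g u)) \<le> ennreal (v - u) * ennreal e"
          proof -
            have "e' * norm (g v - g u) = (v - u) * (e' * norm (x - y))"
              using uv by (simp add: gdist)
            also have "\<dots> \<le> (v - u) * e"
              using uv \<open>e' * norm (x - y) \<le> e\<close> by (intro mult_left_mono) auto
            finally show ?thesis
              using uv \<open>e > 0\<close> by (simp flip: ennreal_mult)
          qed
          finally have "nrm (\<lambda>i j. F (g v) i j - F (g u) i j) \<le> ennreal (v - u) * c"
            by (simp add: c_def distrib_left mult.assoc add.commute)
          then show ?thesis by (simp add: Q_def)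
        qed (auto simp: Q_def)
      qed
    qed
    then show "nrm (\<lambda>i j. F x i j - F y i j)
        \<le> ennreal (\<Sum>m\<in>UNIV. \<bar>x $ m - y $ m\<bar>) * M + ennreal e"
      by (simp add: Q_def g_def c_def)
  qed
  have "(SUP x\<in>D. SUP y\<in>D - {x}.
      nrm (\<lambda>i j. F x i j - F y i j) / ennreal (\<Sum>m\<in>UNIV. \<bar>x $ m - y $ m\<bar>)) \<le> M"
  proof (intro SUP_least)
    fix x y assume "x \<in> D" "y \<in> D - {x}"
    then have "(\<Sum>m\<in>UNIV. \<bar>x $ m - y $ m\<bar>) \<noteq> 0"
      by (auto simp: sum_nonneg_eq_0_iff vec_eq_iff) metis
    then have "(\<Sum>m\<in>UNIV. \<bar>x $ m - y $ m\<bar>) > 0"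
      by (simp add: order_less_le sum_nonneg)
    then show "nrm (\<lambda>i j. F x i j - F y i j) / ennreal (\<Sum>m\<in>UNIV. \<bar>x $ m - y $ m\<bar>) \<le> M"
      using lip[of x y] \<open>x \<in> D\<close> \<open>y \<in> D - {x}\<close>
      by (auto intro!: divide_le_posI_ennreal simp: ennreal_zero_less_divide)
  qed
  then show ?thesis
    by (simp add: whitney_norm_def M_def max.absorb1 max.assoc)
qed


subsection \<open>Maps on complex neighbourhoods of the torus\<close>

text \<open>
  Maps on the complex neighbourhood of width \<open>\<rho>\<close> of the torus are \<open>2\<pi>\<close>-periodic maps on the
  following strip. Analyticity is complex (Frechet) differentiability with respect to the matrix
  norm \<open>nrm\<close>.
\<close>

definition strip :: "real \<Rightarrow> (complex^'n) set" where
  "strip \<rho> = {\<theta>. \<forall>m. \<bar>Im (\<theta> $ m)\<bar> < \<rho>}"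

definition torus_analytic :: "(imat \<Rightarrow> ennreal) \<Rightarrow> real \<Rightarrow> (complex^'n \<Rightarrow> imat) \<Rightarrow> bool" where
  "torus_analytic nrm \<rho> f \<longleftrightarrow>
     (\<forall>\<theta>\<in>strip \<rho>. \<forall>m. f (\<theta> + axis m (of_real (2 * pi))) = f \<theta>) \<and>
     (\<forall>\<theta>\<in>strip \<rho>. nrm (f \<theta>) < \<infinity>) \<and>
     (\<forall>\<theta>\<in>strip \<rho>. \<exists>L :: 'n \<Rightarrow> imat. (\<forall>m. nrm (L m) < \<infinity>) \<and>
        (\<forall>e>0. \<exists>d>0. \<forall>h. norm h < d \<longrightarrow>
           nrm (\<lambda>i j. f (\<theta> + h) i j - f \<theta> i j - (\<Sum>m\<in>UNIV. h $ m * L m i j))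
             \<le> ennreal (e * norm h)))"

definition param_norm ::
  "(imat \<Rightarrow> ennreal) \<Rightarrow> (real^'n) set \<Rightarrow> real \<Rightarrow>
   (real^'n \<Rightarrow> complex^'n \<Rightarrow> imat) \<Rightarrow> ('n \<Rightarrow> real^'n \<Rightarrow> complex^'n \<Rightarrow> imat) \<Rightarrow> ennreal"
where
  "param_norm nrm D \<rho> P dP =
     (SUP \<theta>\<in>strip \<rho>. whitney_norm nrm D (\<lambda>\<omega>. P \<omega> \<theta>) (\<lambda>m \<omega>. dP m \<omega> \<theta>))"

text \<open>
  The maps, given with their derivatives \<open>dP m\<close> in \<open>\<omega>\<close>, which are \<open>C\<^sup>1\<close> in \<open>\<omega>\<close> and analytic
  in \<open>\<theta>\<close>, without a bound on their norm.
\<close>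

definition C1_analytic ::
  "(imat \<Rightarrow> ennreal) \<Rightarrow> (real^'n) set \<Rightarrow> real \<Rightarrow>
   (real^'n \<Rightarrow> complex^'n \<Rightarrow> imat) \<Rightarrow> ('n \<Rightarrow> real^'n \<Rightarrow> complex^'n \<Rightarrow> imat) \<Rightarrow> bool"
where
  "C1_analytic nrm D \<rho> P dP \<longleftrightarrow>
     (\<forall>\<theta>\<in>strip \<rho>. whitney_C1 nrm D (\<lambda>\<omega>. P \<omega> \<theta>) (\<lambda>m \<omega>. dP m \<omega> \<theta>)) \<and>
     (\<forall>\<omega>\<in>D. torus_analytic nrm \<rho> (P \<omega>)) \<and>
     (\<forall>\<omega>\<in>D. \<forall>m. torus_analytic nrm \<rho> (dP m \<omega>))"

definition hermitian_map ::
  "(real^'n) set \<Rightarrow> (real^'n \<Rightarrow> complex^'n \<Rightarrow> imat) \<Rightarrow> bool" where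
  "hermitian_map D P \<longleftrightarrow>
     (\<forall>\<omega>\<in>D. \<forall>t :: real^'n. \<forall>i j.
        P \<omega> (\<chi> m. of_real (t $ m)) j i = cnj (P \<omega> (\<chi> m. of_real (t $ m)) i j))"

definition antihermitian_map ::
  "(real^'n) set \<Rightarrow> (real^'n \<Rightarrow> complex^'n \<Rightarrow> imat) \<Rightarrow> bool" where
  "antihermitian_map D P \<longleftrightarrow>
     (\<forall>\<omega>\<in>D. \<forall>t :: real^'n. \<forall>i j.
        P \<omega> (\<chi> m. of_real (t $ m)) j i = - cnj (P \<omega> (\<chi> m. of_real (t $ m)) i j))"

definition time_deriv :: "(real^'n \<Rightarrow> complex^'n \<Rightarrow> imat) \<Rightarrow> real^'n \<Rightarrow> complex^'n \<Rightarrow> imat" where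
  "time_deriv S \<omega> \<theta> =
     (\<lambda>i j. \<Sum>m\<in>UNIV. of_real (\<omega> $ m) * deriv (\<lambda>z. S \<omega> (\<theta> + axis m z) i j) 0)"

end

theory Submission
  imports Defs "HOL-Complex_Analysis.Cauchy_Integral_Formula"
begin

text \<open>
  Expanding in Fourier modes, the equation decouples into
  \<open>(\<Lambda>\<^sub>i - \<Lambda>\<^sub>j + k \<cdot> \<omega>) S\<^sub>i\<^sub>j(k) = - P\<^sub>i\<^sub>j(k)\<close> for the modes with all \<open>\<bar>k\<^sub>m\<bar> \<le> K\<close> (except \<open>k = 0\<close>,
  \<open>i = j\<close>, which is absorbed by the diagonal of \<open>P(0)\<close>); the tail of the Fourier series is \<open>R\<close>.
  The parameters removed are those for which some divisor is smaller than \<open>\<kappa> (1 + \<bar>i - j\<bar>)\<close>. For each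
  \<open>k\<close> and \<open>l = i - j\<close> infinitely many divisors occur, but since \<open>\<Lambda>\<^sub>i - \<Lambda>\<^sub>j\<close> is \<open>2 l\<close> up to
  \<open>O((i \<and> j)\<^sup>-\<^sup>\<alpha>)\<close>, all those with \<open>i \<and> j\<close> large are treated at once by removing the
  \<open>\<omega>\<close> with \<open>2 l + k \<cdot> \<omega>\<close> small. The division is bounded because the reciprocal divisors form a Schur
  multiplier with columns in \<open>\<ell>\<^sup>2\<close>, and it gains the factor \<open>i - j\<close> because
  \<open>(i - j) / (\<Lambda>\<^sub>i - \<Lambda>\<^sub>j + k \<cdot> \<omega>)\<close> is \<open>1/2\<close> up to \<open>O(K)\<close> times such a multiplier. Each derivative or
  difference in \<open>\<omega>\<close> costs one further division and one factor \<open>K\<close>.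

  The Fourier coefficients are replaced by their discrete analogues on a fine grid of the torus: these are
  finite linear combinations of values of \<open>P\<close>, so that Whitney differentiability, which is only assumed
  pointwise in \<open>\<theta>\<close>, is inherited without any interchange of limits.
\<close>


subsection \<open>Matrix norms\<close>

text \<open>Sampling puts an approximate statement in place of Cauchy's theorem: the grid means of a
  periodic holomorphic function on two horizontal lines differ by O(1/N), with a constant that
  depends only on a bound of the function and on the widths. Hence one \<open>N\<close>, fixed by
  the frequency cutoff \<open>n\<close> and the widths, serves every \<open>P\<close>, derivative
  and difference, and its error is hidden in the exponential bounds. Scalar estimates reach
  \<open>hat_norm\<close> without loss through linear functionals of finitely many entries, which
  commute with sampling. The width \<open>\<rho>\<close> - \<open>\<rho>'\<close> is 2 s. The
  coefficients decay like exp (-|k| (\<open>\<rho>'\<close> + s)), which leaves exp (-|k| s) for the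
  sum over k on the smaller strip, and the cut at n = floor K costs exp (-(n + 1) s); this is the
  origin of K / 2. One division has norm \<open>\<tau>\<close> of order K / \<kappa>^2 from
  \<open>hat_norm\<close> to \<open>hat_plus_norm\<close>; with L of order K for the divisor, a
  quotient has norm at most \<open>\<tau>\<close> (1 + L \<open>\<tau>\<close>), which is the factor
  K^3 / \<kappa>^4. D is an arbitrary set, so measures are estimated for the compact closures of its
  resonant parts.\<close>

definition op_bound :: "imat \<Rightarrow> real \<Rightarrow> bool" where
  "op_bound A M \<longleftrightarrow> (\<forall>m n u. L2_set (\<lambda>i. cmod (\<Sum>j<n. A i j * u j)) {..<m} \<le> M * L2_set (\<lambda>j. cmod (u j)) {..<n})"

lemma op_boundD: "op_bound A M \<Longrightarrow> L2_set (\<lambda>i. cmod (\<Sum>j<n. A i j * u j)) {..<m} \<le> M * L2_set (\<lambda>j. cmod (u j)) {..<n}"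
  by (simp add: op_bound_def)

lemma op_bound_sq:
  assumes "op_bound A M" "M \<ge> 0"
  shows "(\<Sum>i<m. (cmod (\<Sum>j<n. A i j * u j))\<^sup>2) \<le> M\<^sup>2 * (\<Sum>j<n. (cmod (u j))\<^sup>2)"
proof -
  have "(L2_set (\<lambda>i. cmod (\<Sum>j<n. A i j * u j)) {..<m})\<^sup>2 \<le> (M * L2_set (\<lambda>j. cmod (u j)) {..<n})\<^sup>2"
    by (intro power_mono op_boundD assms L2_set_nonneg)
  then show ?thesis by (simp add: L2_set_def power_mult_distrib sum_nonneg)
qed

lemma op_bound_sqI:
  assumes "M \<ge> 0" "\<And>m n u. (\<Sum>i<m. (cmod (\<Sum>j<n. A i j * u j))\<^sup>2) \<le> M\<^sup>2 * (\<Sum>j<n. (cmod (u j))\<^sup>2)"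
  shows "op_bound A M"
  unfolding op_bound_def
proof (intro allI)
  fix m n :: nat and u :: "nat \<Rightarrow> complex"
  have "sqrt (\<Sum>i<m. (cmod (\<Sum>j<n. A i j * u j))\<^sup>2) \<le> sqrt (M\<^sup>2 * (\<Sum>j<n. (cmod (u j))\<^sup>2))"
    using assms(2) by (intro real_sqrt_le_mono)
  then show "L2_set (\<lambda>i. cmod (\<Sum>j<n. A i j * u j)) {..<m} \<le> M * L2_set (\<lambda>j. cmod (u j)) {..<n}"
    using assms(1) by (simp add: L2_set_def real_sqrt_mult)
qed

lemma op_bound_entry:
  assumes "op_bound A M"
  shows "cmod (A i j) \<le> M"
proof -
  define u where "u k = (if k = j then 1 else 0 :: complex)" for k
  have "(\<Sum>k<Suc j. A l k * u k) = A l j" for l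
    by (simp add: u_def)
  then have "L2_set (\<lambda>l. cmod (A l j)) {..<Suc i} \<le> M * L2_set (\<lambda>k. cmod (u k)) {..<Suc j}"
    using op_boundD[OF assms, where n = "Suc j" and u = u and m = "Suc i"] by simp
  also have "L2_set (\<lambda>k. cmod (u k)) {..<Suc j} = 1"
    by (simp add: L2_set_def u_def if_distrib[of cmod] if_distrib[of "\<lambda>x. x\<^sup>2"] cong: if_cong)
  finally show ?thesis
    using member_le_L2_set[of "{..<Suc i}" i "\<lambda>l. cmod (A l j)"] by simp
qed

lemma op_bound_nonneg: "op_bound A M \<Longrightarrow> M \<ge> 0"
  using op_bound_entry order_trans[OF norm_ge_zero] by blast

lemma op_bound_add:
  assumes "op_bound A a" "op_bound B b"
  shows "op_bound (\<lambda>i j. A i j + B i j) (a + b)"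
  unfolding op_bound_def
proof (intro allI)
  fix m n :: nat and u :: "nat \<Rightarrow> complex"
  let ?U = "L2_set (\<lambda>j. cmod (u j)) {..<n}"
  have "L2_set (\<lambda>i. cmod (\<Sum>j<n. (A i j + B i j) * u j)) {..<m}
      \<le> L2_set (\<lambda>i. cmod (\<Sum>j<n. A i j * u j) + cmod (\<Sum>j<n. B i j * u j)) {..<m}"
    by (intro L2_set_mono) (auto simp: distrib_right sum.distrib norm_triangle_ineq)
  also have "\<dots> \<le> L2_set (\<lambda>i. cmod (\<Sum>j<n. A i j * u j)) {..<m} + L2_set (\<lambda>i. cmod (\<Sum>j<n. B i j * u j)) {..<m}"
    by (rule L2_set_triangle_ineq)
  also have "\<dots> \<le> a * ?U + b * ?U"
    by (intro add_mono op_boundD assms)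
  finally show "L2_set (\<lambda>i. cmod (\<Sum>j<n. (A i j + B i j) * u j)) {..<m} \<le> (a + b) * ?U"
    by (simp add: distrib_right)
qed

lemma op_bound_mono: "op_bound A M \<Longrightarrow> M \<le> M' \<Longrightarrow> op_bound A M'"
  unfolding op_bound_def by (meson L2_set_nonneg mult_right_mono order_trans)

lemma op_bound_row_scale:
  assumes "op_bound A M" "\<And>i. cmod (a i) \<le> c"
  shows "op_bound (\<lambda>i j. a i * A i j) (c * M)"
  unfolding op_bound_def
proof (intro allI)
  fix m n :: nat and u :: "nat \<Rightarrow> complex"
  have c: "c \<ge> 0" using assms(2) order_trans[OF norm_ge_zero] by blast
  have "L2_set (\<lambda>i. cmod (\<Sum>j<n. a i * A i j * u j)) {..<m} \<le> L2_set (\<lambda>i. c * cmod (\<Sum>j<n. A i j * u j)) {..<m}"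
    using assms(2) by (intro L2_set_mono) (auto simp: mult.assoc norm_mult mult_right_mono simp flip: sum_distrib_left)
  also have "\<dots> = c * L2_set (\<lambda>i. cmod (\<Sum>j<n. A i j * u j)) {..<m}"
    using c by (simp add: L2_set_right_distrib)
  also have "\<dots> \<le> c * (M * L2_set (\<lambda>j. cmod (u j)) {..<n})"
    by (intro mult_left_mono op_boundD assms c)
  finally show "L2_set (\<lambda>i. cmod (\<Sum>j<n. a i * A i j * u j)) {..<m} \<le> c * M * L2_set (\<lambda>j. cmod (u j)) {..<n}"
    by (simp add: mult.assoc)
qed

lemma op_bound_col_scale:
  assumes "op_bound A M" "\<And>j. cmod (a j) \<le> c"
  shows "op_bound (\<lambda>i j. a j * A i j) (c * M)"
  unfolding op_bound_def
proof (intro allI)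
  fix m n :: nat and u :: "nat \<Rightarrow> complex"
  have c: "c \<ge> 0" using assms(2) order_trans[OF norm_ge_zero] by blast
  have "L2_set (\<lambda>i. cmod (\<Sum>j<n. A i j * (a j * u j))) {..<m} \<le> M * L2_set (\<lambda>j. cmod (a j * u j)) {..<n}"
    by (intro op_boundD assms)
  also have "\<dots> \<le> M * L2_set (\<lambda>j. c * cmod (u j)) {..<n}"
    using assms(2) op_bound_nonneg[OF assms(1)]
    by (intro mult_left_mono L2_set_mono) (auto simp: norm_mult mult_right_mono)
  finally show "L2_set (\<lambda>i. cmod (\<Sum>j<n. a j * A i j * u j)) {..<m} \<le> c * M * L2_set (\<lambda>j. cmod (u j)) {..<n}"
    using c by (simp add: mult_ac L2_set_right_distrib)
qed

text \<open>Estimate the \<open>i\<close>-th entry of the product by the norm of \<open>A\<close> applied to \<open>u\<close> weighted by the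
  \<open>i\<close>-th row of the multiplier, and sum over \<open>i\<close>.\<close>

lemma op_bound_schur:
  assumes A: "op_bound A M" and c: "c \<ge> 0" "\<And>m j. (\<Sum>i<m. (cmod (w i j))\<^sup>2) \<le> c\<^sup>2"
  shows "op_bound (\<lambda>i j. w i j * A i j) (c * M)"
proof (rule op_bound_sqI)
  have M: "M \<ge> 0" using op_bound_nonneg[OF A] .
  then show "c * M \<ge> 0" using c by simp
  fix m n :: nat and u :: "nat \<Rightarrow> complex"
  have "(\<Sum>i<m. (cmod (\<Sum>j<n. w i j * A i j * u j))\<^sup>2) \<le> (\<Sum>i<m. M\<^sup>2 * (\<Sum>j<n. (cmod (w i j * u j))\<^sup>2))"
  proof (rule sum_mono)
    fix i assume i: "i \<in> {..<m}"
    have "(cmod (\<Sum>j<n. w i j * A i j * u j))\<^sup>2 = (cmod (\<Sum>j<n. A i j * (w i j * u j)))\<^sup>2"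
      by (simp add: mult_ac)
    also have "\<dots> \<le> (\<Sum>i'<m. (cmod (\<Sum>j<n. A i' j * (w i j * u j)))\<^sup>2)"
      using i by (intro member_le_sum) auto
    also have "\<dots> \<le> M\<^sup>2 * (\<Sum>j<n. (cmod (w i j * u j))\<^sup>2)"
      by (rule op_bound_sq[OF A M])
    finally show "(cmod (\<Sum>j<n. w i j * A i j * u j))\<^sup>2 \<le> M\<^sup>2 * (\<Sum>j<n. (cmod (w i j * u j))\<^sup>2)" .
  qed
  also have "\<dots> = M\<^sup>2 * (\<Sum>j<n. (\<Sum>i<m. (cmod (w i j))\<^sup>2) * (cmod (u j))\<^sup>2)"
    unfolding sum_distrib_left[symmetric] sum_distrib_right
    by (subst sum.swap) (simp add: norm_mult power_mult_distrib)
  also have "\<dots> \<le> M\<^sup>2 * (\<Sum>j<n. c\<^sup>2 * (cmod (u j))\<^sup>2)"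
    by (intro mult_left_mono sum_mono mult_right_mono c) auto
  finally show "(\<Sum>i<m. (cmod (\<Sum>j<n. w i j * A i j * u j))\<^sup>2) \<le> (c * M)\<^sup>2 * (\<Sum>j<n. (cmod (u j))\<^sup>2)"
    by (simp add: power_mult_distrib mult_ac flip: sum_distrib_left)
qed

text \<open>Tested on the conjugate of the truncated \<open>i\<close>-th row, the bound reads s^2
  \<le> M^2 s for the truncated sum of squares s. Square-summable rows are what makes
  \<open>mat_apply\<close> converge on all of \<open>ell2\<close>.\<close>

lemma op_bound_row_summable:
  assumes "op_bound A M"
  shows "summable (\<lambda>j. (cmod (A i j))\<^sup>2)"
proof (rule summableI_nonneg_bounded)
  have M: "M \<ge> 0" using op_bound_nonneg[OF assms] .
  fix n
  let ?s = "\<Sum>j<n. (cmod (A i j))\<^sup>2"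
  have s0: "?s \<ge> 0" by (simp add: sum_nonneg)
  have "(cmod (\<Sum>j<n. A i j * cnj (A i j)))\<^sup>2 \<le> (\<Sum>l<Suc i. (cmod (\<Sum>j<n. A l j * cnj (A i j)))\<^sup>2)"
    by (intro member_le_sum) auto
  also have "\<dots> \<le> M\<^sup>2 * ?s"
    using op_bound_sq[OF assms M, where n = n and u = "\<lambda>j. cnj (A i j)" and m = "Suc i"] by simp
  also have "(\<Sum>j<n. A i j * cnj (A i j)) = of_real ?s"
    by (simp add: complex_norm_square flip: of_real_power)
  also have "cmod (of_real ?s) = ?s"
    using s0 by (simp only: norm_of_real abs_of_nonneg)
  finally have "?s * ?s \<le> M\<^sup>2 * ?s"
    by (simp only: power2_eq_square)
  then show "?s \<le> M\<^sup>2"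
    using s0 by (cases "?s = 0") (auto simp: mult_le_cancel_right)
qed simp

lemma summable_mult_l2:
  fixes f g :: "nat \<Rightarrow> complex"
  assumes "summable (\<lambda>j. (cmod (f j))\<^sup>2)" "summable (\<lambda>j. (cmod (g j))\<^sup>2)"
  shows "summable (\<lambda>j. f j * g j)"
proof (rule summable_comparison_test')
  show "summable (\<lambda>j. (cmod (f j))\<^sup>2 + (cmod (g j))\<^sup>2)"
    using assms by (rule summable_add)
  show "norm (f j * g j) \<le> (cmod (f j))\<^sup>2 + (cmod (g j))\<^sup>2" for j
  proof -
    have "2 * (cmod (f j) * cmod (g j)) \<le> (cmod (f j))\<^sup>2 + (cmod (g j))\<^sup>2"
      using sum_squares_bound[of "cmod (f j)" "cmod (g j)"] by simp
    moreover have "0 \<le> cmod (f j) * cmod (g j)" by simp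
    ultimately show ?thesis unfolding norm_mult by linarith
  qed
qed

text \<open>\<open>op_bound\<close> speaks of finite sections only, so the estimates below need no
  convergence of series; this is the bridge to the operator norm. In one direction the number of
  columns and then the number of rows tends to infinity; in the other a finite vector is normalised
  and extended by zero.\<close>

lemma op_norm_le_iff:
  assumes M: "M \<ge> 0"
  shows "op_norm A \<le> ennreal M \<longleftrightarrow> op_bound A M"
proof
  assume A: "op_bound A M"
  have u: "(\<forall>i. summable (\<lambda>j. A i j * u j)) \<and> mat_apply A u \<in> ell2 \<and> ell2_norm (mat_apply A u) \<le> M * ell2_norm u"
    if u: "u \<in> ell2" for u
  proof -
    have us: "summable (\<lambda>j. (cmod (u j))\<^sup>2)" using u by (simp add: ell2_def)
    have s: "summable (\<lambda>j. A i j * u j)" for i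
      using op_bound_row_summable[OF A] us by (rule summable_mult_l2)
    have lim: "(\<lambda>n. \<Sum>j<n. A i j * u j) \<longlonglongrightarrow> mat_apply A u i" for i
      using summable_LIMSEQ[OF s] by (simp add: mat_apply_def)
    have bd: "(\<Sum>i<m. (cmod (mat_apply A u i))\<^sup>2) \<le> M\<^sup>2 * (\<Sum>j. (cmod (u j))\<^sup>2)" for m
    proof (rule LIMSEQ_le_const2)
      show "(\<lambda>n. \<Sum>i<m. (cmod (\<Sum>j<n. A i j * u j))\<^sup>2) \<longlonglongrightarrow> (\<Sum>i<m. (cmod (mat_apply A u i))\<^sup>2)"
        by (intro tendsto_intros lim)
      show "\<exists>N. \<forall>n\<ge>N. (\<Sum>i<m. (cmod (\<Sum>j<n. A i j * u j))\<^sup>2) \<le> M\<^sup>2 * (\<Sum>j. (cmod (u j))\<^sup>2)"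
        using us by (intro exI[of _ 0] allI impI order_trans[OF op_bound_sq[OF A M]] mult_left_mono sum_le_suminf) auto
    qed
    have sm: "summable (\<lambda>i. (cmod (mat_apply A u i))\<^sup>2)"
      by (rule summableI_nonneg_bounded[OF _ bd]) simp
    have "ell2_norm (mat_apply A u) \<le> sqrt (M\<^sup>2 * (\<Sum>j. (cmod (u j))\<^sup>2))"
      unfolding ell2_norm_def by (intro real_sqrt_le_mono suminf_le_const[OF sm bd])
    then show ?thesis
      using s sm M by (auto simp: ell2_def ell2_norm_def real_sqrt_mult)
  qed
  then have "acts_on_ell2 A" by (auto simp: acts_on_ell2_def)
  moreover have "ell2_norm (mat_apply A u) \<le> M" if "u \<in> ell2" "ell2_norm u \<le> 1" for u
    using u[OF that(1)] mult_left_mono[OF that(2) M] by simp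
  ultimately show "op_norm A \<le> ennreal M"
    by (auto simp: op_norm_def intro!: SUP_least ennreal_leI)
next
  assume le: "op_norm A \<le> ennreal M"
  then have act: "acts_on_ell2 A" by (auto simp: op_norm_def top_unique split: if_splits)
  show "op_bound A M"
  proof (rule op_bound_sqI[OF M])
    fix m n :: nat and u :: "nat \<Rightarrow> complex"
    define S where "S = (\<Sum>j<n. (cmod (u j))\<^sup>2)"
    have S0: "S \<ge> 0" by (simp add: S_def sum_nonneg)
    show "(\<Sum>i<m. (cmod (\<Sum>j<n. A i j * u j))\<^sup>2) \<le> M\<^sup>2 * (\<Sum>j<n. (cmod (u j))\<^sup>2)"
    proof (cases "S = 0")
      case True
      then have "\<forall>j\<in>{..<n}. (cmod (u j))\<^sup>2 = 0"
        unfolding S_def by (subst (asm) sum_nonneg_eq_0_iff) auto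
      then show ?thesis by simp
    next
      case False
      define U where "U j = (if j < n then u j / sqrt S else 0)" for j
      have sU: "(\<lambda>j. (cmod (U j))\<^sup>2) sums 1"
      proof -
        have "(\<lambda>j. (cmod (U j))\<^sup>2) sums (\<Sum>j\<in>{..<n}. (cmod (U j))\<^sup>2)"
          by (rule sums_finite) (auto simp: U_def)
        also have "(\<Sum>j\<in>{..<n}. (cmod (U j))\<^sup>2) = S / S"
          unfolding S_def sum_divide_distrib
          by (intro sum.cong) (use S0 in \<open>auto simp: U_def norm_divide power_divide S_def\<close>)
        finally show ?thesis using False by simp
      qed
      then have U: "U \<in> ell2" "ell2_norm U = 1"
        by (auto simp: ell2_def ell2_norm_def sums_iff)
      then have "ennreal (ell2_norm (mat_apply A U)) \<le> op_norm A"
        using act by (auto simp: op_norm_def intro!: SUP_upper)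
      then have *: "ell2_norm (mat_apply A U) \<le> M"
        using le M by (metis ennreal_le_iff order_trans)
      have mU: "mat_apply A U i = (\<Sum>j<n. A i j * u j) / sqrt S" for i
      proof -
        have "mat_apply A U i = (\<Sum>j<n. A i j * U j)"
          unfolding mat_apply_def by (rule suminf_finite) (auto simp: U_def)
        also have "\<dots> = (\<Sum>j<n. A i j * u j / sqrt S)"
          by (intro sum.cong) (auto simp: U_def)
        finally show ?thesis by (simp only: sum_divide_distrib)
      qed
      have sm: "summable (\<lambda>i. (cmod (mat_apply A U i))\<^sup>2)"
        using act U by (auto simp: acts_on_ell2_def ell2_def)
      have "(\<Sum>i<m. (cmod (mat_apply A U i))\<^sup>2) \<le> (ell2_norm (mat_apply A U))\<^sup>2"
        unfolding ell2_norm_def using sum_le_suminf[OF sm, of "{..<m}"] suminf_nonneg[OF sm] by simp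
      also have "\<dots> \<le> M\<^sup>2"
        using * suminf_nonneg[OF sm] by (intro power_mono) (auto simp: ell2_norm_def)
      also have "(\<Sum>i<m. (cmod (mat_apply A U i))\<^sup>2) = (\<Sum>i<m. (cmod (\<Sum>j<n. A i j * u j))\<^sup>2) / S"
      proof -
        have "(cmod (mat_apply A U i))\<^sup>2 = (cmod (\<Sum>j<n. A i j * u j))\<^sup>2 / S" for i
          unfolding mU norm_divide power_divide using S0 by simp
        then show ?thesis by (simp only: sum_divide_distrib)
      qed
      finally show ?thesis
        using S0 False by (simp add: S_def[symmetric] divide_le_eq)
    qed
  qed
qed

lemma weight_norm_le_iff:
  "M \<ge> 0 \<Longrightarrow> weight_norm \<alpha> A \<le> ennreal M \<longleftrightarrow> (\<forall>i j. real (min i j + 1) powr \<alpha> * cmod (A i j) \<le> M)"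
  by (simp add: weight_norm_def SUP_le_iff ennreal_le_iff)

lemma hat_norm_le_iff:
  "M \<ge> 0 \<Longrightarrow> hat_norm \<alpha> A \<le> ennreal M \<longleftrightarrow>
     op_bound A M \<and> (\<forall>i j. real (min i j + 1) powr \<alpha> * cmod (Delta A i j) \<le> M)"
  by (simp add: hat_norm_def op_norm_le_iff weight_norm_le_iff)

lemma hat_plus_norm_le_iff:
  "M \<ge> 0 \<Longrightarrow> hat_plus_norm \<alpha> A \<le> ennreal M \<longleftrightarrow>
     op_bound A M \<and> op_bound (commutator_diag num_diag A) M \<and>
     (\<forall>i j. real (min i j + 1) powr \<alpha> * cmod (Delta A i j) \<le> M) \<and>
     (\<forall>i j. real (min i j + 1) powr \<alpha> * cmod (commutator_diag num_diag (Delta A) i j) \<le> M)"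
  by (simp add: hat_plus_norm_def op_norm_le_iff weight_norm_le_iff)

text \<open>Infinite values are allowed and homogeneity is only an inequality. For c = 0 the
  convention 0 * \<infinity> = 0 makes it say that the zero matrix has norm 0; for other
  \<open>c\<close> the reverse inequality follows by scaling back with 1 / c.\<close>

locale mat_seminorm =
  fixes nrm :: "imat \<Rightarrow> ennreal"
  assumes tri: "nrm (\<lambda>i j. A i j + B i j) \<le> nrm A + nrm B"
    and hom: "nrm (\<lambda>i j. c * A i j) \<le> ennreal (cmod c) * nrm A"

text \<open>All norms are handled through the predicate of being at most a real \<open>M\<close>, so
  the axioms only have to be checked for real bounds. If the norm of \<open>A\<close> is infinite, c
  = 0 is a case of its own because the right-hand side is then 0.\<close>

lemma mat_seminormI:
  fixes nrm :: "imat \<Rightarrow> ennreal" and bd :: "imat \<Rightarrow> real \<Rightarrow> bool"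
  assumes iff: "\<And>A M. M \<ge> 0 \<Longrightarrow> nrm A \<le> ennreal M \<longleftrightarrow> bd A M"
    and tri: "\<And>A B a b. a \<ge> 0 \<Longrightarrow> b \<ge> 0 \<Longrightarrow> bd A a \<Longrightarrow> bd B b \<Longrightarrow> bd (\<lambda>i j. A i j + B i j) (a + b)"
    and hom: "\<And>A a c. a \<ge> 0 \<Longrightarrow> bd A a \<Longrightarrow> bd (\<lambda>i j. c * A i j) (cmod c * a)"
    and zero: "bd (\<lambda>i j. 0) 0"
  shows "mat_seminorm nrm"
proof
  fix A B :: imat and c :: complex
  show "nrm (\<lambda>i j. A i j + B i j) \<le> nrm A + nrm B"
  proof (cases "nrm A = \<infinity> \<or> nrm B = \<infinity>")
    case False
    then obtain a b where ab: "nrm A = ennreal a" "a \<ge> 0" "nrm B = ennreal b" "b \<ge> 0"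
      by (metis ennreal_cases infinity_ennreal_def)
    then have "bd (\<lambda>i j. A i j + B i j) (a + b)"
      using iff tri by (metis order_refl)
    then show ?thesis using ab iff by (simp flip: ennreal_plus)
  qed auto
  show "nrm (\<lambda>i j. c * A i j) \<le> ennreal (cmod c) * nrm A"
  proof (cases "nrm A = \<infinity>")
    case True
    show ?thesis
    proof (cases "c = 0")
      case True
      then show ?thesis using iff[of 0 "\<lambda>i j. 0"] zero by simp
    next
      case False
      then show ?thesis using True by (simp add: ennreal_mult_top)
    qed
  next
    case False
    then obtain a where a: "nrm A = ennreal a" "a \<ge> 0"
      by (metis ennreal_cases infinity_ennreal_def)
    then have "bd (\<lambda>i j. c * A i j) (cmod c * a)"
      using iff hom by (metis order_refl)
    then show ?thesis using a iff by (simp flip: ennreal_mult)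
  qed
qed

lemma op_bound_zero: "op_bound (\<lambda>i j. 0) 0"
  by (simp add: op_bound_def L2_set_def)

lemma weight_add:
  fixes w a b :: real and x y :: complex
  assumes "w \<ge> 0" "w * cmod x \<le> a" "w * cmod y \<le> b"
  shows "w * cmod (x + y) \<le> a + b"
  using mult_left_mono[OF norm_triangle_ineq[of x y] assms(1)] assms by (simp add: distrib_left)

lemma weight_cmult:
  fixes w a :: real and x c :: complex
  assumes "w * cmod x \<le> a"
  shows "w * cmod (c * x) \<le> cmod c * a"
  using mult_left_mono[OF assms norm_ge_zero[of c]] by (simp add: norm_mult mult_ac)

lemma op_bound_cmult: "op_bound A M \<Longrightarrow> op_bound (\<lambda>i j. c * A i j) (cmod c * M)"
  using op_bound_row_scale[of A M "\<lambda>_. c" "cmod c"] by simp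

lemma commutator_add:
  "commutator_diag d (\<lambda>i j. A i j + B i j) = (\<lambda>i j. commutator_diag d A i j + commutator_diag d B i j)"
  by (simp add: commutator_diag_def distrib_left)

lemma commutator_cmult:
  "commutator_diag d (\<lambda>i j. c * A i j) = (\<lambda>i j. c * commutator_diag d A i j)"
  by (simp add: commutator_diag_def mult_ac)

lemma Delta_add: "Delta (\<lambda>i j. A i j + B i j) = (\<lambda>i j. Delta A i j + Delta B i j)"
  by (simp add: Delta_def fun_eq_iff)

lemma Delta_cmult: "Delta (\<lambda>i j. c * A i j) = (\<lambda>i j. c * Delta A i j)"
  by (simp add: Delta_def right_diff_distrib)

lemma mat_seminorm_hat: "mat_seminorm (hat_norm \<alpha>)"
proof (rule mat_seminormI[OF hat_norm_le_iff])
  show "op_bound (\<lambda>i j. 0) 0 \<and> (\<forall>i j. real (min i j + 1) powr \<alpha> * cmod (Delta (\<lambda>i j. 0) i j) \<le> 0)"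
    by (simp add: op_bound_zero Delta_def)
qed (auto simp: Delta_add Delta_cmult intro!: op_bound_add op_bound_cmult weight_add weight_cmult)

lemma mat_seminorm_hat_plus: "mat_seminorm (hat_plus_norm \<alpha>)"
proof (rule mat_seminormI[OF hat_plus_norm_le_iff])
  show "op_bound (\<lambda>i j. 0) 0 \<and> op_bound (commutator_diag num_diag (\<lambda>i j. 0)) 0 \<and>
     (\<forall>i j. real (min i j + 1) powr \<alpha> * cmod (Delta (\<lambda>i j. 0) i j) \<le> 0) \<and>
     (\<forall>i j. real (min i j + 1) powr \<alpha> * cmod (commutator_diag num_diag (Delta (\<lambda>i j. 0)) i j) \<le> 0)"
    by (simp add: op_bound_zero Delta_def commutator_diag_def)
qed (auto simp: Delta_add Delta_cmult commutator_add commutator_cmult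
      intro!: op_bound_add op_bound_cmult weight_add weight_cmult)

lemma hat_norm_le_hat_plus_norm: "hat_norm \<alpha> A \<le> hat_plus_norm \<alpha> A"
  by (auto simp: hat_norm_def hat_plus_norm_def le_max_iff_disj)

section \<open>Linear functionals that detect the norm of a matrix\<close>

definition hat_tests :: "real \<Rightarrow> (imat \<Rightarrow> complex) set" where
  "hat_tests \<alpha> =
     {\<lambda>A. \<Sum>i<m. \<Sum>j<n. v i * u j * A i j | m n u v.
        (\<Sum>j<n. (cmod (u j))\<^sup>2) \<le> 1 \<and> (\<Sum>i<m. (cmod (v i))\<^sup>2) \<le> 1} \<union>
     {\<lambda>A. of_real (real (min i j + 1) powr \<alpha>) * Delta A i j | i j. True}"

lemma op_bound_bilinear:
  assumes A: "op_bound A M" and u: "(\<Sum>j<n. (cmod (u j))\<^sup>2) \<le> 1" and v: "(\<Sum>i<m. (cmod (v i))\<^sup>2) \<le> 1"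
  shows "cmod (\<Sum>i<m. \<Sum>j<n. v i * u j * A i j) \<le> M"
proof -
  define w where "w i = (\<Sum>j<n. A i j * u j)" for i
  have "(\<Sum>i<m. \<Sum>j<n. v i * u j * A i j) = (\<Sum>i<m. v i * w i)"
    by (simp add: w_def sum_distrib_left mult_ac)
  also have "cmod \<dots> \<le> (\<Sum>i<m. \<bar>cmod (v i)\<bar> * \<bar>cmod (w i)\<bar>)"
    by (rule order_trans[OF norm_sum]) (simp add: norm_mult)
  also have "\<dots> \<le> L2_set (\<lambda>i. cmod (v i)) {..<m} * L2_set (\<lambda>i. cmod (w i)) {..<m}"
    by (rule L2_set_mult_ineq)
  also have "\<dots> \<le> 1 * (M * 1)"
  proof (intro mult_mono)
    show "L2_set (\<lambda>i. cmod (v i)) {..<m} \<le> 1"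
      using v by (simp add: L2_set_def)
    have "L2_set (\<lambda>i. cmod (w i)) {..<m} \<le> M * L2_set (\<lambda>j. cmod (u j)) {..<n}"
      unfolding w_def by (rule op_boundD[OF A])
    also have "\<dots> \<le> M * 1"
      using u op_bound_nonneg[OF A] by (intro mult_left_mono) (simp_all add: L2_set_def)
    finally show "L2_set (\<lambda>i. cmod (w i)) {..<m} \<le> M * 1" .
  qed (auto simp: L2_set_nonneg)
  finally show ?thesis by simp
qed

text \<open>Duality in finite dimension: the length of w = A u is attained by pairing w with its own
  conjugate, divided by that length. The degenerate cases of a zero vector are split off before
  dividing.\<close>

lemma op_boundI_bilinear:
  assumes "\<And>m n u v. (\<Sum>j<n. (cmod (u j))\<^sup>2) \<le> 1 \<Longrightarrow> (\<Sum>i<m. (cmod (v i))\<^sup>2) \<le> 1 \<Longrightarrow>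
      cmod (\<Sum>i<m. \<Sum>j<n. v i * u j * A i j) \<le> M"
  shows "op_bound A M"
  unfolding op_bound_def
proof (intro allI)
  fix m n :: nat and u :: "nat \<Rightarrow> complex"
  define w where "w i = (\<Sum>j<n. A i j * u j)" for i
  define a where "a = L2_set (\<lambda>j. cmod (u j)) {..<n}"
  define b where "b = L2_set (\<lambda>i. cmod (w i)) {..<m}"
  have M: "M \<ge> 0" using assms[where n = 0 and m = 0] by simp
  have a2: "a\<^sup>2 = (\<Sum>j<n. (cmod (u j))\<^sup>2)" and b2: "b\<^sup>2 = (\<Sum>i<m. (cmod (w i))\<^sup>2)"
    by (simp_all add: a_def b_def L2_set_def sum_nonneg)
  have ab: "a \<ge> 0" "b \<ge> 0" by (simp_all add: a_def b_def L2_set_nonneg)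
  have "b \<le> M * a"
  proof (cases "a = 0 \<or> b = 0")
    case True
    then show ?thesis
    proof
      assume "a = 0"
      then have "\<forall>j\<in>{..<n}. u j = 0" by (simp add: a_def L2_set_eq_0_iff)
      then have "w i = 0" for i by (simp add: w_def)
      then have "b = 0" by (simp add: b_def L2_set_def)
      then show ?thesis using M ab by simp
    qed (use M ab in simp)
  next
    case False
    then have ab: "a > 0" "b > 0" using ab by auto
    have "cmod (\<Sum>i<m. \<Sum>j<n. (cnj (w i) / b) * (u j / a) * A i j) \<le> M"
    proof (rule assms)
      show "(\<Sum>j<n. (cmod (u j / complex_of_real a))\<^sup>2) \<le> 1"
        using ab by (simp add: norm_divide power_divide a2[symmetric] flip: sum_divide_distrib)
      show "(\<Sum>i<m. (cmod (cnj (w i) / complex_of_real b))\<^sup>2) \<le> 1"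
        using ab by (simp add: norm_divide power_divide b2[symmetric] flip: sum_divide_distrib)
    qed
    also have "(\<Sum>i<m. \<Sum>j<n. (cnj (w i) / b) * (u j / a) * A i j) = (\<Sum>i<m. (cnj (w i) / b) * (w i / a))"
    proof (rule sum.cong)
      fix i
      have "(\<Sum>j<n. (cnj (w i) / b) * (u j / a) * A i j) = (\<Sum>j<n. (cnj (w i) / b / a) * (A i j * u j))"
        by (intro sum.cong) simp_all
      also have "\<dots> = (cnj (w i) / b) * (w i / a)"
        unfolding sum_distrib_left[symmetric] w_def[symmetric] by simp
      finally show "(\<Sum>j<n. (cnj (w i) / b) * (u j / a) * A i j) = (cnj (w i) / b) * (w i / a)" .
    qed simp
    also have "\<dots> = of_real (b\<^sup>2) / (b * a)"
      unfolding b2 by (simp add: sum_divide_distrib complex_norm_square mult_ac flip: of_real_power)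
    also have "\<dots> = of_real (b / a)" using ab by (simp add: power2_eq_square)
    finally show ?thesis using ab by (simp add: divide_le_eq norm_divide)
  qed
  then show "L2_set (\<lambda>i. cmod (\<Sum>j<n. A i j * u j)) {..<m} \<le> M * L2_set (\<lambda>j. cmod (u j)) {..<n}"
    by (simp add: a_def b_def w_def)
qed

lemma hat_norm_le_iff_tests:
  assumes M: "M \<ge> 0"
  shows "hat_norm \<alpha> A \<le> ennreal M \<longleftrightarrow> (\<forall>f\<in>hat_tests \<alpha>. cmod (f A) \<le> M)"
  unfolding hat_norm_le_iff[OF M]
proof safe
  fix f assume "f \<in> hat_tests \<alpha>" "op_bound A M"
    "\<forall>i j. real (min i j + 1) powr \<alpha> * cmod (Delta A i j) \<le> M"
  then show "cmod (f A) \<le> M"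
    by (auto simp: hat_tests_def norm_mult intro!: op_bound_bilinear)
next
  assume *: "\<forall>f\<in>hat_tests \<alpha>. cmod (f A) \<le> M"
  show "op_bound A M"
  proof (rule op_boundI_bilinear)
    fix m n :: nat and u v :: "nat \<Rightarrow> complex"
    assume "(\<Sum>j<n. (cmod (u j))\<^sup>2) \<le> 1" "(\<Sum>i<m. (cmod (v i))\<^sup>2) \<le> 1"
    then have "(\<lambda>A. \<Sum>i<m. \<Sum>j<n. v i * u j * A i j) \<in> hat_tests \<alpha>"
      unfolding hat_tests_def by blast
    from bspec[OF * this] show "cmod (\<Sum>i<m. \<Sum>j<n. v i * u j * A i j) \<le> M" .
  qed
  fix i j
  have "(\<lambda>A. of_real (real (min i j + 1) powr \<alpha>) * Delta A i j) \<in> hat_tests \<alpha>"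
    unfolding hat_tests_def by blast
  from bspec[OF * this] show "real (min i j + 1) powr \<alpha> * cmod (Delta A i j) \<le> M"
    by (simp add: norm_mult)
qed

lemma hat_tests_finite_sum:
  assumes "f \<in> hat_tests \<alpha>"
  shows "\<exists>I w. finite (I :: (nat \<times> nat) set) \<and> (\<forall>A. f A = (\<Sum>p\<in>I. w p * A (fst p) (snd p)))"
  using assms unfolding hat_tests_def
proof (elim UnE CollectE exE conjE)
  fix m n :: nat and u v assume f: "f = (\<lambda>A. \<Sum>i<m. \<Sum>j<n. v i * u j * A i j)"
  show ?thesis
    by (intro exI[of _ "{..<m} \<times> {..<n}"] exI[of _ "\<lambda>p. v (fst p) * u (snd p)"])
      (simp add: f sum.cartesian_product case_prod_unfold)
next
  fix i j assume f: "f = (\<lambda>A. of_real (real (min i j + 1) powr \<alpha>) * Delta A i j)"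
  show ?thesis
    by (intro exI[of _ "{(i, j), (i + 1, j + 1)}"]
          exI[of _ "\<lambda>p. (if p = (i, j) then - 1 else 1) * of_real (real (min i j + 1) powr \<alpha>)"])
      (simp add: f Delta_def algebra_simps)
qed

section \<open>Schur multipliers that decay off the diagonal\<close>

text \<open>Up to the factor 1 / \<kappa> this is the size of the reciprocal of a divisor that is
  bounded below by \<kappa> (1 + |i - j|).\<close>

definition decay :: "nat \<Rightarrow> nat \<Rightarrow> real" where
  "decay i j = 1 / (1 + \<bar>real i - real j\<bar>)"

lemma decay_pos: "decay i j > 0" and decay_le_1: "decay i j \<le> 1" and decay_diag [simp]: "decay i i = 1"
  and decay_dist: "\<bar>real i - real j\<bar> * decay i j \<le> 1"
  by (auto simp: decay_def)

lemma decay_Suc [simp]: "decay (Suc i) (Suc j) = decay i j"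
  by (simp add: decay_def)

text \<open>The bound is 2 + 2: the part of a column up to the diagonal and the part beyond it are
  both dominated by the sum of 1 / l^2 over l \<ge> 1, which is at most 2.\<close>

lemma sum_decay_sq: "(\<Sum>i<m. (decay i j)\<^sup>2) \<le> 4"
proof -
  have basel: "(\<Sum>l<L. (1 / (1 + real l))\<^sup>2) \<le> 2" for L
  proof -
    \<comment> \<open>The subtracted term makes the induction work: the next summand is at most the
      difference of two consecutive reciprocals.\<close>
    have "(\<Sum>l<Suc L. (1 / (1 + real l))\<^sup>2) \<le> 2 - 1 / (1 + real L)" for L
    proof (induction L)
      case (Suc L)
      have "(1 / (2 + real L))\<^sup>2 \<le> 1 / (1 + real L) - 1 / (2 + real L)"
      proof -
        have "(1 / (2 + real L))\<^sup>2 \<le> 1 / ((1 + real L) * (2 + real L))"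
          unfolding power_one_over unfolding power2_eq_square by (intro divide_left_mono mult_right_mono) auto
        also have "\<dots> = 1 / (1 + real L) - 1 / (2 + real L)" by (simp add: field_simps)
        finally show ?thesis .
      qed
      with Suc show ?case by (simp add: add_ac)
    qed simp
    moreover have "2 - 1 / (1 + real L) \<le> 2" for L by simp
    ultimately have S: "(\<Sum>l<Suc L. (1 / (1 + real l))\<^sup>2) \<le> 2" for L by (rule order_trans)
    show ?thesis
    proof (cases L)
      case (Suc L')
      show ?thesis unfolding Suc by (rule S)
    qed simp
  qed
  have 1: "(\<Sum>i\<in>A. (decay i j)\<^sup>2) \<le> 2" if "A \<subseteq> {..j}" for A
  proof -
    have fin: "finite A" using that finite_subset by blast
    have "(\<Sum>i\<in>A. (decay i j)\<^sup>2) = (\<Sum>l\<in>(\<lambda>i. j - i) ` A. (1 / (1 + real l))\<^sup>2)"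
    proof (subst sum.reindex)
      show "inj_on (\<lambda>i. j - i) A"
      proof (rule inj_onI)
        fix x y assume "x \<in> A" "y \<in> A" "j - x = j - y"
        moreover from this have "x \<le> j" "y \<le> j" using that by auto
        ultimately show "x = y" by linarith
      qed
      have "decay i j = 1 / (1 + real (j - i))" if "i \<in> A" for i
      proof -
        have "i \<le> j" using that \<open>A \<subseteq> {..j}\<close> by auto
        then show ?thesis by (simp add: decay_def of_nat_diff)
      qed
      then show "(\<Sum>i\<in>A. (decay i j)\<^sup>2) = sum ((\<lambda>l. (1 / (1 + real l))\<^sup>2) \<circ> (\<lambda>i. j - i)) A"
        by simp
    qed
    also have "\<dots> \<le> (\<Sum>l<Suc j. (1 / (1 + real l))\<^sup>2)"
      using fin by (intro sum_mono2) auto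
    finally show ?thesis using basel[of "Suc j"] by linarith
  qed
  have 2: "(\<Sum>i\<in>A. (decay i j)\<^sup>2) \<le> 2" if "A \<subseteq> {j<..<m}" for A
  proof -
    have fin: "finite A" using that finite_subset by blast
    have "(\<Sum>i\<in>A. (decay i j)\<^sup>2) = (\<Sum>l\<in>(\<lambda>i. i - j) ` A. (1 / (1 + real l))\<^sup>2)"
    proof (subst sum.reindex)
      show "inj_on (\<lambda>i. i - j) A"
      proof (rule inj_onI)
        fix x y assume "x \<in> A" "y \<in> A" "x - j = y - j"
        moreover from this have "j < x" "j < y" using that by auto
        ultimately show "x = y" by linarith
      qed
      have "decay i j = 1 / (1 + real (i - j))" if "i \<in> A" for i
      proof -
        have "j < i" using that \<open>A \<subseteq> {j<..<m}\<close> by auto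
        then show ?thesis by (simp add: decay_def of_nat_diff)
      qed
      then show "(\<Sum>i\<in>A. (decay i j)\<^sup>2) = sum ((\<lambda>l. (1 / (1 + real l))\<^sup>2) \<circ> (\<lambda>i. i - j)) A"
        by simp
    qed
    also have "\<dots> \<le> (\<Sum>l<m. (1 / (1 + real l))\<^sup>2)"
    proof (rule sum_mono2)
      show "(\<lambda>i. i - j) ` A \<subseteq> {..<m}"
      proof clarsimp
        fix i assume "i \<in> A"
        then have "i < m" using that by auto
        then show "i - j < m" by linarith
      qed
    qed auto
    finally show ?thesis using basel[of "m"] by linarith
  qed
  have split: "{..<m} = ({..<m} \<inter> {..j}) \<union> ({..<m} \<inter> {j<..})" by auto
  have "(\<Sum>i<m. (decay i j)\<^sup>2) = (\<Sum>i\<in>{..<m} \<inter> {..j}. (decay i j)\<^sup>2) + (\<Sum>i\<in>{..<m} \<inter> {j<..}. (decay i j)\<^sup>2)"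
    by (subst split, rule sum.union_disjoint) auto
  also have "\<dots> \<le> 2 + 2" by (intro add_mono 1 2) auto
  finally show ?thesis by simp
qed

text \<open>The factor 2 is the square root of the column bound 4 from
  \<open>sum_decay_sq\<close>.\<close>

lemma op_bound_schur_decay:
  assumes A: "op_bound A M" and c: "c \<ge> 0" "\<And>i j. cmod (w i j) \<le> c * decay i j"
  shows "op_bound (\<lambda>i j. w i j * A i j) (2 * c * M)"
proof (rule op_bound_schur[OF A])
  show "(\<Sum>i<m. (cmod (w i j))\<^sup>2) \<le> (2 * c)\<^sup>2" for m j
  proof -
    have "(\<Sum>i<m. (cmod (w i j))\<^sup>2) \<le> (\<Sum>i<m. c\<^sup>2 * (decay i j)\<^sup>2)"
      using power_mono[OF c(2) norm_ge_zero, of _ _ 2] by (intro sum_mono) (simp add: power_mult_distrib)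
    also have "\<dots> \<le> c\<^sup>2 * 4"
      unfolding sum_distrib_left[symmetric] by (intro mult_left_mono sum_decay_sq) simp
    finally show ?thesis by (simp add: power_mult_distrib)
  qed
qed (use c in simp)

text \<open>The multiplier \<open>w\<close> will be the reciprocal of a small divisor; \<open>tail\<close> expresses that the
  divisor is \<open>2 (i - j)\<close> up to a bounded error, whence the gain of one power of the distance from
  the diagonal.\<close>

lemma hat_plus_norm_multiplier:
  assumes Q: "hat_norm \<alpha> Q \<le> ennreal H" "H \<ge> 0" and \<kappa>: "0 < \<kappa>" "\<kappa> \<le> 1" and c: "c \<ge> 0"
    and w: "\<And>i j. cmod (w i j) \<le> decay i j / \<kappa>"
    and tail: "\<And>i j. cmod (1/2 - (of_nat i - of_nat j) * w i j) \<le> c / \<kappa> * decay i j"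
    and dw: "\<And>i j. real (min i j + 1) powr \<alpha> * cmod (w (Suc i) (Suc j) - w i j) \<le> 2 / \<kappa>\<^sup>2 * (decay i j)\<^sup>2"
  shows "hat_plus_norm \<alpha> (\<lambda>i j. w i j * Q i j) \<le> ennreal ((2 * c + 4) / \<kappa>\<^sup>2 * H)"
proof -
  have Qo: "op_bound Q H" and Qd: "\<And>i j. real (min i j + 1) powr \<alpha> * cmod (Delta Q i j) \<le> H"
    using Q hat_norm_le_iff by blast+
  have k2: "1 / \<kappa> \<le> 1 / \<kappa>\<^sup>2" "1 \<le> 1 / \<kappa>" "1 / \<kappa>\<^sup>2 \<ge> 1"
    using \<kappa> power_le_one[of \<kappa> 2] mult_left_le[of \<kappa> \<kappa>] by (simp_all add: field_simps power2_eq_square)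
  have 1: "op_bound (\<lambda>i j. w i j * Q i j) ((2 * c + 4) / \<kappa>\<^sup>2 * H)"
  proof (rule op_bound_mono)
    show "op_bound (\<lambda>i j. w i j * Q i j) (2 * (1 / \<kappa>) * H)"
      using w \<kappa> by (intro op_bound_schur_decay Qo) auto
    have "2 * (1 / \<kappa>) \<le> 2 * (1 / \<kappa>\<^sup>2) + (2 * c + 2) * (1 / \<kappa>\<^sup>2)"
      using k2 c by (intro add_increasing2 mult_left_mono) auto
    also have "\<dots> = (2 * c + 4) / \<kappa>\<^sup>2" by (simp add: add_divide_distrib algebra_simps)
    finally show "2 * (1 / \<kappa>) * H \<le> (2 * c + 4) / \<kappa>\<^sup>2 * H"
      using Q(2) by (intro mult_right_mono)
  qed
  have 2: "op_bound (commutator_diag num_diag (\<lambda>i j. w i j * Q i j)) ((2 * c + 4) / \<kappa>\<^sup>2 * H)"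
  proof (rule op_bound_mono)
    \<comment> \<open>The unbounded factor i - j is harmless: (i - j) w Q is Q / 2 minus the product
      of Q with the multiplier estimated by \<open>tail\<close>, which decays again.\<close>
    have "op_bound (\<lambda>i j. (1/2) * Q i j + (- (1/2 - (of_nat i - of_nat j) * w i j)) * Q i j) (cmod (1/2) * H + 2 * (c / \<kappa>) * H)"
      using tail \<kappa> c by (intro op_bound_add op_bound_cmult op_bound_schur_decay Qo) (auto simp: norm_minus_commute)
    also have "(\<lambda>i j. (1/2) * Q i j + (- (1/2 - (of_nat i - of_nat j) * w i j)) * Q i j)
        = commutator_diag num_diag (\<lambda>i j. w i j * Q i j)"
      by (simp add: commutator_diag_def num_diag_def fun_eq_iff algebra_simps)
    finally show "op_bound (commutator_diag num_diag (\<lambda>i j. w i j * Q i j)) ((1/2 + 2 * (c / \<kappa>)) * H)"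
      by (simp add: distrib_right)
    have "1/2 + 2 * (c / \<kappa>) \<le> 4 * (1 / \<kappa>\<^sup>2) + 2 * c * (1 / \<kappa>\<^sup>2)"
      using k2 c mult_left_mono[OF k2(1), of "2 * c"] by (intro add_mono) (auto)
    also have "\<dots> = (2 * c + 4) / \<kappa>\<^sup>2" by (simp add: add_divide_distrib algebra_simps)
    finally show "(1/2 + 2 * (c / \<kappa>)) * H \<le> (2 * c + 4) / \<kappa>\<^sup>2 * H"
      using Q(2) by (intro mult_right_mono)
  qed
  \<comment> \<open>Discrete product rule for \<open>Delta\<close>. Both terms keep one factor
    \<open>decay i j\<close>, which is spent later on the factor |i - j| of the commutator with
    \<open>num_diag\<close>.\<close>
  have D: "real (min i j + 1) powr \<alpha> * cmod (Delta (\<lambda>i j. w i j * Q i j) i j) \<le> 3 / \<kappa>\<^sup>2 * H * decay i j" for i j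
  proof -
    let ?W = "real (min i j + 1) powr \<alpha>"
    have W: "?W \<ge> 0" by simp
    have d: "decay i j > 0" "decay i j \<le> 1" by (rule decay_pos decay_le_1)+
    have "Delta (\<lambda>i j. w i j * Q i j) i j = w (Suc i) (Suc j) * Delta Q i j + (w (Suc i) (Suc j) - w i j) * Q i j"
      by (simp add: Delta_def algebra_simps)
    then have "?W * cmod (Delta (\<lambda>i j. w i j * Q i j) i j)
       \<le> ?W * cmod (w (Suc i) (Suc j) * Delta Q i j) + ?W * cmod ((w (Suc i) (Suc j) - w i j) * Q i j)"
      using mult_left_mono[OF norm_triangle_ineq W, of "w (Suc i) (Suc j) * Delta Q i j" "(w (Suc i) (Suc j) - w i j) * Q i j"]
      by (simp only: distrib_left)
    also have "?W * cmod (w (Suc i) (Suc j) * Delta Q i j) = cmod (w (Suc i) (Suc j)) * (?W * cmod (Delta Q i j))"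
      by (simp add: norm_mult)
    also have "\<dots> \<le> decay i j / \<kappa> * H"
      using w[of "Suc i" "Suc j"] Qd[of i j] d \<kappa> by (intro mult_mono) auto
    also have "?W * cmod ((w (Suc i) (Suc j) - w i j) * Q i j) = (?W * cmod (w (Suc i) (Suc j) - w i j)) * cmod (Q i j)"
      by (simp add: norm_mult)
    also have "\<dots> \<le> 2 / \<kappa>\<^sup>2 * (decay i j)\<^sup>2 * H"
      by (intro mult_mono dw op_bound_entry[OF Qo]) auto
    also have "\<dots> \<le> 2 / \<kappa>\<^sup>2 * decay i j * H"
      using d Q(2) \<kappa> by (intro mult_right_mono mult_left_mono) (auto simp: power2_eq_square mult_left_le)
    also have "decay i j / \<kappa> * H \<le> decay i j * (1 / \<kappa>\<^sup>2) * H"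
    proof -
      have "decay i j * (1 / \<kappa>) \<le> decay i j * (1 / \<kappa>\<^sup>2)"
        using k2 d by (intro mult_left_mono) auto
      then show ?thesis using Q(2) by (intro mult_right_mono) auto
    qed
    finally show ?thesis by (simp add: algebra_simps)
  qed
  have 0: "3 / \<kappa>\<^sup>2 * H \<le> (2 * c + 4) / \<kappa>\<^sup>2 * H" "0 \<le> 3 / \<kappa>\<^sup>2 * H"
    using c Q(2) by (auto intro!: mult_right_mono divide_right_mono)
  have 3: "real (min i j + 1) powr \<alpha> * cmod (Delta (\<lambda>i j. w i j * Q i j) i j) \<le> (2 * c + 4) / \<kappa>\<^sup>2 * H" for i j
    using D[of i j] mult_left_mono[OF decay_le_1 0(2), of i j] 0(1) by simp
  have 4: "real (min i j + 1) powr \<alpha> * cmod (commutator_diag num_diag (Delta (\<lambda>i j. w i j * Q i j)) i j) \<le> (2 * c + 4) / \<kappa>\<^sup>2 * H" for i j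
  proof -
    have "cmod (num_diag i - num_diag j) = \<bar>real i - real j\<bar>"
    proof -
      have "num_diag i - num_diag j = of_real (real i - real j)" by (simp add: num_diag_def)
      then show ?thesis by (simp only: norm_of_real)
    qed
    then have "real (min i j + 1) powr \<alpha> * cmod (commutator_diag num_diag (Delta (\<lambda>i j. w i j * Q i j)) i j)
      = \<bar>real i - real j\<bar> * (real (min i j + 1) powr \<alpha> * cmod (Delta (\<lambda>i j. w i j * Q i j) i j))"
      by (simp add: commutator_diag_def norm_mult)
    also have "\<dots> \<le> \<bar>real i - real j\<bar> * (3 / \<kappa>\<^sup>2 * H * decay i j)"
      by (intro mult_left_mono D) simp
    also have "\<dots> = 3 / \<kappa>\<^sup>2 * H * (\<bar>real i - real j\<bar> * decay i j)" by simp
    also have "\<dots> \<le> 3 / \<kappa>\<^sup>2 * H * 1"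
      by (intro mult_left_mono decay_dist 0)
    finally show ?thesis using 0 by simp
  qed
  have "0 \<le> (2 * c + 4) / \<kappa>\<^sup>2 * H" using 0 by linarith
  then show ?thesis using 1 2 3 4 by (simp only: hat_plus_norm_le_iff) blast
qed

section \<open>Diagonal matrices and products with their differences\<close>

text \<open>\<open>Delta\<close> of a diagonal matrix is diagonal again, so both parts of the norm
  reduce to suprema along the diagonal.\<close>

lemma hat_norm_diag_iff:
  assumes "M \<ge> 0"
  shows "hat_norm \<alpha> (diag d) \<le> ennreal M \<longleftrightarrow>
    (\<forall>i. cmod (d i) \<le> M) \<and> (\<forall>i. real (i + 1) powr \<alpha> * cmod (d (Suc i) - d i) \<le> M)"
  unfolding hat_norm_le_iff[OF assms]
proof safe
  fix i
  assume "op_bound (diag d) M"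
  from op_bound_entry[OF this, of i i] show "cmod (d i) \<le> M" by (simp add: diag_def)
next
  fix i
  assume "\<forall>i j. real (min i j + 1) powr \<alpha> * cmod (Delta (diag d) i j) \<le> M"
  from spec[OF spec[OF this, of i], of i] show "real (i + 1) powr \<alpha> * cmod (d (Suc i) - d i) \<le> M"
    by (simp add: Delta_def diag_def)
next
  assume d: "\<forall>i. cmod (d i) \<le> M"
  show "op_bound (diag d) M"
    unfolding op_bound_def
  proof (intro allI)
    fix m n :: nat and u :: "nat \<Rightarrow> complex"
    have "L2_set (\<lambda>i. cmod (\<Sum>j<n. diag d i j * u j)) {..<m} \<le> L2_set (\<lambda>i. M * (if i < n then cmod (u i) else 0)) {..<m}"
      using d assms by (intro L2_set_mono) (auto simp: diag_def if_distrib[of "\<lambda>x. x * _"] norm_mult mult_right_mono cong: if_cong)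
    also have "\<dots> = M * L2_set (\<lambda>i. if i < n then cmod (u i) else 0) {..<m}"
      using assms by (simp add: L2_set_right_distrib)
    also have "L2_set (\<lambda>i. if i < n then cmod (u i) else 0) {..<m} \<le> L2_set (\<lambda>j. cmod (u j)) {..<n}"
    proof -
      have "(\<Sum>i<m. (if i < n then cmod (u i) else 0)\<^sup>2) = (\<Sum>i\<in>{..<m} \<inter> {..<n}. (cmod (u i))\<^sup>2)"
        by (intro sum.mono_neutral_cong_right) auto
      also have "\<dots> \<le> (\<Sum>i<n. (cmod (u i))\<^sup>2)" by (intro sum_mono2) auto
      finally show ?thesis by (simp add: L2_set_def)
    qed
    finally show "L2_set (\<lambda>i. cmod (\<Sum>j<n. diag d i j * u j)) {..<m} \<le> M * L2_set (\<lambda>j. cmod (u j)) {..<n}"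
      using assms by (simp add: mult_left_mono)
  qed
next
  fix i j
  assume "\<forall>i. real (i + 1) powr \<alpha> * cmod (d (Suc i) - d i) \<le> M"
  then show "real (min i j + 1) powr \<alpha> * cmod (Delta (diag d) i j) \<le> M"
    using assms by (cases "i = j") (auto simp: Delta_def diag_def)
qed

lemma hat_norm_diag_part:
  assumes "hat_norm \<alpha> A \<le> ennreal M" "M \<ge> 0"
  shows "hat_norm \<alpha> (diag (\<lambda>i. A i i)) \<le> ennreal M"
proof -
  have *: "op_bound A M" "\<And>i j. real (min i j + 1) powr \<alpha> * cmod (Delta A i j) \<le> M"
    using assms hat_norm_le_iff by blast+
  show ?thesis
    unfolding hat_norm_diag_iff[OF assms(2)] using op_bound_entry[OF *(1)] *(2)[of i i for i]
    by (auto simp: Delta_def)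
qed

text \<open>This is used for differences and derivatives of the divisor in \<omega>, whose entries
  have the form d i - d j + c. In the weighted part the product rule gives a for each of the two
  increments of \<open>d\<close> and 2 a + b for the undifferenced factor, in total 4 a + b.\<close>

lemma hat_norm_diag_commutator:
  assumes Q: "hat_norm \<alpha> Q \<le> ennreal H" "H \<ge> 0" and d: "hat_norm \<alpha> (diag d) \<le> ennreal a" "a \<ge> 0"
    and c: "cmod c \<le> b" and \<alpha>: "\<alpha> \<ge> 0"
  shows "hat_norm \<alpha> (\<lambda>i j. (d i - d j + c) * Q i j) \<le> ennreal ((4 * a + b) * H)"
proof -
  have Qo: "op_bound Q H" and Qd: "\<And>i j. real (min i j + 1) powr \<alpha> * cmod (Delta Q i j) \<le> H"
    using Q hat_norm_le_iff by blast+
  have da: "\<And>i. cmod (d i) \<le> a" and dd: "\<And>i. real (i + 1) powr \<alpha> * cmod (d (Suc i) - d i) \<le> a"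
    using d hat_norm_diag_iff by blast+
  have b: "b \<ge> 0" using c order_trans[OF norm_ge_zero] by blast
  have "op_bound (\<lambda>i j. d i * Q i j + (- d j * Q i j + c * Q i j)) (a * H + (a * H + b * H))"
    using da c by (intro op_bound_add op_bound_row_scale op_bound_col_scale Qo) auto
  also have "(\<lambda>i j. d i * Q i j + (- d j * Q i j + c * Q i j)) = (\<lambda>i j. (d i - d j + c) * Q i j)"
    by (simp add: fun_eq_iff algebra_simps)
  finally have 1: "op_bound (\<lambda>i j. (d i - d j + c) * Q i j) ((4 * a + b) * H)"
    using d(2) Q(2) by (elim op_bound_mono) (simp add: algebra_simps)
  have 2: "real (min i j + 1) powr \<alpha> * cmod (Delta (\<lambda>i j. (d i - d j + c) * Q i j) i j) \<le> (4 * a + b) * H" for i j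
  proof -
    let ?W = "real (min i j + 1) powr \<alpha>"
    \<comment> \<open>The weight is taken at the smaller index, hence dominated by the weight at
      either index as \<alpha> \<ge> 0.\<close>
    have W: "?W * cmod (d (Suc l) - d l) \<le> a" if "l = i \<or> l = j" for l
    proof -
      have "?W \<le> real (l + 1) powr \<alpha>" using that \<alpha> by (intro powr_mono2) auto
      then show ?thesis using dd[of l] mult_right_mono[of ?W "real (l + 1) powr \<alpha>" "cmod (d (Suc l) - d l)"] by simp
    qed
    have Q1: "cmod (Q (Suc i) (Suc j)) \<le> H" by (rule op_bound_entry[OF Qo])
    have "Delta (\<lambda>i j. (d i - d j + c) * Q i j) i j
       = (d (Suc i) - d i) * Q (Suc i) (Suc j) + (- (d (Suc j) - d j) * Q (Suc i) (Suc j) + (d i - d j + c) * Delta Q i j)"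
      by (simp add: Delta_def algebra_simps)
    moreover have "?W * cmod ((d (Suc i) - d i) * Q (Suc i) (Suc j)) \<le> a * H"
      using mult_mono[OF W[of i] Q1] d(2) by (simp add: norm_mult mult.assoc)
    moreover have "?W * cmod (- (d (Suc j) - d j) * Q (Suc i) (Suc j)) \<le> a * H"
      using mult_mono[OF W[of j] Q1] d(2) by (simp add: norm_mult mult.assoc norm_minus_commute)
    moreover have "?W * cmod ((d i - d j + c) * Delta Q i j) \<le> (2 * a + b) * H"
    proof -
      have "cmod (d i - d j + c) \<le> 2 * a + b"
        using norm_triangle_ineq[of "d i - d j" c] norm_triangle_ineq4[of "d i" "d j"] da[of i] da[of j] c by linarith
      then have "cmod (d i - d j + c) * (?W * cmod (Delta Q i j)) \<le> (2 * a + b) * H"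
        using Qd[of i j] d(2) b by (intro mult_mono) auto
      then show ?thesis by (simp add: norm_mult mult_ac)
    qed
    ultimately have "?W * cmod (Delta (\<lambda>i j. (d i - d j + c) * Q i j) i j) \<le> a * H + (a * H + (2 * a + b) * H)"
      by (simp only:) (intro weight_add, auto)
    then show ?thesis by (simp add: algebra_simps)
  qed
  have "0 \<le> (4 * a + b) * H" using d(2) b Q(2) by simp
  then show ?thesis using 1 2 by (simp only: hat_norm_le_iff) blast
qed

subsection \<open>Sampled Fourier coefficients in one variable\<close>

definition hstrip :: "real \<Rightarrow> complex set" where
  "hstrip b = {z. \<bar>Im z\<bar> < b}"

lemma open_hstrip: "open (hstrip b)"
  unfolding hstrip_def by (intro open_Collect_less continuous_intros)

lemma convex_hstrip: "convex (hstrip b)"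
proof -
  have "hstrip b = {z. Im z < b} \<inter> {z. Im z > -b}"
    by (auto simp: hstrip_def)
  then show ?thesis
    by (simp add: convex_Int convex_halfspace_Im_lt convex_halfspace_Im_gt)
qed

text \<open>At a zero of \<open>h\<close> the singularity is removable and the value is the quotient
  of the derivatives. The intended instance is the quotient of g(\<zeta>) - g(z) by exp (i (\<zeta>
  - z)) - 1.\<close>

lemma holomorphic_quotient_simple_zeros:
  assumes f: "f holomorphic_on S" and h: "h holomorphic_on S" and S: "open S"
    and simple: "\<And>z. z \<in> S \<Longrightarrow> h z = 0 \<Longrightarrow> f z = 0 \<and> deriv h z \<noteq> 0"
  shows "(\<lambda>z. if h z = 0 then deriv f z / deriv h z else f z / h z) holomorphic_on S"
    (is "?q holomorphic_on S")
proof -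
  have "?q field_differentiable at z" if z: "z \<in> S" for z
  proof (cases "h z = 0")
    case False
    have "eventually (\<lambda>w. w \<in> S \<and> h w \<noteq> 0) (nhds z)"
    proof (intro eventually_conj)
      show "\<forall>\<^sub>F x in nhds z. x \<in> S" using S z by (rule eventually_nhds_in_open)
      have "isCont h z"
        using h S z holomorphic_on_imp_differentiable_at field_differentiable_imp_continuous_at by blast
      then have "(h \<longlongrightarrow> h z) (nhds z)"
        by (simp add: continuous_at tendsto_at_iff_tendsto_nhds)
      then show "\<forall>\<^sub>F x in nhds z. h x \<noteq> 0" by (rule tendsto_imp_eventually_ne) (rule False)
    qed
    then have ev: "eventually (\<lambda>w. ?q w = f w / h w) (nhds z)"
      by eventually_elim auto
    have "(\<lambda>w. f w / h w) field_differentiable at z"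
      using f h S z False
      by (intro field_differentiable_divide) (auto intro: holomorphic_on_imp_differentiable_at)
    then obtain D where "((\<lambda>w. f w / h w) has_field_derivative D) (at z)"
      by (auto simp: field_differentiable_def)
    then have "(?q has_field_derivative D) (at z)"
      using ev DERIV_cong_ev[OF refl ev refl] by simp
    then show ?thesis by (auto simp: field_differentiable_def)
  next
    case True
    note sz = simple[OF z True]
    have dh: "(h has_field_derivative deriv h z) (at z)"
      using h S z by (rule holomorphic_derivI)
    have df: "(f has_field_derivative deriv f z) (at z)"
      using f S z by (rule holomorphic_derivI)
    have nz: "eventually (\<lambda>w. h w \<noteq> 0) (at z)"
    proof -
      have "((\<lambda>w. (h w - h z) / (w - z)) \<longlongrightarrow> deriv h z) (at z)"
        using dh by (simp add: has_field_derivative_iff)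
      then have "eventually (\<lambda>w. (h w - h z) / (w - z) \<noteq> 0) (at z)"
        using sz by (intro tendsto_imp_eventually_ne) auto
      then show ?thesis by eventually_elim (auto simp: True)
    qed
    moreover have "eventually (\<lambda>w. w \<in> S) (at z)"
      using S z eventually_at_topological by blast
    ultimately have "eventually (\<lambda>w. h w \<noteq> 0 \<and> w \<in> S) (at z)"
      by (rule eventually_conj)
    then obtain r where r: "r > 0" "\<And>w. w \<noteq> z \<Longrightarrow> dist w z < r \<Longrightarrow> h w \<noteq> 0 \<and> w \<in> S"
      unfolding eventually_at by auto
    have sub: "w \<in> S" if "w \<in> ball z r" for w
      using r z that by (cases "w = z") (auto simp: dist_commute)
    have "?q holomorphic_on ball z r"
    proof (rule no_isolated_singularity')
      show "?q holomorphic_on ball z r - {z}"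
      proof (rule holomorphic_transform)
        show "(\<lambda>w. f w / h w) holomorphic_on ball z r - {z}"
          using f h r sub
          by (intro holomorphic_on_divide)
             (auto simp: dist_commute intro: holomorphic_on_subset)
      qed (use r in \<open>auto simp: dist_commute\<close>)
      show "(?q \<longlongrightarrow> ?q w) (at w within ball z r)" if "w \<in> {z}" for w
      proof -
        have "((\<lambda>w. ((f w - f z) / (w - z)) / ((h w - h z) / (w - z))) \<longlongrightarrow> deriv f z / deriv h z) (at z)"
          using df dh sz by (intro tendsto_divide) (auto simp: has_field_derivative_iff)
        then have "(?q \<longlongrightarrow> deriv f z / deriv h z) (at z)"
        proof (rule Lim_transform_eventually)
          show "\<forall>\<^sub>F w in at z. (f w - f z) / (w - z) / ((h w - h z) / (w - z)) = ?q w"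
            using nz eventually_neq_at_within[of z z UNIV]
            by eventually_elim (use sz True in auto)
        qed
        then show ?thesis using that True
          by (auto intro: tendsto_within_subset)
      qed
    qed auto
    then show ?thesis
      using r by (auto intro: holomorphic_on_imp_differentiable_at)
  qed
  then show ?thesis
    using S by (auto simp: holomorphic_on_def intro: field_differentiable_at_within)
qed

text \<open>The rectangle rule with \<open>N\<close> nodes for the mean over one period along the
  line Im z = b.\<close>

definition grid_mean :: "nat \<Rightarrow> real \<Rightarrow> (complex \<Rightarrow> complex) \<Rightarrow> complex" where
  "grid_mean N b f = (\<Sum>j<N. f (Complex (2 * pi * real j / real N) b)) / of_nat N"

lemma grid_mean_bound:
  assumes "N > 0" "\<And>z. Im z = b \<Longrightarrow> cmod (f z) \<le> B"
  shows "cmod (grid_mean N b f) \<le> B"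
proof -
  have "cmod (\<Sum>j<N. f (Complex (2 * pi * real j / real N) b)) \<le> (\<Sum>j<N. B)"
    by (intro order_trans[OF norm_sum] sum_mono assms) auto
  then show ?thesis using assms(1)
    by (simp add: grid_mean_def norm_divide divide_le_eq mult.commute)
qed

lemma primitive_first_order:
  assumes "convex S" "x \<in> S" "y \<in> S"
    and prim: "\<And>z. z \<in> S \<Longrightarrow> (F has_field_derivative f z) (at z within S)"
    and lip: "\<And>z. z \<in> S \<Longrightarrow> cmod (f z - f x) \<le> L"
  shows "cmod (F y - F x - (y - x) * f x) \<le> L * cmod (y - x)"
proof -
  have "cmod ((F y - y * f x) - (F x - x * f x)) \<le> L * cmod (y - x)"
  proof (rule field_differentiable_bound[where S = S and f' = "\<lambda>z. f z - f x"])
    show "((\<lambda>z. F z - z * f x) has_field_derivative f z - f x) (at z within S)" if "z \<in> S" for z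
      using prim[OF that] by (auto intro!: derivative_eq_intros)
  qed (use assms in auto)
  then show ?thesis by (simp add: algebra_simps)
qed

text \<open>Each of the \<open>N\<close> cells has length h = 2 pi / N and contributes an error of
  at most h^2 times a bound of the derivative, which Cauchy's inequality gives as 2 B / r. The total
  is N (2 B / r) (2 pi / N)^2.\<close>

lemma grid_mean_primitive:
  assumes hol: "f holomorphic_on hstrip \<rho>"
    and prim: "\<And>z. z \<in> hstrip \<rho> \<Longrightarrow> (F has_field_derivative f z) (at z within hstrip \<rho>)"
    and r: "r > 0" "\<bar>b\<bar> + r \<le> \<rho>" and N: "N > 0"
    and bd: "\<And>z. \<bar>Im z - b\<bar> < r \<Longrightarrow> cmod (f z) \<le> B"
  shows "cmod (F (Complex (2 * pi) b) - F (Complex 0 b) - 2 * pi * grid_mean N b f) \<le> 8 * pi^2 * B / (r * N)"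
proof -
  define x where "x j = Complex (2 * pi * real j / real N) b" for j :: nat
  have inS: "z \<in> hstrip \<rho>" if "\<bar>Im z - b\<bar> < r" for z
    using that r by (auto simp: hstrip_def)
  \<comment> \<open>The radius is r / 2 and not r because the closed disc has to stay inside the
    open band on which \<open>f\<close> is bounded by \<open>B\<close>.\<close>
  have df: "cmod (deriv f z) \<le> B / (r/2)" if "Im z = b" for z
  proof -
    have *: "\<bar>Im w - b\<bar> < r" if "w \<in> cball z (r/2)" for w
    proof -
      have "\<bar>Im (z - w)\<bar> \<le> r / 2"
        using that abs_Im_le_cmod[of "z - w"] by (simp add: dist_norm)
      then show ?thesis using r \<open>Im z = b\<close> by (auto simp: abs_if split: if_splits)
    qed
    have "norm ((deriv ^^ 1) f z) \<le> fact 1 * B / (r/2) ^ 1"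
    proof (rule Cauchy_inequality)
      show "f holomorphic_on ball z (r/2)"
        by (rule holomorphic_on_subset[OF hol]) (use * inS in force)
      show "continuous_on (cball z (r/2)) f"
        by (rule continuous_on_subset[OF holomorphic_on_imp_continuous_on[OF hol]]) (use * inS in force)
      show "norm (f w) \<le> B" if "norm (z - w) = r/2" for w
        by (rule bd, rule *) (use that in \<open>auto simp: dist_norm\<close>)
    qed (use r in auto)
    then show ?thesis by simp
  qed
  define S where "S = {z. Im z = b}"
  have S: "convex S" "S \<subseteq> hstrip \<rho>"
  proof -
    have "S = {z. inner \<i> z = b}" by (auto simp: S_def inner_complex_def)
    then show "convex S" using convex_hyperplane[of \<i> b] by metis
    show "S \<subseteq> hstrip \<rho>" using inS r by (auto simp: S_def)
  qed
  have step: "cmod (F (x (Suc j)) - F (x j) - (x (Suc j) - x j) * f (x j)) \<le> (2*B/r) * (2*pi/N) * (2*pi/N)" for j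
  proof -
    have xx: "x (Suc j) - x j = of_real (2*pi/N)"
      using N by (simp add: x_def complex_eq_iff field_simps)
    define T where "T = closed_segment (x j) (x (Suc j))"
    have TS: "T \<subseteq> S"
      unfolding T_def using S(1) by (intro closed_segment_subset) (auto simp: x_def S_def)
    have "cmod (F (x (Suc j)) - F (x j) - (x (Suc j) - x j) * f (x j)) \<le> ((2*B/r) * (2*pi/N)) * cmod (x (Suc j) - x j)"
    proof (rule primitive_first_order[where S = T])
      show "(F has_field_derivative f z) (at z within T)" if "z \<in> T" for z
        using prim[of z] that TS S(2) by (meson DERIV_subset subset_trans subsetD)
      show "cmod (f z - f (x j)) \<le> (2*B/r) * (2*pi/N)" if "z \<in> T" for z
      proof -
        have "cmod (f z - f (x j)) \<le> (2*B/r) * cmod (z - x j)"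
        proof (rule field_differentiable_bound[where S = S and f' = "deriv f"])
          show "(f has_field_derivative deriv f w) (at w within S)" if "w \<in> S" for w
            using holomorphic_derivI[OF hol open_hstrip] that S(2) by (meson DERIV_subset subsetD top_greatest)
          show "cmod (deriv f w) \<le> 2*B/r" if "w \<in> S" for w
            using df[of w] that by (simp add: S_def mult.commute)
        qed (use S that TS in \<open>auto simp: T_def\<close>)
        note fz = this
        have "cmod (z - x j) \<le> cmod (x (Suc j) - x j)"
          using that segment_bound(1)[of z "x j" "x (Suc j)"] by (simp add: T_def)
        also have "\<dots> = 2*pi/N" by (simp only: xx norm_of_real) simp
        finally have zx: "cmod (z - x j) \<le> 2*pi/N" .
        have "0 \<le> 2*B/r"
          using order_trans[OF norm_ge_zero df[of "x j"]] by (simp add: x_def mult.commute)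
        then have "(2*B/r) * cmod (z - x j) \<le> (2*B/r) * (2*pi/N)"
          using zx by (rule mult_left_mono[rotated])
        with fz show ?thesis by linarith
      qed
    qed (auto simp: T_def)
    also have "cmod (x (Suc j) - x j) = 2*pi/N" by (simp only: xx norm_of_real) simp
    finally show ?thesis .
  qed
  have xx: "x (Suc j) - x j = of_real (2*pi/N)" for j
    using N by (simp add: x_def complex_eq_iff field_simps)
  have "(\<Sum>j<N. F (x (Suc j)) - F (x j) - (x (Suc j) - x j) * f (x j))
     = (\<Sum>j<N. F (x (Suc j)) - F (x j)) - (\<Sum>j<N. of_real (2*pi/N) * f (x j))"
    by (simp only: sum_subtractf xx)
  also have "(\<Sum>j<N. F (x (Suc j)) - F (x j)) = F (x N) - F (x 0)"
    by (fact sum_lessThan_telescope[of "\<lambda>j. F (x j)" N])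
  also have "(\<Sum>j<N. of_real (2*pi/N) * f (x j)) = 2 * pi * grid_mean N b f"
    by (simp add: grid_mean_def x_def sum_distrib_left sum_divide_distrib)
  finally have "cmod (F (x N) - F (x 0) - 2 * pi * grid_mean N b f) \<le> (\<Sum>j<N. (2*B/r) * (2*pi/N) * (2*pi/N))"
    using order_trans[OF norm_sum sum_mono[OF step], of "\<lambda>j. j" "{..<N}"] by simp
  also have "\<dots> = 8 * pi^2 * B / (r * N)"
    using N by (simp add: field_simps power2_eq_square)
  finally show ?thesis using N by (simp add: x_def)
qed

text \<open>The stand-in for moving a contour. By periodicity the increment of a primitive over one
  period is the same constant at every height, and both grid means approximate this constant divided
  by 2 pi.\<close>

lemma grid_mean_shift:
  assumes hol: "f holomorphic_on hstrip \<rho>"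
    and per: "\<And>z. z \<in> hstrip \<rho> \<Longrightarrow> f (z + 2 * pi) = f z"
    and r: "r > 0" "\<bar>b\<bar> + r \<le> \<rho>" "\<bar>b'\<bar> + r \<le> \<rho>" and N: "N > 0"
    and bd: "\<And>z. \<bar>Im z - b\<bar> < r \<Longrightarrow> cmod (f z) \<le> B" "\<And>z. \<bar>Im z - b'\<bar> < r \<Longrightarrow> cmod (f z) \<le> B"
  shows "cmod (grid_mean N b f - grid_mean N b' f) \<le> 8 * pi * B / (r * N)"
proof -
  obtain F where F: "\<And>z. z \<in> hstrip \<rho> \<Longrightarrow> (F has_field_derivative f z) (at z within hstrip \<rho>)"
    using holomorphic_convex_primitive'[OF convex_hstrip open_hstrip hol] by blast
  have F': "(F has_field_derivative f z) (at z)" if "z \<in> hstrip \<rho>" for z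
    using F[OF that] that at_within_open[OF that open_hstrip] by simp
  have "\<exists>c. \<forall>z\<in>hstrip \<rho>. F (z + 2 * pi) - F z = c"
  proof (rule has_field_derivative_zero_constant[OF convex_hstrip])
    fix z assume z: "z \<in> hstrip \<rho>"
    then have z': "z + 2 * pi \<in> hstrip \<rho>" by (simp add: hstrip_def)
    have "((\<lambda>z. F (z + 2 * pi)) has_field_derivative f (z + 2 * pi)) (at z)"
      using F'[OF z'] by (simp add: DERIV_shift)
    then have "((\<lambda>z. F (z + 2 * pi) - F z) has_field_derivative f (z + 2 * pi) - f z) (at z)"
      using F'[OF z] by (intro DERIV_diff)
    then show "((\<lambda>z. F (z + 2 * pi) - F z) has_field_derivative 0) (at z within hstrip \<rho>)"
      using per[OF z] by (simp add: has_field_derivative_at_within)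
  qed
  then obtain c where c: "\<And>z. z \<in> hstrip \<rho> \<Longrightarrow> F (z + 2 * pi) - F z = c" by blast
  have cc: "F (Complex (2*pi) b) - F (Complex 0 b) = c" if "\<bar>b\<bar> < \<rho>" for b
  proof -
    have "Complex (2*pi) b = Complex 0 b + 2 * pi" by (simp add: complex_eq_iff)
    then show ?thesis using c[of "Complex 0 b"] that by (simp add: hstrip_def)
  qed
  have 1: "cmod (c - 2 * pi * grid_mean N b f) \<le> 8 * pi^2 * B / (r * N)"
    using grid_mean_primitive[OF hol F r(1,2) N bd(1)] cc[of b] r by simp
  have 2: "cmod (c - 2 * pi * grid_mean N b' f) \<le> 8 * pi^2 * B / (r * N)"
    using grid_mean_primitive[OF hol F r(1,3) N bd(2)] cc[of b'] r by simp
  have "cmod (2 * pi * (grid_mean N b f - grid_mean N b' f)) \<le> 2 * (8 * pi^2 * B / (r * N))"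
    using norm_triangle_le_diff[OF add_mono[OF 2 1]] by (simp add: algebra_simps)
  then have "2 * pi * cmod (grid_mean N b f - grid_mean N b' f) \<le> 2 * pi * (8 * pi * B / (r * N))"
    by (simp only: norm_mult norm_of_real power2_eq_square) (simp add: mult_ac)
  then show ?thesis
    by (rule mult_left_le_imp_le) simp
qed

section \<open>Decay of sampled coefficients and the truncation error\<close>

text \<open>The nodes are real, which keeps the symmetry of the coefficients under conjugation;
  lines at other heights enter only through estimates.\<close>

definition fourier_coef :: "nat \<Rightarrow> int \<Rightarrow> (complex \<Rightarrow> complex) \<Rightarrow> complex" where
  "fourier_coef N k g = grid_mean N 0 (\<lambda>z. g z * exp (- (\<i> * of_int k * z)))"

definition bounded_periodic :: "real \<Rightarrow> real \<Rightarrow> (complex \<Rightarrow> complex) \<Rightarrow> bool" where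
  "bounded_periodic \<rho> M g \<longleftrightarrow> g holomorphic_on hstrip \<rho> \<and>
     (\<forall>z\<in>hstrip \<rho>. g (z + 2 * pi) = g z) \<and> (\<forall>z\<in>hstrip \<rho>. cmod (g z) \<le> M)"

lemma bounded_periodic_nonneg:
  assumes "bounded_periodic \<rho> M g" "\<rho> > 0"
  shows "M \<ge> 0"
proof -
  have "cmod (g 0) \<le> M" using assms by (auto simp: bounded_periodic_def hstrip_def)
  then show ?thesis by (rule order_trans[OF norm_ge_zero])
qed

lemma exp_int_periodic:
  fixes z :: complex
  shows "exp (\<i> * of_int k * (z + 2 * pi)) = exp (\<i> * of_int k * z)"
proof -
  have "\<i> * of_int k * (z + 2 * pi) = \<i> * of_int k * z + 2 * of_int k * pi * \<i>"
    by (simp add: algebra_simps)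
  then show ?thesis
    using exp_integer_2pi[of "of_int k"] by (simp add: exp_add)
qed

lemma exp_int_periodic_minus:
  fixes z :: complex
  shows "exp (- (\<i> * of_int k * (z + 2 * pi))) = exp (- (\<i> * of_int k * z))"
  using exp_int_periodic[of "-k" z] by simp

lemma grid_mean_add: "grid_mean N b (\<lambda>z. f z + g z) = grid_mean N b f + grid_mean N b g"
  by (simp add: grid_mean_def sum.distrib add_divide_distrib)

lemma grid_mean_diff: "grid_mean N b (\<lambda>z. f z - g z) = grid_mean N b f - grid_mean N b g"
  by (simp add: grid_mean_def sum_subtractf diff_divide_distrib)

lemma grid_mean_cmult: "grid_mean N b (\<lambda>z. c * f z) = c * grid_mean N b f"
  by (simp add: grid_mean_def sum_distrib_left)

lemma grid_mean_sum: "grid_mean N b (\<lambda>z. \<Sum>k\<in>A. f k z) = (\<Sum>k\<in>A. grid_mean N b (f k))"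
  by (simp add: grid_mean_def sum_divide_distrib[symmetric]) (subst sum.swap, simp)

lemma grid_mean_cong:
  assumes "\<And>z. Im z = b \<Longrightarrow> f z = g z"
  shows "grid_mean N b f = grid_mean N b g"
  by (simp add: grid_mean_def assms)

text \<open>Sampled exponentials are exactly orthogonal as long as no aliasing occurs: the mean is a
  geometric sum over the powers of an \<open>N\<close>-th root of unity, which is not 1 because
  \<open>N\<close> does not divide \<open>k\<close>.\<close>

lemma grid_mean_exp:
  assumes "0 < k" "k < N"
  shows "grid_mean N b (\<lambda>z. exp (\<i> * of_nat k * (z - w))) = 0"
proof -
  define u where "u = exp (\<i> * of_real (2 * pi * k / N))"
  have "exp (\<i> * of_nat k * (Complex (2 * pi * real j / real N) b - w))
      = exp (\<i> * of_nat k * (Complex 0 b - w)) * u ^ j" for j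
  proof -
    have "Complex (2 * pi * real j / real N) b = Complex 0 b + of_real (2 * pi * real j / real N)"
      by (simp add: complex_eq_iff)
    then show ?thesis
      unfolding u_def exp_of_nat_mult[symmetric] exp_add[symmetric] by (simp add: algebra_simps)
  qed
  then have *: "grid_mean N b (\<lambda>z. exp (\<i> * of_nat k * (z - w)))
      = exp (\<i> * of_nat k * (Complex 0 b - w)) * (\<Sum>j<N. u ^ j) / N"
    by (simp add: grid_mean_def sum_distrib_left)
  have "u \<noteq> 1"
  proof
    assume "u = 1"
    then obtain m :: int where "2 * pi * k / N = of_int (2 * m) * pi"
      by (auto simp: u_def exp_eq_1)
    then have "real k = real_of_int (m * int N)" using assms by (simp add: field_simps)
    then have "int k = m * int N" by linarith
    then have "int N dvd int k" by simp
    then show False using assms by (auto dest: dvd_imp_le)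
  qed
  moreover have "u ^ N = 1"
  proof -
    have "u ^ N = exp (\<i> * of_real (2 * pi * k))"
      using assms by (simp add: u_def flip: exp_of_nat_mult)
    also have "\<dots> = 1"
      unfolding exp_eq_1 by (auto intro!: exI[of _ "int k"])
    finally show ?thesis .
  qed
  ultimately have "(\<Sum>j<N. u ^ j) = 0"
    by (simp add: geometric_sum)
  then show ?thesis by (simp add: *)
qed

lemma fourier_coef_shift:
  assumes g: "bounded_periodic \<rho> M g" and "r > 0" "\<bar>b\<bar> + r \<le> \<rho>" "N > 0" "\<bar>k\<bar> \<le> int n"
  shows "cmod (grid_mean N b (\<lambda>z. g z * exp (- (\<i> * of_int k * z))) - fourier_coef N k g)
    \<le> 8 * pi * (M * exp (n * \<rho>)) / (r * N)"
  unfolding fourier_coef_def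
proof (rule grid_mean_shift[where \<rho> = \<rho>])
  show "(\<lambda>z. g z * exp (- (\<i> * complex_of_int k * z))) holomorphic_on hstrip \<rho>"
    using g by (auto simp: bounded_periodic_def intro!: holomorphic_intros)
  show "g (z + complex_of_real (2 * pi)) * exp (- (\<i> * complex_of_int k * (z + complex_of_real (2 * pi))))
     = g z * exp (- (\<i> * complex_of_int k * z))" if "z \<in> hstrip \<rho>" for z
    using g that exp_int_periodic_minus[of k z] by (simp add: bounded_periodic_def)
  have bd: "cmod (g z * exp (- (\<i> * complex_of_int k * z))) \<le> M * exp (n * \<rho>)" if "\<bar>Im z\<bar> < \<rho>" for z
  proof -
    have "cmod (g z) \<le> M" using g that by (auto simp: bounded_periodic_def hstrip_def)
    moreover have "k * Im z \<le> n * \<rho>"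
    proof -
      have "k * Im z \<le> \<bar>k * Im z\<bar>" by simp
      also have "\<dots> = \<bar>k\<bar> * \<bar>Im z\<bar>" by (simp add: abs_mult)
      also have "\<dots> \<le> n * \<rho>" using assms(5) that by (intro mult_mono) auto
      finally show ?thesis .
    qed
    then have "cmod (exp (- (\<i> * complex_of_int k * z))) \<le> exp (n * \<rho>)" by simp
    ultimately show ?thesis
      unfolding norm_mult by (intro mult_mono) (auto intro: order_trans[OF norm_ge_zero])
  qed
  show "cmod (g z * exp (- (\<i> * complex_of_int k * z))) \<le> M * exp (n * \<rho>)" if "\<bar>Im z - b\<bar> < r" for z
    using assms that by (intro bd) auto
  show "cmod (g z * exp (- (\<i> * complex_of_int k * z))) \<le> M * exp (n * \<rho>)" if "\<bar>Im z - 0\<bar> < r" for z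
    using assms that by (intro bd) auto
qed (use assms in auto)

text \<open>The grid is moved to the height -sgn k * \<open>\<rho>1\<close>, where the exponential
  has modulus exp (-|k| \<open>\<rho>1\<close>). The second summand is the price of moving a grid
  instead of an integral.\<close>

lemma fourier_coef_bound:
  assumes g: "bounded_periodic \<rho> M g" and "0 < \<rho>1" "\<rho>1 < \<rho>" "N > 0" "\<bar>k\<bar> \<le> int n"
  shows "cmod (fourier_coef N k g) \<le> M * exp (- (real_of_int \<bar>k\<bar> * \<rho>1)) + 8 * pi * (M * exp (n * \<rho>)) / ((\<rho> - \<rho>1) * N)"
proof -
  define b where "b = - (sgn k * \<rho>1)"
  have b: "\<bar>b\<bar> \<le> \<rho>1" using assms by (auto simp: b_def sgn_if)
  have "cmod (grid_mean N b (\<lambda>z. g z * exp (- (\<i> * of_int k * z)))) \<le> M * exp (- (real_of_int \<bar>k\<bar> * \<rho>1))"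
  proof (rule grid_mean_bound)
    fix z assume z: "Im z = b"
    have "k * Im z = - (real_of_int \<bar>k\<bar> * \<rho>1)" by (auto simp: z b_def sgn_if)
    moreover have "cmod (g z) \<le> M" using g z b assms by (auto simp: bounded_periodic_def hstrip_def)
    ultimately show "cmod (g z * exp (- (\<i> * complex_of_int k * z))) \<le> M * exp (- (real_of_int \<bar>k\<bar> * \<rho>1))"
      by (simp add: norm_mult mult_right_mono)
  qed fact
  moreover have "cmod (grid_mean N b (\<lambda>z. g z * exp (- (\<i> * of_int k * z))) - fourier_coef N k g)
    \<le> 8 * pi * (M * exp (n * \<rho>)) / ((\<rho> - \<rho>1) * N)"
    using b assms by (intro fourier_coef_shift) auto
  ultimately show ?thesis
    using norm_triangle_sub[of "fourier_coef N k g" "grid_mean N b (\<lambda>z. g z * exp (- (\<i> * of_int k * z)))"]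
    by (simp add: norm_minus_commute)
qed

lemma sum_int_symmetric:
  fixes f :: "int \<Rightarrow> 'a :: comm_monoid_add"
  shows "(\<Sum>k\<in>{-int n..int n}. f k) = (\<Sum>k\<le>n. f (- int k)) + (\<Sum>k=1..n. f (int k))"
proof -
  have "{-int n..int n} = (\<lambda>k. - int k) ` {..n} \<union> int ` {1..n}"
  proof (intro set_eqI iffI)
    fix k assume "k \<in> {-int n..int n}"
    then show "k \<in> (\<lambda>k. - int k) ` {..n} \<union> int ` {1..n}"
      by (cases "k \<le> 0") (force intro: image_eqI[of _ _ "nat (-k)"], force intro: image_eqI[of _ _ "nat k"])
  qed auto
  moreover have "(\<lambda>k. - int k) ` {..n} \<inter> int ` {1..n} = {}" by auto
  ultimately show ?thesis
    by (simp add: sum.union_disjoint sum.reindex inj_on_def)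
qed

text \<open>A discrete Cauchy formula. The quotient of g(\<zeta>) - g(z) by exp (i (\<zeta> - z)) -
  1 is holomorphic and periodic, so its grid means on two lines enclosing z almost agree. With q =
  exp (i (\<zeta> - z)), the factor 1 / (q - 1) is expanded in powers of q above z and in powers of
  1 / q below z, which produces the frequencies k \<le> 0 and k > 0. The value g(z) comes back from
  the constant term of the upper expansion.\<close>

lemma fourier_remainder:
  assumes g: "bounded_periodic \<rho> M g" and \<rho>: "0 < \<rho>'" "s > 0" "\<rho> = \<rho>' + 2 * s" and N: "n < N"
    and z: "\<bar>Im z\<bar> < \<rho>'"
  shows "cmod (g z - (\<Sum>k\<in>{-int n..int n}. fourier_coef N k g * exp (\<i> * of_int k * z)))
    \<le> 4 * M * exp (- (real (n + 1) * s)) / (1 - exp (- s)) +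
       (32 * pi * M / (s * (1 - exp (- (s/2)))) + (2 * n + 1) * exp (n * \<rho>) * (8 * pi * (M * exp (n * \<rho>)) / s)) / N"
proof -
  \<comment> \<open>Halfway between the strip of z and the edge of the domain, with room s on either
    side.\<close>
  define \<rho>1 where "\<rho>1 = \<rho>' + s"
  define e where "e \<zeta> = exp (\<i> * (\<zeta> - z)) - 1" for \<zeta>
  define f where "f \<zeta> = g \<zeta> - g z" for \<zeta>
  define \<phi> where "\<phi> \<zeta> = (if e \<zeta> = 0 then deriv f \<zeta> / deriv e \<zeta> else f \<zeta> / e \<zeta>)" for \<zeta>
  have zin: "z \<in> hstrip \<rho>" using z \<rho> by (auto simp: hstrip_def)
  have M: "cmod (g w) \<le> M" if "\<bar>Im w\<bar> < \<rho>" for w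
    using g that by (auto simp: bounded_periodic_def hstrip_def)
  have f2M: "cmod (f w) \<le> 2 * M" if "\<bar>Im w\<bar> < \<rho>" for w
    using M[OF that] M[of z] z \<rho> norm_triangle_ineq4[of "g w" "g z"] by (auto simp: f_def)
  have M0: "M \<ge> 0" using M[of z] z \<rho> by (auto intro: order_trans[OF norm_ge_zero])
  have per2: "g (w + of_real (2 * pi * real_of_int k)) = g w" if "w \<in> hstrip \<rho>" for w k
  proof (induction k rule: int_induct[where k = 0])
    case (step1 i)
    have "g (w + of_real (2 * pi * real_of_int (i + 1))) = g (w + of_real (2 * pi * real_of_int i) + 2 * pi)"
      by (simp add: algebra_simps)
    also have "\<dots> = g (w + of_real (2 * pi * real_of_int i))"
      using g that by (auto simp: bounded_periodic_def hstrip_def)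
    finally show ?case using step1 by simp
  next
    case (step2 i)
    have "g (w + of_real (2 * pi * real_of_int i)) = g (w + of_real (2 * pi * real_of_int (i - 1)) + 2 * pi)"
      by (simp add: algebra_simps)
    also have "\<dots> = g (w + of_real (2 * pi * real_of_int (i - 1)))"
      using g that by (auto simp: bounded_periodic_def hstrip_def)
    finally show ?case using step2 by simp
  qed auto
  have de: "(e has_field_derivative \<i> * exp (\<i> * (\<zeta> - z))) (at \<zeta>)" for \<zeta>
    unfolding e_def by (auto intro!: derivative_eq_intros)
  have hol: "\<phi> holomorphic_on hstrip \<rho>"
    unfolding \<phi>_def
  proof (rule holomorphic_quotient_simple_zeros[OF _ _ open_hstrip])
    show "f holomorphic_on hstrip \<rho>"
      using g unfolding f_def by (auto simp: bounded_periodic_def intro!: holomorphic_intros)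
    show "e holomorphic_on hstrip \<rho>"
      unfolding e_def by (intro holomorphic_intros)
    fix \<zeta> assume \<zeta>: "\<zeta> \<in> hstrip \<rho>" "e \<zeta> = 0"
    then have "exp (\<i> * (\<zeta> - z)) = 1" by (simp add: e_def)
    then obtain k :: int where k: "Im (\<zeta> - z) = 0" "Re (\<zeta> - z) = of_int (2 * k) * pi"
      by (auto simp: exp_eq_1)
    then have "\<zeta> = z + of_real (2 * pi * real_of_int k)"
      by (intro complex_eqI) (simp_all add: mult_ac eq_diff_eq diff_eq_eq)
    then have "f \<zeta> = 0" using per2[OF zin] by (simp add: f_def)
    moreover have "deriv e \<zeta> \<noteq> 0" using DERIV_imp_deriv[OF de] by simp
    ultimately show "f \<zeta> = 0 \<and> deriv e \<zeta> \<noteq> 0" by blast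
  qed
  have eper: "e (\<zeta> + 2 * pi) = e \<zeta>" for \<zeta> :: complex
    using exp_int_periodic[of 1 "\<zeta> - z"] by (simp add: e_def algebra_simps)
  have per: "\<phi> (\<zeta> + 2 * pi) = \<phi> \<zeta>" if \<zeta>: "\<zeta> \<in> hstrip \<rho>" for \<zeta>
  proof -
    have fper: "f (w + 2 * pi) = f w" if "w \<in> hstrip \<rho>" for w
      using g that by (auto simp: f_def bounded_periodic_def)
    have dfper: "deriv f (\<zeta> + 2 * pi) = deriv f \<zeta>"
    proof -
      have "deriv f (\<zeta> + 2 * pi) = deriv (\<lambda>w. f (w + 2 * pi)) \<zeta>"
      proof (rule DERIV_imp_deriv[symmetric])
        have "f holomorphic_on hstrip \<rho>"
          using g unfolding f_def by (auto simp: bounded_periodic_def intro!: holomorphic_intros)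
        then have "(f has_field_derivative deriv f (\<zeta> + 2 * pi)) (at (\<zeta> + 2 * pi))"
          by (rule holomorphic_derivI[OF _ open_hstrip]) (use \<zeta> in \<open>simp add: hstrip_def\<close>)
        then show "((\<lambda>w. f (w + 2 * pi)) has_field_derivative deriv f (\<zeta> + 2 * pi)) (at \<zeta>)"
          by (simp add: DERIV_shift)
      qed
      also have "\<dots> = deriv f \<zeta>"
      proof (rule deriv_cong_ev)
        show "\<forall>\<^sub>F w in nhds \<zeta>. f (w + complex_of_real (2 * pi)) = f w"
          using eventually_nhds_in_open[OF open_hstrip \<zeta>] by eventually_elim (rule fper)
      qed simp
      finally show ?thesis .
    qed
    have deper: "deriv e (\<zeta> + 2 * pi) = deriv e \<zeta>"
      using DERIV_imp_deriv[OF de, of \<zeta>] DERIV_imp_deriv[OF de, of "\<zeta> + 2 * pi"] exp_int_periodic[of 1 "\<zeta> - z"]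
      by (simp add: algebra_simps)
    show ?thesis using eper[of \<zeta>] dfper deper fper[OF \<zeta>] by (simp add: \<phi>_def)
  qed
  define q where "q \<zeta> = exp (\<i> * (\<zeta> - z))" for \<zeta>
  have nq: "cmod (q \<zeta>) = exp (Im z - Im \<zeta>)" for \<zeta> by (simp add: q_def)
  \<comment> \<open>Above z the modulus of \<open>q\<close> is at most exp (-t); below z it is at
    least exp t, and exp t - 1 \<ge> 1 - exp (-t).\<close>
  have low: "1 - exp (- t) \<le> cmod (e \<zeta>)" if "t > 0" "\<bar>Im \<zeta> - Im z\<bar> \<ge> t" for t \<zeta>
  proof (cases "Im \<zeta> \<ge> Im z")
    case True
    have "cmod (q \<zeta>) \<le> exp (-t)" using that True by (simp add: nq)
    moreover have "1 - cmod (q \<zeta>) \<le> cmod (e \<zeta>)"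
      using norm_triangle_ineq2[of 1 "q \<zeta>"] by (simp add: e_def q_def norm_minus_commute)
    ultimately show ?thesis by linarith
  next
    case False
    have "1 - exp (- t) \<le> exp t - 1"
      using exp_ge_add_one_self[of t] exp_ge_add_one_self[of "-t"] by linarith
    also have "exp t \<le> cmod (q \<zeta>)" using that False by (simp add: nq)
    also have "cmod (q \<zeta>) - 1 \<le> cmod (e \<zeta>)"
      using norm_triangle_ineq2[of "q \<zeta>" 1] by (simp add: e_def q_def)
    finally show ?thesis by simp
  qed
  have e0: "1 - exp (-t) > 0" if "t > 0" for t :: real using that by simp
  have \<phi>: "\<phi> \<zeta> = f \<zeta> / (q \<zeta> - 1)" "q \<zeta> \<noteq> 1" if "\<bar>Im \<zeta> - Im z\<bar> > 0" for \<zeta>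
  proof -
    have "e \<zeta> \<noteq> 0" using low[OF that order_refl] e0[OF that] by auto
    then show "\<phi> \<zeta> = f \<zeta> / (q \<zeta> - 1)" "q \<zeta> \<noteq> 1" by (auto simp: \<phi>_def e_def q_def)
  qed
  have bd\<phi>: "cmod (\<phi> \<zeta>) \<le> 2 * M / (1 - exp (- (s/2)))" if "\<bar>Im \<zeta> - Im z\<bar> \<ge> s/2" "\<bar>Im \<zeta>\<bar> < \<rho>" for \<zeta>
  proof -
    have "\<phi> \<zeta> = f \<zeta> / (q \<zeta> - 1)" using that \<rho> by (intro \<phi>) auto
    moreover have "1 - exp (- (s/2)) \<le> cmod (q \<zeta> - 1)"
      using low[of "s/2" \<zeta>] that \<rho> by (simp add: e_def q_def)
    ultimately show ?thesis
      using f2M[OF that(2)] e0[of "s/2"] \<rho> M0 by (simp only: norm_divide) (intro frac_le, auto)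
  qed
  have N0: "N > 0" using N by simp
  \<comment> \<open>The bands of radius s / 2 around the two lines lie in the domain and keep the
    distance s / 2 from the height of z, where the denominator has its zeros.\<close>
  have d1: "cmod (grid_mean N \<rho>1 \<phi> - grid_mean N (-\<rho>1) \<phi>) \<le> 8 * pi * (2 * M / (1 - exp (- (s/2)))) / (s/2 * N)"
    using \<rho> z by (intro grid_mean_shift[OF hol per _ _ _ N0] bd\<phi>) (unfold \<rho>1_def, linarith+)
  define E where "E = 8 * pi * (M * exp (n * \<rho>)) / (s * N)"
  define rp where "rp = grid_mean N \<rho>1 (\<lambda>\<zeta>. f \<zeta> * (q \<zeta> ^ (n+1) / (q \<zeta> - 1)))"
  define rm where "rm = grid_mean N (-\<rho>1) (\<lambda>\<zeta>. f \<zeta> * (inverse (q \<zeta>) ^ (n+1) / (1 - inverse (q \<zeta>))))"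
  have rem: "exp (- (real (n+1) * s)) \<ge> 0" by simp
  have rp: "cmod rp \<le> 2 * M * (exp (- (real (n+1) * s)) / (1 - exp (- s)))"
    unfolding rp_def
  proof (rule grid_mean_bound[OF N0])
    fix \<zeta> assume \<zeta>: "Im \<zeta> = \<rho>1"
    have "cmod (q \<zeta>) ^ (n+1) \<le> exp (-s) ^ (n+1)"
      using \<zeta> z \<rho> by (intro power_mono) (auto simp: nq \<rho>1_def)
    also have "\<dots> = exp (- (real (n+1) * s))"
      by (simp only: exp_of_nat_mult[symmetric]) simp
    finally have "cmod (q \<zeta> ^ (n+1) / (q \<zeta> - 1)) \<le> exp (- (real (n+1) * s)) / (1 - exp (- s))"
      using low[of s \<zeta>] e0[of s] \<rho> \<zeta> z unfolding norm_divide norm_power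
      by (intro frac_le) (auto simp: e_def q_def \<rho>1_def)
    then show "cmod (f \<zeta> * (q \<zeta> ^ (n+1) / (q \<zeta> - 1))) \<le> 2 * M * (exp (- (real (n+1) * s)) / (1 - exp (- s)))"
      unfolding norm_mult[of "f \<zeta>"] using f2M[of \<zeta>] \<zeta> \<rho> M0 by (intro mult_mono) (auto simp: \<rho>1_def)
  qed
  have rm: "cmod rm \<le> 2 * M * (exp (- (real (n+1) * s)) / (1 - exp (- s)))"
    unfolding rm_def
  proof (rule grid_mean_bound[OF N0])
    fix \<zeta> assume \<zeta>: "Im \<zeta> = -\<rho>1"
    have iq: "cmod (inverse (q \<zeta>)) \<le> exp (-s)"
      using \<zeta> z \<rho> by (auto simp: nq \<rho>1_def norm_inverse simp flip: exp_minus)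
    have "cmod (inverse (q \<zeta>)) ^ (n+1) \<le> exp (-s) ^ (n+1)"
      by (rule power_mono[OF iq]) simp
    also have "\<dots> = exp (- (real (n+1) * s))"
      by (simp only: exp_of_nat_mult[symmetric]) simp
    finally have "cmod (inverse (q \<zeta>) ^ (n+1) / (1 - inverse (q \<zeta>))) \<le> exp (- (real (n+1) * s)) / (1 - exp (- s))"
      using norm_triangle_ineq2[of 1 "inverse (q \<zeta>)"] iq e0[of s] \<rho> unfolding norm_divide norm_power
      by (intro frac_le) auto
    then show "cmod (f \<zeta> * (inverse (q \<zeta>) ^ (n+1) / (1 - inverse (q \<zeta>)))) \<le> 2 * M * (exp (- (real (n+1) * s)) / (1 - exp (- s)))"
      unfolding norm_mult[of "f \<zeta>"] using f2M[of \<zeta>] \<zeta> \<rho> M0 by (intro mult_mono) (auto simp: \<rho>1_def)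
  qed
  define cp where "cp k = grid_mean N \<rho>1 (\<lambda>\<zeta>. g \<zeta> * exp (- (\<i> * of_int (- int k) * \<zeta>)))" for k
  define cm where "cm k = grid_mean N (-\<rho>1) (\<lambda>\<zeta>. g \<zeta> * exp (- (\<i> * of_int (int k) * \<zeta>)))" for k
  \<comment> \<open>Here 1 / (q - 1) is minus the sum of q^k over k \<le> n plus q^(n+1) / (q - 1).
    The means of the q^k vanish for 0 < k < N, so only k = 0 contributes to the multiple of
    g(z).\<close>
  have up: "grid_mean N \<rho>1 \<phi> = g z - (\<Sum>k\<le>n. exp (\<i> * of_int (- int k) * z) * cp k) + rp"
  proof -
    have "grid_mean N \<rho>1 \<phi> = grid_mean N \<rho>1 (\<lambda>\<zeta>.
        (g z * (\<Sum>k\<le>n. exp (\<i> * of_nat k * (\<zeta> - z)))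
          - (\<Sum>k\<le>n. exp (\<i> * of_int (- int k) * z) * (g \<zeta> * exp (- (\<i> * of_int (- int k) * \<zeta>)))))
        + f \<zeta> * (q \<zeta> ^ (n+1) / (q \<zeta> - 1)))"
    proof (rule grid_mean_cong)
      fix \<zeta> assume \<zeta>: "Im \<zeta> = \<rho>1"
      have q: "\<phi> \<zeta> = f \<zeta> / (q \<zeta> - 1)" "q \<zeta> \<noteq> 1" using \<phi>[of \<zeta>] z \<zeta> \<rho> by (auto simp: \<rho>1_def)
      have "(\<Sum>k\<le>n. q \<zeta> ^ k) = (q \<zeta> ^ (n+1) - 1) / (q \<zeta> - 1)"
        using geometric_sum[OF q(2), of "Suc n"] by (simp add: lessThan_Suc_atMost)
      moreover have "\<phi> \<zeta> = f \<zeta> * (q \<zeta> ^ (n+1) / (q \<zeta> - 1) - (q \<zeta> ^ (n+1) - 1) / (q \<zeta> - 1))"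
        unfolding q(1) diff_divide_distrib[symmetric] by simp
      ultimately have "\<phi> \<zeta> = f \<zeta> * (q \<zeta> ^ (n+1) / (q \<zeta> - 1)) - f \<zeta> * (\<Sum>k\<le>n. q \<zeta> ^ k)"
        by (simp only: right_diff_distrib)
      also have "f \<zeta> * (\<Sum>k\<le>n. q \<zeta> ^ k) = g \<zeta> * (\<Sum>k\<le>n. q \<zeta> ^ k) - g z * (\<Sum>k\<le>n. q \<zeta> ^ k)"
        by (simp add: f_def algebra_simps)
      also have "(\<Sum>k\<le>n. q \<zeta> ^ k) = (\<Sum>k\<le>n. exp (\<i> * of_nat k * (\<zeta> - z)))"
        by (intro sum.cong) (auto simp: q_def mult_ac simp flip: exp_of_nat_mult)
      also have "g \<zeta> * (\<Sum>k\<le>n. exp (\<i> * of_nat k * (\<zeta> - z)))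
        = (\<Sum>k\<le>n. exp (\<i> * of_int (- int k) * z) * (g \<zeta> * exp (- (\<i> * of_int (- int k) * \<zeta>))))"
        by (auto simp: sum_distrib_left mult_ac exp_add[symmetric] algebra_simps exp_diff exp_minus divide_inverse intro!: sum.cong)
      finally show "\<phi> \<zeta> = (g z * (\<Sum>k\<le>n. exp (\<i> * of_nat k * (\<zeta> - z)))
          - (\<Sum>k\<le>n. exp (\<i> * of_int (- int k) * z) * (g \<zeta> * exp (- (\<i> * of_int (- int k) * \<zeta>)))))
        + f \<zeta> * (q \<zeta> ^ (n+1) / (q \<zeta> - 1))" by simp
    qed
    also have "\<dots> = g z * (\<Sum>k\<le>n. grid_mean N \<rho>1 (\<lambda>\<zeta>. exp (\<i> * of_nat k * (\<zeta> - z))))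
        - (\<Sum>k\<le>n. exp (\<i> * of_int (- int k) * z) * cp k) + rp"
      by (simp add: grid_mean_add grid_mean_diff grid_mean_cmult grid_mean_sum rp_def cp_def)
    also have "(\<Sum>k\<le>n. grid_mean N \<rho>1 (\<lambda>\<zeta>. exp (\<i> * of_nat k * (\<zeta> - z)))) = (\<Sum>k\<le>n. if k = 0 then 1 else 0)"
    proof (rule sum.cong)
      fix k assume "k \<in> {..n}"
      then show "grid_mean N \<rho>1 (\<lambda>\<zeta>. exp (\<i> * of_nat k * (\<zeta> - z))) = (if k = 0 then 1 else 0)"
        using N grid_mean_exp[of k N \<rho>1 z] by (cases "k = 0") (auto simp: grid_mean_def)
    qed simp
    finally show ?thesis by simp
  qed
  \<comment> \<open>Conjugation reverses the exponent and maps the lower line to the upper one,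
    which reduces the claim to \<open>grid_mean_exp\<close>.\<close>
  have iq0: "grid_mean N (-\<rho>1) (\<lambda>\<zeta>. exp (- (\<i> * of_nat k * (\<zeta> - z)))) = 0" if "1 \<le> k" "k \<le> n" for k
  proof -
    have "cnj (grid_mean N (-\<rho>1) (\<lambda>\<zeta>. exp (- (\<i> * of_nat k * (\<zeta> - z)))))
       = grid_mean N \<rho>1 (\<lambda>\<zeta>. exp (\<i> * of_nat k * (\<zeta> - cnj z)))"
      unfolding grid_mean_def by (simp add: exp_cnj complex_cnj)
    then show ?thesis using grid_mean_exp[of k N \<rho>1 "cnj z"] that N by simp
  qed
  \<comment> \<open>With p = 1 / q, the quotient 1 / (q - 1) is the sum of p^k over 1 \<le> k \<le>
    n plus p^(n+1) / (1 - p). The sum starts at 1, so no multiple of g(z) survives.\<close>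
  have dn: "grid_mean N (-\<rho>1) \<phi> = (\<Sum>k=1..n. exp (\<i> * of_int (int k) * z) * cm k) + rm"
  proof -
    have "grid_mean N (-\<rho>1) \<phi> = grid_mean N (-\<rho>1) (\<lambda>\<zeta>.
        ((\<Sum>k=1..n. exp (\<i> * of_int (int k) * z) * (g \<zeta> * exp (- (\<i> * of_int (int k) * \<zeta>))))
          - g z * (\<Sum>k=1..n. exp (- (\<i> * of_nat k * (\<zeta> - z)))))
        + f \<zeta> * (inverse (q \<zeta>) ^ (n+1) / (1 - inverse (q \<zeta>))))"
    proof (rule grid_mean_cong)
      fix \<zeta> assume \<zeta>: "Im \<zeta> = -\<rho>1"
      define p where "p = inverse (q \<zeta>)"
      have q: "\<phi> \<zeta> = f \<zeta> / (q \<zeta> - 1)" "q \<zeta> \<noteq> 1" using \<phi>[of \<zeta>] z \<zeta> \<rho> by (auto simp: \<rho>1_def)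
      have q0: "q \<zeta> \<noteq> 0" by (simp add: q_def)
      have p: "p \<noteq> 1" "1 - p \<noteq> 0" using q by (auto simp: p_def)
      have "(\<Sum>k=1..n. p ^ k) = (\<Sum>k\<le>n. p ^ k) - 1"
        by (simp add: atMost_atLeast0 sum.atLeast_Suc_atMost)
      then have "(1 - p) * (\<Sum>k=1..n. p ^ k) = p - p ^ (n+1)"
        using sum_gp_basic[of p n] by (simp add: right_diff_distrib)
      then have "(\<Sum>k=1..n. p ^ k) = (p - p ^ (n+1)) / (1 - p)"
        using p(2) by (simp add: eq_divide_eq mult.commute)
      then have "(\<Sum>k=1..n. p ^ k) = p / (1 - p) - p ^ (n+1) / (1 - p)"
        by (simp only: diff_divide_distrib)
      moreover have "1 / (q \<zeta> - 1) = p / (1 - p)"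
        using q q0 by (simp add: p_def field_simps)
      ultimately have "1 / (q \<zeta> - 1) = (\<Sum>k=1..n. p ^ k) + p ^ (n+1) / (1 - p)" by simp
      then have "\<phi> \<zeta> = f \<zeta> * (\<Sum>k=1..n. p ^ k) + f \<zeta> * (p ^ (n+1) / (1 - p))"
        unfolding q(1) by (metis (no_types) distrib_left divide_inverse inverse_eq_divide)
      also have "f \<zeta> * (\<Sum>k=1..n. p ^ k) = g \<zeta> * (\<Sum>k=1..n. p ^ k) - g z * (\<Sum>k=1..n. p ^ k)"
        by (simp add: f_def algebra_simps)
      also have "(\<Sum>k=1..n. p ^ k) = (\<Sum>k=1..n. exp (- (\<i> * of_nat k * (\<zeta> - z))))"
        by (intro sum.cong) (auto simp: p_def q_def mult_ac simp flip: exp_minus exp_of_nat_mult)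
      also have "g \<zeta> * (\<Sum>k=1..n. exp (- (\<i> * of_nat k * (\<zeta> - z))))
        = (\<Sum>k=1..n. exp (\<i> * of_int (int k) * z) * (g \<zeta> * exp (- (\<i> * of_int (int k) * \<zeta>))))"
        by (auto simp: sum_distrib_left mult_ac exp_add[symmetric] algebra_simps exp_diff exp_minus divide_inverse intro!: sum.cong)
      finally show "\<phi> \<zeta> = ((\<Sum>k=1..n. exp (\<i> * of_int (int k) * z) * (g \<zeta> * exp (- (\<i> * of_int (int k) * \<zeta>))))
          - g z * (\<Sum>k=1..n. exp (- (\<i> * of_nat k * (\<zeta> - z)))))
        + f \<zeta> * (inverse (q \<zeta>) ^ (n+1) / (1 - inverse (q \<zeta>)))" by (simp add: p_def)
    qed
    also have "\<dots> = (\<Sum>k=1..n. exp (\<i> * of_int (int k) * z) * cm k)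
        - g z * (\<Sum>k=1..n. grid_mean N (-\<rho>1) (\<lambda>\<zeta>. exp (- (\<i> * of_nat k * (\<zeta> - z))))) + rm"
      by (simp add: grid_mean_add grid_mean_diff grid_mean_cmult grid_mean_sum rm_def cm_def)
    finally show ?thesis using iq0 by simp
  qed
  have cp: "cmod (cp k - fourier_coef N (- int k) g) \<le> E" if "k \<le> n" for k
    unfolding cp_def E_def using that \<rho> by (intro fourier_coef_shift[OF g _ _ N0]) (auto simp: \<rho>1_def)
  have cm: "cmod (cm k - fourier_coef N (int k) g) \<le> E" if "k \<le> n" for k
    unfolding cm_def E_def using that \<rho> by (intro fourier_coef_shift[OF g _ _ N0]) (auto simp: \<rho>1_def)
  have ex: "cmod (exp (\<i> * of_int k * z)) \<le> exp (n * \<rho>)" if "\<bar>k\<bar> \<le> int n" for k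
  proof -
    have "- (k * Im z) \<le> \<bar>k * Im z\<bar>" by simp
    also have "\<dots> = \<bar>k\<bar> * \<bar>Im z\<bar>" by (simp add: abs_mult)
    also have "\<dots> \<le> n * \<rho>" using that z \<rho> by (intro mult_mono) auto
    finally show ?thesis by simp
  qed
  have tm: "cmod (exp (\<i> * of_int k * z) * c) \<le> exp (n * \<rho>) * E" if "\<bar>k\<bar> \<le> int n" "cmod c \<le> E" for k c
    unfolding norm_mult using ex[OF that(1)] that(2) by (intro mult_mono) auto
  \<comment> \<open>X and Y account for the coefficients having been sampled at the heights
    \<plusminus> \<open>\<rho>1\<close> and not on the real axis.\<close>
  define X where "X = (\<Sum>k\<le>n. exp (\<i> * of_int (- int k) * z) * (cp k - fourier_coef N (- int k) g))"
  define Y where "Y = (\<Sum>k=1..n. exp (\<i> * of_int (int k) * z) * (cm k - fourier_coef N (int k) g))"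
  have X: "cmod X \<le> (\<Sum>k\<le>n. exp (n * \<rho>) * E)"
    unfolding X_def using cp by (intro order_trans[OF norm_sum] sum_mono tm) auto
  have Y: "cmod Y \<le> (\<Sum>k=1..n. exp (n * \<rho>) * E)"
    unfolding Y_def using cm by (intro order_trans[OF norm_sum] sum_mono tm) auto
  have "g z - (\<Sum>k\<in>{-int n..int n}. fourier_coef N k g * exp (\<i> * of_int k * z))
     = (grid_mean N \<rho>1 \<phi> - grid_mean N (-\<rho>1) \<phi>) - rp + rm + X + Y"
    unfolding up dn sum_int_symmetric X_def Y_def
    by (simp add: right_diff_distrib sum_subtractf mult.commute)
  also have "cmod \<dots> \<le> cmod (grid_mean N \<rho>1 \<phi> - grid_mean N (-\<rho>1) \<phi>) + cmod rp + cmod rm + cmod X + cmod Y"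
  proof -
    have "cmod (a - b + c + d + e) \<le> cmod a + cmod b + cmod c + cmod d + cmod e" for a b c d e
      using norm_triangle_ineq[of "a - b + c + d" e] norm_triangle_ineq[of "a - b + c" d]
        norm_triangle_ineq[of "a - b" c] norm_triangle_ineq4[of a b] by linarith
    then show ?thesis .
  qed
  also have "\<dots> \<le> 8 * pi * (2 * M / (1 - exp (- (s/2)))) / (s/2 * N)
      + 2 * M * (exp (- (real (n+1) * s)) / (1 - exp (- s))) + 2 * M * (exp (- (real (n+1) * s)) / (1 - exp (- s)))
      + (\<Sum>k\<le>n. exp (n * \<rho>) * E) + (\<Sum>k=1..n. exp (n * \<rho>) * E)"
    by (intro add_mono d1 rp rm X Y)
  also have "\<dots> = 4 * M * exp (- (real (n + 1) * s)) / (1 - exp (- s)) +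
       (32 * pi * M / (s * (1 - exp (- (s/2)))) + (2 * n + 1) * exp (n * \<rho>) * (8 * pi * (M * exp (n * \<rho>)) / s)) / N"
    by (simp add: E_def add_divide_distrib algebra_simps)
  finally show ?thesis by (simp only: of_nat_add of_nat_mult of_nat_numeral of_nat_1)
qed

text \<open>All discretisation errors carry a factor 1 / N, so \<open>N\<close> can be chosen from
  \<open>n\<close> and the widths alone, before \<open>g\<close> and \<open>M\<close>. Absorbing the
  errors raises the constant for the coefficients from 1 to 2 and that for the remainder from 4 to
  5.\<close>

lemma fourier_approximation:
  fixes \<rho> \<rho>' s :: real and n :: nat
  assumes \<rho>: "0 < \<rho>'" "s > 0" "\<rho> = \<rho>' + 2 * s"
  shows "\<exists>N>0. \<forall>g M. bounded_periodic \<rho> M g \<longrightarrow>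
     (\<forall>k. \<bar>k\<bar> \<le> int n \<longrightarrow> cmod (fourier_coef N k g) \<le> 2 * M * exp (- (real_of_int \<bar>k\<bar> * (\<rho>' + s)))) \<and>
     (\<forall>z. \<bar>Im z\<bar> < \<rho>' \<longrightarrow>
        cmod (g z - (\<Sum>k\<in>{-int n..int n}. fourier_coef N k g * exp (\<i> * of_int k * z)))
          \<le> 5 * M * exp (- (real (n + 1) * s)) / (1 - exp (- s)))"
proof -
  \<comment> \<open>N \<ge> a brings the error of a coefficient below M exp (-n \<rho>), which is
    less than the decay of every frequency up to \<open>n\<close>; N \<ge> b does the same for the
    remainder. In addition N > n is required for orthogonality.\<close>
  define a where "a = 8 * pi * exp (n * \<rho>) / s * exp (n * \<rho>)"
  define X where "X = 32 * pi / (s * (1 - exp (- (s/2)))) + (2 * n + 1) * exp (n * \<rho>) * (8 * pi * exp (n * \<rho>) / s)"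
  define b where "b = X * exp (real (n + 1) * s)"
  have X0: "X \<ge> 0" unfolding X_def using \<rho> by (intro add_nonneg_nonneg mult_nonneg_nonneg divide_nonneg_nonneg) auto
  obtain N :: nat where N: "real N > max (max a b) (real n)" using reals_Archimedean2 by blast
  have Nn: "n < N" "N > 0" using N by auto
  have "8 * pi * exp (n * \<rho>) / s * exp (n * \<rho>) \<le> real N" "X * exp (real (n + 1) * s) \<le> real N"
    using N by (auto simp: a_def b_def)
  moreover have "x / N \<le> exp (- t)" if "x * exp t \<le> real N" for x t
  proof -
    have "x = x * exp t * exp (- t)" by (simp flip: exp_add)
    also have "\<dots> \<le> N * exp (- t)" using that by (intro mult_right_mono) auto
    finally show ?thesis using Nn by (simp add: pos_divide_le_eq mult.commute)
  qed
  ultimately have e1: "8 * pi * exp (n * \<rho>) / s / N \<le> exp (- (n * \<rho>))"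
    and e2: "X / N \<le> exp (- (real (n + 1) * s))"
    by blast+
  show ?thesis
  proof (intro exI[of _ N] conjI allI impI)
    fix g M k assume g: "bounded_periodic \<rho> M g" and k: "\<bar>k\<bar> \<le> int n"
    have M0: "M \<ge> 0"
      using bounded_periodic_nonneg[OF g] \<rho> by simp
    have "cmod (fourier_coef N k g) \<le> M * exp (- (real_of_int \<bar>k\<bar> * (\<rho>' + s))) + 8 * pi * (M * exp (n * \<rho>)) / ((\<rho> - (\<rho>' + s)) * N)"
      using fourier_coef_bound[OF g _ _ Nn(2) k, of "\<rho>' + s"] \<rho> by simp
    also have "8 * pi * (M * exp (n * \<rho>)) / ((\<rho> - (\<rho>' + s)) * N) = M * (8 * pi * exp (n * \<rho>) / s / N)"
      using \<rho> by simp
    also have "\<dots> \<le> M * exp (- (n * \<rho>))" using e1 M0 by (rule mult_left_mono)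
    also have "\<dots> \<le> M * exp (- (real_of_int \<bar>k\<bar> * (\<rho>' + s)))"
    proof -
      have "\<bar>k\<bar> * (\<rho>' + s) \<le> n * \<rho>" using k \<rho> by (intro mult_mono) auto
      then show ?thesis using M0 by (intro mult_left_mono) auto
    qed
    finally show "cmod (fourier_coef N k g) \<le> 2 * M * exp (- (real_of_int \<bar>k\<bar> * (\<rho>' + s)))" by simp
  next
    fix g M z assume g: "bounded_periodic \<rho> M g" and z: "\<bar>Im z\<bar> < \<rho>'"
    have M0: "M \<ge> 0"
      using bounded_periodic_nonneg[OF g] \<rho> by simp
    have "cmod (g z - (\<Sum>k\<in>{-int n..int n}. fourier_coef N k g * exp (\<i> * of_int k * z)))
      \<le> 4 * M * exp (- (real (n + 1) * s)) / (1 - exp (- s)) + M * (X / N)"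
      using fourier_remainder[OF g \<rho> Nn(1) z] by (simp add: X_def algebra_simps)
    also have "M * (X / N) \<le> M * exp (- (real (n + 1) * s))" using e2 M0 by (rule mult_left_mono)
    also have "\<dots> \<le> M * (exp (- (real (n + 1) * s)) / (1 - exp (- s)))"
      using \<rho> M0 by (intro mult_left_mono) (simp_all add: le_divide_eq mult_left_le)
    also have "4 * M * exp (- (real (n + 1) * s)) / (1 - exp (- s)) + \<dots>
        = 5 * M * exp (- (real (n + 1) * s)) / (1 - exp (- s))"
      by simp
    finally show "cmod (g z - (\<Sum>k\<in>{-int n..int n}. fourier_coef N k g * exp (\<i> * of_int k * z)))
          \<le> 5 * M * exp (- (real (n + 1) * s)) / (1 - exp (- s))"
      by simp
  qed (use Nn in auto)
qed

subsection \<open>Sampled Fourier coefficients in several variables\<close>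

definition upd :: "'a ^ 'n \<Rightarrow> 'n \<Rightarrow> 'a \<Rightarrow> 'a ^ 'n" where
  "upd \<theta> m z = (\<chi> i. if i = m then z else \<theta> $ i)"

lemma upd_nth [simp]: "upd \<theta> m z $ i = (if i = m then z else \<theta> $ i)"
  by (simp add: upd_def)

lemma upd_self [simp]: "upd \<theta> m (\<theta> $ m) = \<theta>"
  by (simp add: vec_eq_iff)

lemma upd_upd [simp]: "upd (upd \<theta> m z) m w = upd \<theta> m w"
  by (simp add: vec_eq_iff)

lemma upd_commute: "m \<noteq> m' \<Longrightarrow> upd (upd \<theta> m z) m' w = upd (upd \<theta> m' w) m z"
  by (simp add: vec_eq_iff)

text \<open>The widths may differ between the variables: in the induction over variables those
  already truncated live on the smaller strip and the others on the full one.\<close>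

definition box_strip :: "('n \<Rightarrow> real) \<Rightarrow> (complex^'n) set" where
  "box_strip r = {\<theta>. \<forall>m. \<bar>Im (\<theta> $ m)\<bar> < r m}"

text \<open>Separate holomorphy is all that is required, since the variables are sampled one at a
  time.\<close>

definition sep_periodic :: "real \<Rightarrow> (complex^'n \<Rightarrow> complex) \<Rightarrow> bool" where
  "sep_periodic \<rho> g \<longleftrightarrow> (\<forall>\<theta>\<in>box_strip (\<lambda>_. \<rho>). \<forall>m.
     (\<lambda>z. g (upd \<theta> m z)) holomorphic_on hstrip \<rho> \<and>
     (\<forall>z\<in>hstrip \<rho>. g (upd \<theta> m (z + 2 * pi)) = g (upd \<theta> m z)))"

definition partial_coef :: "nat \<Rightarrow> 'n \<Rightarrow> int \<Rightarrow> (complex^'n \<Rightarrow> complex) \<Rightarrow> complex^'n \<Rightarrow> complex" where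
  "partial_coef N m k g \<theta> = fourier_coef N k (\<lambda>z. g (upd \<theta> m z))"

primrec iter_coef :: "nat \<Rightarrow> 'n list \<Rightarrow> ('n \<Rightarrow> int) \<Rightarrow> (complex^'n \<Rightarrow> complex) \<Rightarrow> complex^'n \<Rightarrow> complex" where
  "iter_coef N [] k g = g"
| "iter_coef N (m # ms) k g = partial_coef N m (k m) (iter_coef N ms k g)"

definition partial_trunc :: "nat \<Rightarrow> nat \<Rightarrow> 'n \<Rightarrow> (complex^'n \<Rightarrow> complex) \<Rightarrow> complex^'n \<Rightarrow> complex" where
  "partial_trunc N n m g \<theta> = (\<Sum>k\<in>{-int n..int n}. partial_coef N m k g \<theta> * exp (\<i> * of_int k * \<theta> $ m))"

primrec iter_trunc :: "nat \<Rightarrow> nat \<Rightarrow> 'n list \<Rightarrow> (complex^'n \<Rightarrow> complex) \<Rightarrow> complex^'n \<Rightarrow> complex" where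
  "iter_trunc N n [] g = g"
| "iter_trunc N n (m # ms) g = partial_trunc N n m (iter_trunc N n ms g)"

lemma partial_coef_eq:
  "partial_coef N m k g \<theta> =
     (\<Sum>j<N. exp (- (\<i> * of_int k * Complex (2 * pi * real j / real N) 0)) / of_nat N
        * g (upd \<theta> m (Complex (2 * pi * real j / real N) 0)))"
  by (simp add: partial_coef_def fourier_coef_def grid_mean_def sum_divide_distrib mult.commute)

lemma partial_coef_sum:
  "partial_coef N m k (\<lambda>\<theta>. \<Sum>a\<in>A. c a * g a \<theta>) \<theta> = (\<Sum>a\<in>A. c a * partial_coef N m k (g a) \<theta>)"
  unfolding partial_coef_eq sum_distrib_left by (subst sum.swap) (simp add: mult_ac)

lemma partial_coef_diff:
  "partial_coef N m k (\<lambda>\<theta>. f \<theta> - g \<theta>) \<theta> = partial_coef N m k f \<theta> - partial_coef N m k g \<theta>"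
  unfolding partial_coef_eq by (simp add: sum_subtractf right_diff_distrib)

lemma iter_coef_sum:
  "iter_coef N ms k (\<lambda>\<theta>. \<Sum>a\<in>A. c a * g a \<theta>) = (\<lambda>\<theta>. \<Sum>a\<in>A. c a * iter_coef N ms k (g a) \<theta>)"
  by (induction ms) (simp_all add: partial_coef_sum)

lemma partial_trunc_diff:
  "partial_trunc N n m (\<lambda>\<theta>. f \<theta> - g \<theta>) \<theta> = partial_trunc N n m f \<theta> - partial_trunc N n m g \<theta>"
  by (simp add: partial_trunc_def partial_coef_diff left_diff_distrib sum_subtractf)

lemma box_strip_upd: "\<theta> \<in> box_strip r \<Longrightarrow> \<bar>Im z\<bar> < r m \<Longrightarrow> upd \<theta> m z \<in> box_strip r"
  by (simp add: box_strip_def)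

lemma sep_periodic_sum:
  assumes "finite A" "\<And>a. a \<in> A \<Longrightarrow> sep_periodic \<rho> (g a)"
  shows "sep_periodic \<rho> (\<lambda>\<theta>. \<Sum>a\<in>A. c a * g a \<theta>)"
  using assms by (auto simp: sep_periodic_def intro!: holomorphic_intros)

lemma sep_periodic_diff:
  assumes "sep_periodic \<rho> f" "sep_periodic \<rho> g"
  shows "sep_periodic \<rho> (\<lambda>\<theta>. f \<theta> - g \<theta>)"
  using assms by (auto simp: sep_periodic_def intro!: holomorphic_intros)

lemma sep_periodic_mult:
  assumes "sep_periodic \<rho> f" "sep_periodic \<rho> g"
  shows "sep_periodic \<rho> (\<lambda>\<theta>. f \<theta> * g \<theta>)"
  using assms by (auto simp: sep_periodic_def intro!: holomorphic_intros)

lemma sep_periodic_exp: "sep_periodic \<rho> (\<lambda>\<theta>. exp (\<i> * of_int k * \<theta> $ m))"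
proof -
  have "exp (\<i> * complex_of_int k * (z + complex_of_real (2 * pi))) = exp (\<i> * complex_of_int k * z)" for z
    using exp_int_periodic[of k z] by simp
  moreover have "(\<lambda>z. if m = m' then z else c) holomorphic_on A" for m' :: 'a and c and A
    by (cases "m = m'") (auto intro!: holomorphic_intros)
  ultimately show ?thesis
    by (auto simp del: of_real_mult simp: sep_periodic_def intro!: holomorphic_intros)
qed

lemma sep_periodic_freeze:
  fixes g :: "complex^'n \<Rightarrow> complex"
  assumes g: "sep_periodic \<rho> g" and x: "\<bar>Im x\<bar> < \<rho>"
  shows "sep_periodic \<rho> (\<lambda>\<theta>. g (upd \<theta> m x))"
  unfolding sep_periodic_def
proof (intro ballI allI)
  fix \<theta> :: "complex^'n" and m' assume \<theta>: "\<theta> \<in> box_strip (\<lambda>_. \<rho>)"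
  show "(\<lambda>z. g (upd (upd \<theta> m' z) m x)) holomorphic_on hstrip \<rho> \<and>
       (\<forall>z\<in>hstrip \<rho>. g (upd (upd \<theta> m' (z + complex_of_real (2 * pi))) m x) = g (upd (upd \<theta> m' z) m x))"
  proof (cases "m' = m")
    case False
    have "upd \<theta> m x \<in> box_strip (\<lambda>_. \<rho>)" using \<theta> x by (rule box_strip_upd)
    then show ?thesis
      using g unfolding sep_periodic_def upd_commute[OF False] by blast
  qed auto
qed

lemma sep_periodic_partial_coef:
  assumes g: "sep_periodic \<rho> g" and \<rho>: "\<rho> > 0"
  shows "sep_periodic \<rho> (partial_coef N m k g)"
proof -
  have "partial_coef N m k g = (\<lambda>\<theta>. \<Sum>j<N. exp (- (\<i> * of_int k * Complex (2 * pi * real j / real N) 0)) / of_nat N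
        * g (upd \<theta> m (Complex (2 * pi * real j / real N) 0)))"
    by (rule ext) (rule partial_coef_eq)
  then show ?thesis
    using \<rho> by (simp only:) (intro sep_periodic_sum sep_periodic_freeze[OF g], auto)
qed

lemma sep_periodic_iter_coef:
  assumes g: "sep_periodic \<rho> g" and \<rho>: "\<rho> > 0"
  shows "sep_periodic \<rho> (iter_coef N ms k g)"
  by (induction ms) (simp_all add: g sep_periodic_partial_coef[OF _ \<rho>])

lemma sep_periodic_iter_trunc:
  assumes g: "sep_periodic \<rho> g" and \<rho>: "\<rho> > 0"
  shows "sep_periodic \<rho> (iter_trunc N n ms g)"
proof (induction ms)
  case (Cons m ms)
  have "iter_trunc N n (m # ms) g =
    (\<lambda>\<theta>. \<Sum>k\<in>{-int n..int n}. 1 * (partial_coef N m k (iter_trunc N n ms g) \<theta> * exp (\<i> * of_int k * \<theta> $ m)))"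
    by (simp add: partial_trunc_def fun_eq_iff)
  then show ?case
    by (simp only:) (intro sep_periodic_sum sep_periodic_mult sep_periodic_exp sep_periodic_partial_coef Cons \<rho>, auto)
qed (simp add: g)

text \<open>The conclusion of \<open>fourier_approximation\<close> as a property of
  \<open>N\<close>, so that the same grid can be used for all functions.\<close>

definition good_sampling :: "nat \<Rightarrow> nat \<Rightarrow> real \<Rightarrow> real \<Rightarrow> bool" where
  "good_sampling N n \<rho>' s \<longleftrightarrow> N > 0 \<and> (\<forall>g M. bounded_periodic (\<rho>' + 2 * s) M g \<longrightarrow>
     (\<forall>k. \<bar>k\<bar> \<le> int n \<longrightarrow> cmod (fourier_coef N k g) \<le> 2 * M * exp (- (real_of_int \<bar>k\<bar> * (\<rho>' + s)))) \<and>
     (\<forall>z. \<bar>Im z\<bar> < \<rho>' \<longrightarrow>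
        cmod (g z - (\<Sum>k\<in>{-int n..int n}. fourier_coef N k g * exp (\<i> * of_int k * z)))
          \<le> 5 * M * exp (- (real (n + 1) * s)) / (1 - exp (- s))))"

lemma ex_good_sampling: "0 < \<rho>' \<Longrightarrow> 0 < s \<Longrightarrow> \<exists>N. good_sampling N n \<rho>' s"
  using fourier_approximation[of \<rho>' s "\<rho>' + 2 * s" n] unfolding good_sampling_def by auto

lemma bounded_periodic_slice:
  assumes g: "sep_periodic \<rho> g" and \<theta>: "\<theta> \<in> box_strip (\<lambda>_. \<rho>)"
    and bd: "\<And>z. \<bar>Im z\<bar> < \<rho> \<Longrightarrow> cmod (g (upd \<theta> m z)) \<le> M"
  shows "bounded_periodic \<rho> M (\<lambda>z. g (upd \<theta> m z))"
  using g \<theta> bd by (auto simp: bounded_periodic_def sep_periodic_def hstrip_def)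

text \<open>One application of the scalar bound per variable, with the bound for the inner
  coefficients in the role of \<open>M\<close>. Each application costs a factor 2 and brings in the
  decay in that variable.\<close>

lemma iter_coef_bound:
  assumes good: "good_sampling N n \<rho>' s" and s: "0 < \<rho>'" "0 < s" and \<rho>: "\<rho> = \<rho>' + 2 * s"
    and g: "sep_periodic \<rho> g" and bd: "\<And>\<theta>. \<theta> \<in> box_strip (\<lambda>_. \<rho>) \<Longrightarrow> cmod (g \<theta>) \<le> M"
    and k: "\<And>m. \<bar>k m\<bar> \<le> int n" and \<theta>: "\<theta> \<in> box_strip (\<lambda>_. \<rho>)"
  shows "cmod (iter_coef N ms k g \<theta>) \<le> 2 ^ length ms * M * exp (- (real_of_int (\<Sum>m\<leftarrow>ms. \<bar>k m\<bar>) * (\<rho>' + s)))"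
  using \<theta>
proof (induction ms arbitrary: \<theta>)
  case Nil then show ?case using bd by simp
next
  case (Cons m ms)
  define B where "B = 2 ^ length ms * M * exp (- (real_of_int (\<Sum>m\<leftarrow>ms. \<bar>k m\<bar>) * (\<rho>' + s)))"
  have "bounded_periodic \<rho> B (\<lambda>z. iter_coef N ms k g (upd \<theta> m z))"
    unfolding B_def using s \<rho> Cons.prems
    by (intro bounded_periodic_slice sep_periodic_iter_coef g Cons.IH box_strip_upd) auto
  then have "cmod (partial_coef N m (k m) (iter_coef N ms k g) \<theta>) \<le> 2 * B * exp (- (real_of_int \<bar>k m\<bar> * (\<rho>' + s)))"
    using good k unfolding good_sampling_def partial_coef_def \<rho> by blast
  moreover have "exp (- (real_of_int (\<Sum>m\<leftarrow>m # ms. \<bar>k m\<bar>) * (\<rho>' + s)))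
      = exp (- (real_of_int (\<Sum>m\<leftarrow>ms. \<bar>k m\<bar>) * (\<rho>' + s))) * exp (- (real_of_int \<bar>k m\<bar> * (\<rho>' + s)))"
    by (simp only: exp_add[symmetric]) (simp add: algebra_simps)
  ultimately show ?case
    by (simp add: B_def mult_ac)
qed

text \<open>For frequency zero the coefficient is a plain average over real points, so no factor 2
  arises. This is why the diagonal correction is bounded by the norm of \<open>P\<close> with
  constant 1.\<close>

lemma iter_coef_bound_0:
  assumes N: "N > 0" and bd: "\<And>\<theta>. (\<And>m. Im (\<theta> $ m) = 0) \<Longrightarrow> cmod (g \<theta>) \<le> M" and \<theta>: "\<And>m. Im (\<theta> $ m) = 0"
  shows "cmod (iter_coef N ms (\<lambda>_. 0) g \<theta>) \<le> M"
  using \<theta>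
proof (induction ms arbitrary: \<theta>)
  case Nil then show ?case using bd by simp
next
  case (Cons m ms)
  show ?case
    unfolding iter_coef.simps partial_coef_def fourier_coef_def using Cons.prems
    by (intro grid_mean_bound N) (auto intro!: Cons.IH)
qed

lemma sum_exp_abs_bound:
  fixes s :: real assumes "s > 0"
  shows "(\<Sum>k\<in>{-int n..int n}. exp (- (real_of_int \<bar>k\<bar> * s))) \<le> 2 / (1 - exp (- s))"
proof -
  have q: "exp (-s) < 1" using assms by simp
  have *: "(\<Sum>k\<in>A. exp (- s) ^ k) \<le> 1 / (1 - exp (- s))" if "finite A" for A :: "nat set"
    using sum_le_suminf[OF summable_geometric that, of "exp (-s)"] q by (simp add: suminf_geometric)
  have "(\<Sum>k\<in>{-int n..int n}. exp (- (real_of_int \<bar>k\<bar> * s)))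
     = (\<Sum>k\<le>n. exp (- s) ^ k) + (\<Sum>k=1..n. exp (- s) ^ k)"
    unfolding sum_int_symmetric by (simp add: exp_of_nat_mult[symmetric])
  then show ?thesis using *[of "{..n}"] *[of "{1..n}"] by simp
qed

text \<open>Telescoping over the variables: g - T_m T g = (g - T_m g) + T_m (g - T g). The first
  term is the estimate in one variable. In the second, truncation in one variable passes from width
  \<rho> to width \<open>\<rho>'\<close> with norm at most 4 / (1 - exp (-s)), because the
  coefficients decay faster by s than the exponentials grow.\<close>

lemma iter_trunc_error:
  fixes g :: "complex^'n \<Rightarrow> complex"
  assumes good: "good_sampling N n \<rho>' s" and s: "0 < \<rho>'" "0 < s" and \<rho>: "\<rho> = \<rho>' + 2 * s"
    and g: "sep_periodic \<rho> g" and bd: "\<And>\<theta>. \<theta> \<in> box_strip (\<lambda>_. \<rho>) \<Longrightarrow> cmod (g \<theta>) \<le> M"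
    and \<theta>: "\<theta> \<in> box_strip (\<lambda>m. if m \<in> set ms then \<rho>' else \<rho>)" and "distinct ms"
  shows "cmod (g \<theta> - iter_trunc N n ms g \<theta>)
     \<le> length ms * (5 / (1 - exp (- s))) ^ length ms * exp (- (real (n + 1) * s)) * M"
  using \<theta> \<open>distinct ms\<close>
proof (induction ms arbitrary: \<theta>)
  case (Cons m ms)
  define E where "E = 1 / (1 - exp (- s))"
  define \<epsilon> where "\<epsilon> = exp (- (real (n + 1) * s))"
  define Y where "Y = length ms * (5 * E) ^ length ms * \<epsilon> * M"
  have E: "E \<ge> 1" using s by (simp add: E_def)
  have \<rho>0: "\<rho> > 0" "\<rho>' < \<rho>" using s \<rho> by auto
  have M0: "M \<ge> 0" using bd[of 0] \<rho>0 by (auto simp: box_strip_def intro: order_trans[OF norm_ge_zero])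
  have \<theta>\<rho>: "\<theta> \<in> box_strip (\<lambda>_. \<rho>)"
    using Cons.prems(1) \<rho>0 unfolding box_strip_def by (force split: if_splits)
  have \<theta>m: "\<bar>Im (\<theta> $ m)\<bar> < \<rho>'" using Cons.prems(1) by (auto simp: box_strip_def dest: spec[of _ m])
  define h where "h \<theta> = g \<theta> - iter_trunc N n ms g \<theta>" for \<theta>
  have "bounded_periodic \<rho> M (\<lambda>z. g (upd \<theta> m z))"
    using \<theta>\<rho> by (intro bounded_periodic_slice g bd box_strip_upd) auto
  then have "cmod (g (upd \<theta> m (\<theta> $ m)) - (\<Sum>k\<in>{-int n..int n}.
       fourier_coef N k (\<lambda>z. g (upd \<theta> m z)) * exp (\<i> * of_int k * (\<theta> $ m)))) \<le> 5 * M * \<epsilon> / (1 - exp (- s))"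
    using good \<theta>m unfolding good_sampling_def \<rho> \<epsilon>_def by blast
  then have 1: "cmod (g \<theta> - partial_trunc N n m g \<theta>) \<le> 5 * E * \<epsilon> * M"
    by (simp add: partial_trunc_def partial_coef_def E_def mult_ac)
  \<comment> \<open>Since \<open>m\<close> does not occur in \<open>ms\<close>, the induction
    hypothesis holds with the variable \<open>m\<close> on the full width \<rho>, which is what the
    coefficient bound in that variable requires.\<close>
  have "bounded_periodic \<rho> Y (\<lambda>z. h (upd \<theta> m z))"
  proof (intro bounded_periodic_slice \<theta>\<rho>)
    show "sep_periodic \<rho> h"
      unfolding h_def using \<rho>0 by (intro sep_periodic_diff sep_periodic_iter_trunc g)
    fix z assume "\<bar>Im z\<bar> < \<rho>"
    then have "upd \<theta> m z \<in> box_strip (\<lambda>m. if m \<in> set ms then \<rho>' else \<rho>)"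
      using Cons.prems by (auto simp: box_strip_def split: if_splits)
    from Cons.IH[OF this] show "cmod (h (upd \<theta> m z)) \<le> Y"
      using Cons.prems(2) by (simp add: h_def Y_def E_def \<epsilon>_def)
  qed
  then have co: "cmod (partial_coef N m k h \<theta>) \<le> 2 * Y * exp (- (real_of_int \<bar>k\<bar> * (\<rho>' + s)))"
    if "k \<in> {-int n..int n}" for k
    using good that unfolding good_sampling_def \<rho> partial_coef_def by auto
  have Y0: "Y \<ge> 0" using M0 E by (simp add: Y_def \<epsilon>_def)
  have "cmod (partial_trunc N n m h \<theta>) \<le> (\<Sum>k\<in>{-int n..int n}. 2 * Y * exp (- (real_of_int \<bar>k\<bar> * s)))"
    unfolding partial_trunc_def
  proof (intro order_trans[OF norm_sum] sum_mono)
    fix k assume k: "k \<in> {-int n..int n}"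
    have "- (real_of_int k * Im (\<theta> $ m)) \<le> \<bar>real_of_int k * Im (\<theta> $ m)\<bar>" by simp
    also have "\<dots> \<le> real_of_int \<bar>k\<bar> * \<rho>'"
      using \<theta>m by (simp add: abs_mult mult_left_mono)
    finally have "cmod (exp (\<i> * of_int k * \<theta> $ m)) \<le> exp (real_of_int \<bar>k\<bar> * \<rho>')" by simp
    then have "cmod (partial_coef N m k h \<theta> * exp (\<i> * of_int k * \<theta> $ m))
      \<le> 2 * Y * exp (- (real_of_int \<bar>k\<bar> * (\<rho>' + s))) * exp (real_of_int \<bar>k\<bar> * \<rho>')"
      unfolding norm_mult using Y0 by (intro mult_mono co[OF k]) auto
    also have "\<dots> = 2 * Y * exp (- (real_of_int \<bar>k\<bar> * s))"
      by (simp add: mult.assoc flip: exp_add) (simp add: algebra_simps)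
    finally show "cmod (partial_coef N m k h \<theta> * exp (\<i> * of_int k * \<theta> $ m)) \<le> 2 * Y * exp (- (real_of_int \<bar>k\<bar> * s))" .
  qed
  also have "\<dots> = 2 * Y * (\<Sum>k\<in>{-int n..int n}. exp (- (real_of_int \<bar>k\<bar> * s)))"
    by (simp add: sum_distrib_left)
  also have "\<dots> \<le> 2 * Y * (2 * E)"
    using sum_exp_abs_bound[OF s(2), of n] Y0 by (intro mult_left_mono) (auto simp: E_def)
  finally have 2: "cmod (partial_trunc N n m h \<theta>) \<le> 5 * E * Y"
    using mult_nonneg_nonneg[OF _ Y0, of E] E by (simp add: mult_ac)
  have ht: "partial_trunc N n m h \<theta> = partial_trunc N n m g \<theta> - iter_trunc N n (m # ms) g \<theta>"
    unfolding h_def by (simp add: partial_trunc_diff)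
  have "cmod (g \<theta> - iter_trunc N n (m # ms) g \<theta>) \<le> 5 * E * \<epsilon> * M + 5 * E * Y"
    using norm_triangle_le[OF add_mono[OF 1 2]] unfolding ht by simp
  also have "5 * E * \<epsilon> * M \<le> (5 * E) ^ length (m # ms) * \<epsilon> * M"
  proof -
    have "5 * E \<le> (5 * E) ^ length (m # ms)" using E by (intro self_le_power) auto
    then show ?thesis using M0 by (intro mult_right_mono) (auto simp: \<epsilon>_def)
  qed
  finally show ?case
    by (simp add: Y_def E_def \<epsilon>_def algebra_simps add_divide_distrib)
qed simp

lemma iter_coef_cong: "(\<And>m. m \<in> set ms \<Longrightarrow> k m = k' m) \<Longrightarrow> iter_coef N ms k g = iter_coef N ms k' g"
  by (induction ms) auto

lemma sum_PiE_insert: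
  fixes f :: "('a \<Rightarrow> 'b) \<Rightarrow> 'c :: comm_monoid_add"
  assumes "m \<notin> J"
  shows "(\<Sum>k\<in>Pi\<^sub>E (insert m J) B. f k) = (\<Sum>b\<in>B m. \<Sum>k\<in>Pi\<^sub>E J B. f (k(m := b)))"
proof -
  have "(\<Sum>k\<in>Pi\<^sub>E (insert m J) B. f k) = (\<Sum>(b, k)\<in>B m \<times> Pi\<^sub>E J B. f (k(m := b)))"
    unfolding PiE_insert_eq by (subst sum.reindex[OF inj_combinator[OF assms]]) (simp add: case_prod_unfold)
  then show ?thesis by (simp add: sum.cartesian_product)
qed

text \<open>Nested truncation suits the error estimate, the sum over a frequency box suits the
  equation. They agree because exponentials in the other variables are constants for sampling in
  \<open>m\<close>.\<close>

lemma iter_trunc_eq: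
  assumes "distinct ms"
  shows "iter_trunc N n ms g \<theta> = (\<Sum>k\<in>Pi\<^sub>E (set ms) (\<lambda>_. {-int n..int n}).
     exp (\<i> * (\<Sum>m\<in>set ms. of_int (k m) * \<theta> $ m)) * iter_coef N ms k g \<theta>)"
  using assms
proof (induction ms arbitrary: \<theta>)
  case (Cons m ms)
  let ?B = "\<lambda>_::'a. {-int n..int n}"
  have IH: "iter_trunc N n ms g = (\<lambda>\<theta>. \<Sum>k\<in>Pi\<^sub>E (set ms) ?B.
     exp (\<i> * (\<Sum>m\<in>set ms. of_int (k m) * \<theta> $ m)) * iter_coef N ms k g \<theta>)"
    using Cons by auto
  have co: "partial_coef N m b (iter_trunc N n ms g) \<theta>
     = (\<Sum>k\<in>Pi\<^sub>E (set ms) ?B. exp (\<i> * (\<Sum>m\<in>set ms. of_int (k m) * \<theta> $ m)) * partial_coef N m b (iter_coef N ms k g) \<theta>)" for b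
  proof -
    have ups: "(\<Sum>i\<in>set ms. of_int (k i) * upd \<theta> m z $ i) = (\<Sum>i\<in>set ms. of_int (k i) * \<theta> $ i)" for k z
      using Cons.prems by (intro sum.cong) auto
    have "partial_coef N m b (iter_trunc N n ms g) \<theta> = partial_coef N m b
        (\<lambda>\<eta>. \<Sum>k\<in>Pi\<^sub>E (set ms) ?B. exp (\<i> * (\<Sum>m\<in>set ms. of_int (k m) * \<theta> $ m)) * iter_coef N ms k g \<eta>) \<theta>"
      unfolding IH partial_coef_eq ups ..
    then show ?thesis by (simp only: partial_coef_sum)
  qed
  have it: "iter_coef N (m # ms) (k(m := b)) g \<theta> = partial_coef N m b (iter_coef N ms k g) \<theta>" for k b
  proof -
    have "iter_coef N ms (k(m := b)) g = iter_coef N ms k g"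
      using Cons.prems by (intro iter_coef_cong) auto
    then show ?thesis by simp
  qed
  have ex: "exp (\<i> * (\<Sum>i\<in>set (m # ms). of_int ((k(m := b)) i) * \<theta> $ i))
     = exp (\<i> * (\<Sum>i\<in>set ms. of_int (k i) * \<theta> $ i)) * exp (\<i> * of_int b * \<theta> $ m)" for k b
  proof -
    have "(\<Sum>i\<in>set ms. of_int ((k(m := b)) i) * \<theta> $ i) = (\<Sum>i\<in>set ms. of_int (k i) * \<theta> $ i)"
      using Cons.prems by (intro sum.cong) auto
    then show ?thesis
      using Cons.prems by (simp add: distrib_left exp_add mult_ac)
  qed
  have "(\<Sum>k\<in>Pi\<^sub>E (set (m # ms)) ?B. exp (\<i> * (\<Sum>m\<in>set (m # ms). of_int (k m) * \<theta> $ m)) * iter_coef N (m # ms) k g \<theta>)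
    = (\<Sum>b\<in>{-int n..int n}. \<Sum>k\<in>Pi\<^sub>E (set ms) ?B.
         exp (\<i> * (\<Sum>i\<in>set ms. of_int (k i) * \<theta> $ i)) * exp (\<i> * of_int b * \<theta> $ m) * partial_coef N m b (iter_coef N ms k g) \<theta>)"
    using Cons.prems by (simp only: list.set sum_PiE_insert distinct.simps simp_thms) (simp only: it ex list.set[symmetric])
  also have "\<dots> = partial_trunc N n m (iter_trunc N n ms g) \<theta>"
    unfolding partial_trunc_def co by (simp add: sum_distrib_left sum_distrib_right mult_ac)
  finally show ?case by simp
qed simp

text \<open>All nodes are real, so the hypothesis on real points suffices and conjugation merely
  reverses the frequency.\<close>

lemma iter_coef_cnj:
  assumes "\<And>\<theta>. (\<And>m. Im (\<theta> $ m) = 0) \<Longrightarrow> cnj (g \<theta>) = h \<theta>" and "\<And>m. Im (\<theta> $ m) = 0"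
  shows "cnj (iter_coef N ms k g \<theta>) = iter_coef N ms (\<lambda>m. - k m) h \<theta>"
  using assms(2)
proof (induction ms arbitrary: \<theta>)
  case (Cons m ms)
  have "cnj (iter_coef N ms k g (upd \<theta> m (Complex x 0))) = iter_coef N ms (\<lambda>m. - k m) h (upd \<theta> m (Complex x 0))" for x
    using Cons.prems by (intro Cons.IH) simp
  moreover have "cnj (Complex x 0) = Complex x 0" for x
    by (simp add: complex_eq_iff)
  ultimately show ?case
    by (simp add: partial_coef_eq exp_cnj)
qed (simp add: assms(1))

subsection \<open>Measure of the resonant parameters\<close>

text \<open>Disjoint translates of \<open>E\<close> in the direction of the slices fit into a slightly larger cube.\<close>

lemma measure_thin_slices:
  fixes E :: "(real^'n) set"
  assumes cE: "compact E" and sub: "\<And>x m. x \<in> E \<Longrightarrow> 0 \<le> x $ m \<and> x $ m \<le> a" and a: "a \<ge> 0"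
    and w: "w > 0" and thin: "\<And>x s. x \<in> E \<Longrightarrow> x + s *\<^sub>R axis m 1 \<in> E \<Longrightarrow> \<bar>s\<bar> \<le> w"
  shows "measure lebesgue E \<le> 4 * w * (a + 1) ^ CARD('n)"
proof -
  have mE: "E \<in> lmeasurable" using cE by (rule lmeasurable_compact)
  have cube: "measure lebesgue (cbox 0 (\<chi> i. c) :: (real^'n) set) = c ^ CARD('n)" if "c \<ge> 0" for c
  proof -
    have "cbox 0 (\<chi> i. c) \<noteq> ({} :: (real^'n) set)"
      using that by (auto simp: interval_eq_empty_cart not_less)
    then show ?thesis by (simp add: content_cbox_cart)
  qed
  show ?thesis
  proof (cases "w < 1/4")
    \<comment> \<open>For large w the cube containing \<open>E\<close> already has the required
      measure.\<close>
    case False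
    have "measure lebesgue E \<le> measure lebesgue (cbox 0 (\<chi> i. a + 1) :: (real^'n) set)"
      using sub by (intro measure_mono_fmeasurable) (auto simp: mem_box_cart fmeasurableD mE add_increasing2)
    also have "\<dots> = 1 * (a + 1) ^ CARD('n)" using a cube[of "a+1"] by simp
    also have "\<dots> \<le> 4 * w * (a + 1) ^ CARD('n)"
      using False a by (intro mult_right_mono) auto
    finally show ?thesis .
  next
    case True
    \<comment> \<open>Translates by multiples of 2 w are disjoint since slices have length at most
      w. The number is chosen such that the total displacement is at most 1, while still N \<ge> 1 /
      (4 w).\<close>
    define N where "N = nat \<lfloor>1 / (2 * w)\<rfloor>"
    have N: "real N \<le> 1 / (2 * w)" "1 / (2 * w) < real N + 1"
      using w by (auto simp: N_def)
    have "1 / (4 * w) \<ge> 1" "1 / (2 * w) = 2 * (1 / (4 * w))"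
      using True w by (auto simp: field_simps)
    then have N4: "1 / (4 * w) \<le> real N" using N by linarith
    define T where "T j = (+) ((real j * 2 * w) *\<^sub>R axis m 1) ` E" for j :: nat
    have disj: "disjoint_family_on T {..<N}"
    proof (clarsimp simp: disjoint_family_on_def)
      fix j j' :: nat assume "j \<noteq> j'"
      show "T j \<inter> T j' = {}"
      proof (rule ccontr)
        assume "T j \<inter> T j' \<noteq> {}"
        then obtain x y where xy: "x \<in> E" "y \<in> E"
          "(real j * 2 * w) *\<^sub>R axis m 1 + x = (real j' * 2 * w) *\<^sub>R axis m 1 + y"
          by (auto simp: T_def)
        then have "y = x + ((real j - real j') * (2 * w)) *\<^sub>R axis m 1"
          by (simp add: algebra_simps)
        then have "\<bar>(real j - real j') * (2 * w)\<bar> \<le> w" using thin xy by metis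
        moreover have "\<bar>real j - real j'\<bar> \<ge> 1" using \<open>j \<noteq> j'\<close> by linarith
        ultimately show False
          using w mult_right_mono[of 1 "\<bar>real j - real j'\<bar>" "2 * w"] by (simp add: abs_mult)
      qed
    qed
    have mT: "T j \<in> lmeasurable" for j
      unfolding T_def using mE by (rule measurable_translation)
    have "real N * measure lebesgue E = (\<Sum>j<N. measure lebesgue (T j))"
      by (simp add: T_def measure_translation)
    also have "\<dots> = measure lebesgue (\<Union>j<N. T j)"
    proof (rule measure_finite_Union[symmetric, OF _ _ disj])
      show "T ` {..<N} \<subseteq> sets lebesgue" using fmeasurableD[OF mT] by blast
      show "emeasure lebesgue (T j) \<noteq> \<infinity>" for j
        using fmeasurableD2[OF mT, of j] unfolding infinity_ennreal_def .
    qed simp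
    also have "\<dots> \<le> measure lebesgue (cbox 0 (\<chi> i. a + 1) :: (real^'n) set)"
    proof (rule measure_mono_fmeasurable)
      show "(\<Union>j<N. T j) \<subseteq> cbox 0 (\<chi> i. a + 1)"
      proof clarsimp
        fix j y assume j: "j < N" and "y \<in> T j"
        then obtain x where x: "x \<in> E" "y = (real j * 2 * w) *\<^sub>R axis m 1 + x" by (auto simp: T_def)
        have "real j * (2 * w) \<le> real N * (2 * w)" using j w by (intro mult_right_mono) auto
        also have "\<dots> \<le> 1" using N w by (simp add: field_simps)
        finally have "real j * (2 * w) \<le> 1" .
        then have t: "0 \<le> real j * (2 * w)" "real j * (2 * w) \<le> 1" using w by auto
        have "0 \<le> y $ i \<and> y $ i \<le> a + 1" for i
        proof -
          have "y $ i = x $ i + (if i = m then real j * (2 * w) else 0)"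
            by (simp add: x(2) axis_def)
          moreover have "0 \<le> (if i = m then real j * (2 * w) else 0)" "(if i = m then real j * (2 * w) else 0) \<le> 1"
            using t by auto
          ultimately show ?thesis using sub[OF x(1), of i] by linarith
        qed
        then show "y \<in> cbox 0 (\<chi> i. a + 1)" by (simp add: mem_box_cart)
      qed
      show "(\<Union>j<N. T j) \<in> sets lebesgue" using mT by (auto simp: fmeasurableD)
    qed auto
    also have "\<dots> = (a + 1) ^ CARD('n)" using a by (intro cube) simp
    finally have "real N * measure lebesgue E \<le> (a + 1) ^ CARD('n)" .
    moreover have "1 / (4 * w) * measure lebesgue E \<le> real N * measure lebesgue E"
      using N4 by (intro mult_right_mono) auto
    ultimately have "1 / (4 * w) * measure lebesgue E \<le> (a + 1) ^ CARD('n)" by linarith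
    then show ?thesis using w by (simp add: divide_le_eq mult_ac)
  qed
qed

section \<open>Small divisors and the set where they occur\<close>

definition dotk :: "('n::finite \<Rightarrow> int) \<Rightarrow> real^'n \<Rightarrow> real" where
  "dotk k x = (\<Sum>m\<in>UNIV. of_int (k m) * x $ m)"

definition l1 :: "real^'n \<Rightarrow> real" where
  "l1 x = (\<Sum>m\<in>UNIV. \<bar>x $ m\<bar>)"

lemma dotk_diff: "dotk k (x - y) = dotk k x - dotk k y"
  by (simp add: dotk_def right_diff_distrib sum_subtractf)

text \<open>In the direction \<open>m\<close> the linear part varies at the rate |k m| \<ge> 1 and
  \<open>g\<close> at most at the rate 1 / 2, so slices have length at most 4 \<eta> / |k m|. The
  closure makes the set compact, hence measurable, for arbitrary \<open>D\<close>.\<close>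

lemma measure_resonance:
  fixes D :: "(real^'n) set"
  assumes D: "\<And>x m. x \<in> D \<Longrightarrow> 0 \<le> x $ m \<and> x $ m \<le> a" and a: "a \<ge> 0"
    and g: "\<And>x y. x \<in> D \<Longrightarrow> y \<in> D \<Longrightarrow> \<bar>g x - g y\<bar> \<le> l1 (x - y) / 2"
    and \<eta>: "\<eta> > 0" and k: "\<bar>k m\<bar> \<ge> 1"
  defines "E \<equiv> closure {x \<in> D. \<bar>dotk k x + g x\<bar> < \<eta>}"
  shows "compact E" and "measure lebesgue E \<le> 16 * (\<eta> / \<bar>of_int (k m)\<bar>) * (a + 1) ^ CARD('n)"
proof -
  define E0 where "E0 = {x \<in> D. \<bar>dotk k x + g x\<bar> < \<eta>}"
  have E: "E = closure E0" by (simp add: E_def E0_def)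
  have box: "E \<subseteq> cbox 0 (\<chi> i. a)"
    unfolding E by (intro closure_minimal) (auto simp: E0_def mem_box_cart D)
  show cE: "compact E"
    unfolding compact_eq_bounded_closed
    using bounded_subset[OF bounded_cbox box] by (simp add: E)
  \<comment> \<open>A closed condition on pairs of points that no longer mentions \<open>g\<close>.
    It therefore passes to the closure of \<open>E0\<close>, where nothing is known about
    \<open>g\<close>.\<close>
  define F where "F = {p :: (real^'n) \<times> (real^'n). \<bar>dotk k (fst p - snd p)\<bar> \<le> 2 * \<eta> + l1 (fst p - snd p) / 2}"
  have "closed F"
    unfolding F_def dotk_def l1_def divide_inverse by (intro closed_Collect_le continuous_intros)
  moreover have "E0 \<times> E0 \<subseteq> F"
  proof clarsimp
    fix x y assume "x \<in> E0" "y \<in> E0"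
    then have "x \<in> D" "y \<in> D" "\<bar>dotk k x + g x\<bar> < \<eta>" "\<bar>dotk k y + g y\<bar> < \<eta>" by (auto simp: E0_def)
    moreover from this have "\<bar>g x - g y\<bar> \<le> l1 (x - y) / 2" by (intro g)
    ultimately have "\<bar>dotk k x - dotk k y\<bar> \<le> 2 * \<eta> + l1 (x - y) / 2" by linarith
    then show "(x, y) \<in> F" unfolding F_def by (simp add: dotk_diff)
  qed
  ultimately have "closure (E0 \<times> E0) \<subseteq> F" by (intro closure_minimal)
  then have EF: "E \<times> E \<subseteq> F" by (simp add: closure_Times E)
  let ?k = "\<bar>real_of_int (k m)\<bar>"
  have k1: "?k \<ge> 1" using k by linarith
  have "measure lebesgue E \<le> 4 * (4 * \<eta> / ?k) * (a + 1) ^ CARD('n)"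
  proof (rule measure_thin_slices[OF cE _ a])
    show "0 \<le> x $ m \<and> x $ m \<le> a" if "x \<in> E" for x m
      using box that by (auto simp: mem_box_cart)
    show "0 < 4 * \<eta> / ?k" using \<eta> k1 by simp
    fix x s assume "x \<in> E" "x + s *\<^sub>R axis m 1 \<in> E"
    then have "(x + s *\<^sub>R axis m 1, x) \<in> F" using EF by auto
    moreover have "dotk k (s *\<^sub>R axis m 1) = of_int (k m) * s"
      by (simp add: dotk_def axis_def if_distrib[of "\<lambda>x. _ * x"] cong: if_cong)
    moreover have "l1 (s *\<^sub>R axis m 1 :: real^'n) = \<bar>s\<bar>"
      by (simp add: l1_def axis_def if_distrib[of abs] if_distrib[of "\<lambda>x. _ * x"] cong: if_cong)
    ultimately have "?k * \<bar>s\<bar> \<le> 2 * \<eta> + \<bar>s\<bar> / 2" by (simp add: F_def abs_mult)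
    moreover have "\<bar>s\<bar> \<le> ?k * \<bar>s\<bar>" using k1 by (simp add: mult_right_mono[of 1 ?k "\<bar>s\<bar>", simplified])
    ultimately have "?k * \<bar>s\<bar> \<le> 4 * \<eta>" by linarith
    moreover have "?k > 0" using k1 by linarith
    ultimately show "\<bar>s\<bar> \<le> 4 * \<eta> / ?k" by (simp only: pos_le_divide_eq mult.commute)
  qed
  then show "measure lebesgue E \<le> 16 * (\<eta> / ?k) * (a + 1) ^ CARD('n)" by simp
qed

definition freq_box :: "nat \<Rightarrow> ('n::finite \<Rightarrow> int) set" where
  "freq_box n = Pi\<^sub>E UNIV (\<lambda>_. {-int n..int n})"

lemma freq_box_iff: "k \<in> freq_box n \<longleftrightarrow> (\<forall>m. \<bar>k m\<bar> \<le> int n)"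
  by (auto simp: freq_box_def PiE_UNIV_domain abs_le_iff Pi_iff minus_le_iff)

lemma finite_freq_box [simp]: "finite (freq_box n)"
  by (simp add: freq_box_def finite_PiE)

lemma card_symmetric_int: "card {-int a..int a} = 2 * a + 1"
  by (simp only: card_atLeastAtMost_int)

lemma card_freq_box: "card (freq_box n :: ('n::finite \<Rightarrow> int) set) = (2 * n + 1) ^ CARD('n)"
  unfolding freq_box_def by (simp only: card_PiE finite_class.finite_UNIV card_symmetric_int prod_constant)

text \<open>\<open>lam\<close> is the deviation of the eigenvalues from the odd numbers, and 2 (i -
  j) is the difference of two odd numbers.\<close>

definition divisor :: "(real^'n \<Rightarrow> nat \<Rightarrow> real) \<Rightarrow> ('n \<Rightarrow> int) \<Rightarrow> real^'n \<Rightarrow> nat \<Rightarrow> nat \<Rightarrow> real" where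
  "divisor lam k \<omega> i j = 2 * (real i - real j) + (lam \<omega> i - lam \<omega> j) + dotk k \<omega>"

text \<open>Neither \<open>P\<close> nor the widths occur here, so this set can be fixed before
  them. All indices are covered except k = 0, i = j, where the divisor is identically zero.\<close>

definition nonresonant ::
  "(real^'n \<Rightarrow> nat \<Rightarrow> real) \<Rightarrow> real \<Rightarrow> nat \<Rightarrow> (real^'n) set \<Rightarrow> (real^'n) set" where
  "nonresonant lam \<kappa> n D = {\<omega> \<in> D. \<forall>k\<in>freq_box n. \<forall>i j. i \<noteq> j \<or> k \<noteq> (\<lambda>_. 0) \<longrightarrow>
      \<kappa> * (1 + \<bar>real i - real j\<bar>) \<le> \<bar>divisor lam k \<omega> i j\<bar>}"

text \<open>The Lipschitz bound makes every divisor continuous on \<open>D\<close>, so each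
  condition cuts out a relatively closed subset, and there are countably many conditions.\<close>

lemma nonresonant_measurable:
  fixes D :: "(real^'n) set"
  assumes D: "D \<in> sets lebesgue"
    and lip: "\<And>x y i. x \<in> D \<Longrightarrow> y \<in> D \<Longrightarrow> \<bar>lam x i - lam y i\<bar> \<le> \<epsilon> * l1 (x - y)"
  shows "nonresonant lam \<kappa> n D \<in> sets lebesgue"
proof -
  have cont: "continuous_on D (\<lambda>x. lam x i)" for i
    unfolding continuous_on_iff
  proof (intro ballI allI impI)
    fix e :: real and x assume x: "x \<in> D" and e: "0 < (e::real)"
    let ?c = "\<bar>\<epsilon>\<bar> * real CARD('n) + 1"
    have c: "?c > 0" by (simp add: add_nonneg_pos)
    have "dist (lam y i) (lam x i) < e" if y: "y \<in> D" "dist y x < e / ?c" for y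
    proof -
      have "l1 (y - x) \<le> (\<Sum>m\<in>(UNIV :: 'n set). norm (y - x))"
        unfolding l1_def by (intro sum_mono component_le_norm_cart)
      then have l: "l1 (y - x) \<le> real CARD('n) * norm (y - x)" by simp
      have "\<bar>lam y i - lam x i\<bar> \<le> \<epsilon> * l1 (y - x)" using lip y x by auto
      also have "\<dots> \<le> \<bar>\<epsilon>\<bar> * (real CARD('n) * norm (y - x))"
        using l by (intro mult_mono) (auto simp: l1_def sum_nonneg)
      also have "\<dots> \<le> ?c * norm (y - x)" by (simp add: algebra_simps)
      also have "\<dots> < e" using y c by (simp add: dist_norm pos_less_divide_eq mult.commute)
      finally show ?thesis by (simp add: dist_real_def)
    qed
    then show "\<exists>d>0. \<forall>x'\<in>D. dist x' x < d \<longrightarrow> dist (lam x' i) (lam x i) < e"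
      using c e by (intro exI[of _ "e / ?c"]) auto
  qed
  have one: "{\<omega>\<in>D. c \<le> \<bar>divisor lam k \<omega> i j\<bar>} \<in> sets lebesgue" for c k i j
  proof -
    have "continuous_on D (\<lambda>\<omega>. \<bar>divisor lam k \<omega> i j\<bar>)"
      unfolding divisor_def dotk_def by (intro continuous_intros cont)
    then have "closedin (top_of_set D) (D \<inter> (\<lambda>\<omega>. \<bar>divisor lam k \<omega> i j\<bar>) -` {c..})"
      by (intro continuous_closedin_preimage) auto
    then obtain T where "closed T" "D \<inter> (\<lambda>\<omega>. \<bar>divisor lam k \<omega> i j\<bar>) -` {c..} = D \<inter> T"
      by (auto simp: closedin_closed)
    moreover have "{\<omega>\<in>D. c \<le> \<bar>divisor lam k \<omega> i j\<bar>} = D \<inter> (\<lambda>\<omega>. \<bar>divisor lam k \<omega> i j\<bar>) -` {c..}"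
      by auto
    ultimately show ?thesis using D by (auto intro!: sets.Int borel_closed lborelD)
  qed
  define X where "X k i j = (if i \<noteq> j \<or> k \<noteq> (\<lambda>_. 0)
     then {\<omega>\<in>D. \<kappa> * (1 + \<bar>real i - real j\<bar>) \<le> \<bar>divisor lam k \<omega> i j\<bar>} else D)" for k i j
  have X: "X k i j \<in> sets lebesgue" for k i j
    unfolding X_def using one D by simp
  have "nonresonant lam \<kappa> n D = (\<Inter>k\<in>freq_box n. \<Inter>i. \<Inter>j. X k i j)"
  proof -
    have "freq_box n \<noteq> ({} :: ('n \<Rightarrow> int) set)"
      by (auto simp: freq_box_iff intro!: exI[of _ "\<lambda>_. 0"] simp flip: ex_in_conv)
    then have D: "x \<in> D" if "\<forall>k\<in>freq_box n. \<forall>i j. x \<in> X k i j" for x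
    proof -
      obtain k :: "'n \<Rightarrow> int" where "k \<in> freq_box n" using \<open>freq_box n \<noteq> {}\<close> by blast
      then have "x \<in> X k 0 0" using that by blast
      then show ?thesis by (auto simp: X_def split: if_splits)
    qed
    show ?thesis
    proof (intro set_eqI iffI)
      fix x assume "x \<in> nonresonant lam \<kappa> n D"
      then show "x \<in> (\<Inter>k\<in>freq_box n. \<Inter>i. \<Inter>j. X k i j)"
        unfolding nonresonant_def X_def by auto
    next
      fix x assume "x \<in> (\<Inter>k\<in>freq_box n. \<Inter>i. \<Inter>j. X k i j)"
      then have x: "x \<in> X k i j" if "k \<in> freq_box n" for k i j using that by blast
      have "\<kappa> * (1 + \<bar>real i - real j\<bar>) \<le> \<bar>divisor lam k x i j\<bar>"
        if "k \<in> freq_box n" "i \<noteq> j \<or> k \<noteq> (\<lambda>_. 0)" for k i j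
        using x[OF that(1), of i j] that(2) unfolding X_def by simp
      with D[of x] x show "x \<in> nonresonant lam \<kappa> n D"
        unfolding nonresonant_def by blast
    qed
  qed
  also have "\<dots> \<in> sets lebesgue"
    by (intro sets.countable_INT'' X countable_finite[OF finite_freq_box]) simp_all
  finally show ?thesis .
qed

lemma dotk_bound:
  fixes k :: "'n::finite \<Rightarrow> int"
  assumes "\<And>m. \<bar>x $ m\<bar> \<le> a" "\<And>m. \<bar>k m\<bar> \<le> b"
  shows "\<bar>dotk k x\<bar> \<le> real CARD('n) * (of_int b * a)"
proof -
  have "\<bar>dotk k x\<bar> \<le> (\<Sum>m\<in>(UNIV::'n set). of_int b * a)"
    unfolding dotk_def
  proof (intro order_trans[OF sum_abs] sum_mono)
    fix m
    have "real_of_int \<bar>k m\<bar> \<le> of_int b" using assms(2)[of m] by (simp only: of_int_le_iff)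
    then show "\<bar>real_of_int (k m) * x $ m\<bar> \<le> of_int b * a"
      unfolding abs_mult using assms(1)[of m] by (intro mult_mono) auto
  qed
  then show ?thesis by simp
qed

text \<open>A small divisor forces k \<cdot> \<omega> to compensate 2 l, which bounds |l| by a
  multiple of the size of k. The factor 7 stands for an upper bound of 2 pi.\<close>

lemma resonance_range:
  fixes a b c l \<kappa> B :: real
  assumes "\<bar>a\<bar> \<le> 1/4" "\<bar>b\<bar> \<le> 1/4" "0 < \<kappa>" "\<kappa> \<le> 1/4" "\<bar>c\<bar> \<le> 7 * B"
    and "\<bar>2 * l + (a - b) + c\<bar> < \<kappa> * (1 + \<bar>l\<bar>)"
  shows "7 * \<bar>l\<bar> \<le> 3 + 28 * B"
proof -
  have "\<kappa> * (1 + \<bar>l\<bar>) \<le> 1/4 * (1 + \<bar>l\<bar>)" using assms by (intro mult_right_mono) auto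
  moreover have "2 * \<bar>l\<bar> \<le> \<bar>2 * l + (a - b) + c\<bar> + \<bar>a\<bar> + \<bar>b\<bar> + \<bar>c\<bar>"
    by (simp add: abs_if)
  ultimately have "2 * \<bar>l\<bar> \<le> 1/4 * (1 + \<bar>l\<bar>) + 1/4 + 1/4 + 7 * B"
    using assms(1,2,5,6) by linarith
  then show ?thesis by argo
qed

text \<open>For given k and l, the indices p = min i j below M are treated singly at a total cost of
  order M \<kappa>, the remaining ones together at the cost of the oscillation of \<open>lam\<close>
  beyond M. With M about \<kappa>^(-2 / (\<alpha> + 2)) the product M \<kappa> has the order
  \<kappa>^(\<alpha> / (\<alpha> + 2)) and M^(-\<alpha>) is no larger. The first factor of the bound
  counts the frequencies and the relevant l, so it grows like n^(N + 1) for N =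
  \<open>CARD('n)\<close>.\<close>

lemma nonresonant_cover:
  fixes D :: "(real^'n) set"
  assumes D: "\<And>x m. x \<in> D \<Longrightarrow> 0 \<le> x $ m \<and> x $ m < 2 * pi"
    and bd: "\<And>x i. x \<in> D \<Longrightarrow> \<bar>lam x i\<bar> \<le> \<epsilon>"
    and lip: "\<And>x y i. x \<in> D \<Longrightarrow> y \<in> D \<Longrightarrow> \<bar>lam x i - lam y i\<bar> \<le> \<epsilon> * l1 (x - y)"
    and dec: "\<And>x i. x \<in> D \<Longrightarrow> real (i + 1) powr \<alpha> * \<bar>lam x (Suc i) - lam x i\<bar> \<le> \<epsilon>"
    and \<epsilon>: "0 < \<epsilon>" "\<epsilon> \<le> 1/4" and \<kappa>: "0 < \<kappa>" "\<kappa> \<le> 1/4" and \<alpha>: "0 < \<alpha>"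
  shows "\<exists>U\<in>lmeasurable. D - nonresonant lam \<kappa> n D \<subseteq> U \<and>
     measure lebesgue U \<le> real ((2 * n + 1) ^ CARD('n) * (16 * CARD('n) * n + 1)) *
        (576 * CARD('n) * (2 * pi + 1) ^ CARD('n)) * \<kappa> powr (\<alpha> / (\<alpha> + 2))"
proof -
  define \<mu> where "\<mu> = \<kappa> powr (\<alpha> / (\<alpha> + 2))"
  define M where "M = nat \<lceil>\<kappa> powr (- 2 / (\<alpha> + 2))\<rceil>"
  let ?N = "CARD('n)"
  have M: "real M \<ge> \<kappa> powr (- 2 / (\<alpha> + 2))" "real M \<le> \<kappa> powr (- 2 / (\<alpha> + 2)) + 1"
  proof -
    have "\<lceil>\<kappa> powr (- 2 / (\<alpha> + 2))\<rceil> \<ge> 0" by (simp add: le_ceiling_iff less_le_trans[OF _ powr_ge_zero])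
    then have "real M = of_int \<lceil>\<kappa> powr (- 2 / (\<alpha> + 2))\<rceil>" by (simp add: M_def)
    then show "real M \<ge> \<kappa> powr (- 2 / (\<alpha> + 2))" "real M \<le> \<kappa> powr (- 2 / (\<alpha> + 2)) + 1"
      by linarith+
  qed
  have \<kappa>\<mu>: "\<kappa> \<le> \<mu>"
    using powr_mono'[of "\<alpha> / (\<alpha> + 2)" 1 \<kappa>] \<kappa> \<alpha> by (simp add: \<mu>_def)
  have \<mu>: "\<mu> > 0" using \<kappa> by (simp add: \<mu>_def)
  \<comment> \<open>The 2 absorbs the rounding of M to an integer, which adds at most \<kappa> \<le>
    \<mu>.\<close>
  have M\<kappa>: "M * \<kappa> \<le> 2 * \<mu>"
  proof -
    have "M * \<kappa> \<le> (\<kappa> powr (- 2 / (\<alpha> + 2)) + 1) * \<kappa>" using M \<kappa> by (intro mult_right_mono) auto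
    also have "\<dots> = \<kappa> powr (- 2 / (\<alpha> + 2)) * \<kappa> powr 1 + \<kappa>" using \<kappa> by (simp add: distrib_right)
    also have "\<kappa> powr (- 2 / (\<alpha> + 2)) * \<kappa> powr 1 = \<mu>"
      unfolding \<mu>_def powr_add[symmetric] using \<alpha> by (simp add: field_simps)
    finally show ?thesis using \<kappa>\<mu> by simp
  qed
  have M\<alpha>: "real (p + 1) powr (- \<alpha>) \<le> \<mu>" if "M \<le> p" for p
  proof -
    have "real (p + 1) powr (- \<alpha>) \<le> (\<kappa> powr (- 2 / (\<alpha> + 2))) powr (- \<alpha>)"
      using M(1) that \<kappa> \<alpha> by (intro powr_mono2') auto
    also have "\<dots> = \<kappa> powr (2 * \<alpha> / (\<alpha> + 2))" by (simp add: powr_powr)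
    also have "\<dots> \<le> \<mu>" unfolding \<mu>_def using \<kappa> \<alpha> by (intro powr_mono') (auto simp: divide_right_mono)
    finally show ?thesis .
  qed
  \<comment> \<open>Beyond M every single increment of \<open>lam\<close> is at most \<epsilon> (p +
    1)^(-\<alpha>) \<le> \<mu>.\<close>
  have tele: "\<bar>lam x (p + a) - lam x p\<bar> \<le> real a * \<mu>" if "x \<in> D" "M \<le> p" for x p a
  proof (induction a)
    case (Suc a)
    have "real (p + a + 1) powr (- \<alpha>) * (real (p + a + 1) powr \<alpha> * \<bar>lam x (Suc (p + a)) - lam x (p + a)\<bar>)
      \<le> \<mu> * \<epsilon>"
      using M\<alpha>[of "p + a"] dec[OF that(1), of "p + a"] that \<mu> by (intro mult_mono) auto
    then have "\<bar>lam x (Suc (p + a)) - lam x (p + a)\<bar> \<le> \<mu> * \<epsilon>"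
      by (simp add: mult.assoc[symmetric] flip: powr_add)
    also have "\<dots> \<le> \<mu>" using \<epsilon> \<mu> by (intro mult_left_le) auto
    finally show ?case using Suc by (simp add: algebra_simps)
  qed simp
  \<comment> \<open>Row and column with difference \<open>l\<close> and minimum \<open>p\<close>;
    \<open>nat\<close> sends negative numbers to 0, so one of the two equals
    \<open>p\<close>.\<close>
  define ii where "ii l p = p + nat l" for l :: int and p
  define jj where "jj l p = p + nat (- l)" for l :: int and p
  define Z where "Z k l = closure {x \<in> D. \<bar>dotk k x + 2 * real_of_int l\<bar> < 2 * \<mu> * (1 + \<bar>real_of_int l\<bar>)}" for k :: "'n \<Rightarrow> int" and l
  define Y where "Y k l p = closure {x \<in> D. \<bar>dotk k x + (2 * (real (ii l p) - real (jj l p)) + (lam x (ii l p) - lam x (jj l p)))\<bar> < \<kappa> * (1 + \<bar>real_of_int l\<bar>)}" for k :: "'n \<Rightarrow> int" and l p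
  \<comment> \<open>The pairs for which a resonance is possible at all. For them (1 + |l|) / |k m|
    is at most 9 \<open>CARD('n)\<close>, so the measure of a resonant set does not grow with
    l.\<close>
  define adm where "adm k l \<longleftrightarrow> (\<exists>m. \<bar>k m\<bar> \<ge> 1 \<and> 1 + \<bar>real_of_int l\<bar> \<le> 9 * ?N * \<bar>real_of_int (k m)\<bar>)" for k :: "'n \<Rightarrow> int" and l :: int
  define W where "W k l = (if adm k l then Z k l \<union> (\<Union>p<M. Y k l p) else {})" for k l
  define I where "I = (freq_box n :: ('n \<Rightarrow> int) set) \<times> {- int (8 * ?N * n)..int (8 * ?N * n)}"
  have cardI: "card I = (2 * n + 1) ^ ?N * (16 * ?N * n + 1)"
    unfolding I_def card_cartesian_product card_freq_box card_symmetric_int by simp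
  have finI: "finite I" by (simp add: I_def)
  have Dle: "0 \<le> x $ m \<and> x $ m \<le> 2 * pi" if "x \<in> D" for x m using D[OF that, of m] by simp
  \<comment> \<open>Up to the factor \<open>CARD('n)\<close> (2 pi + 1)^\<open>CARD('n)\<close>, the
    set Z contributes 16 * 2 * 9 \<mu> = 288 \<mu> and the M sets Y contribute 16 * 9 M \<kappa>
    \<le> 288 \<mu>.\<close>
  have WM: "W k l \<in> lmeasurable \<and> measure lebesgue (W k l) \<le> 576 * ?N * (2 * pi + 1) ^ ?N * \<mu>" for k l
  proof (cases "adm k l")
    case True
    then obtain m where m: "\<bar>k m\<bar> \<ge> 1" "1 + \<bar>real_of_int l\<bar> \<le> 9 * ?N * \<bar>real_of_int (k m)\<bar>" by (auto simp: adm_def)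
    have ratio: "c * (1 + \<bar>real_of_int l\<bar>) / \<bar>real_of_int (k m)\<bar> \<le> c * (9 * ?N)" if "c \<ge> 0" for c
    proof -
      have "(1 + \<bar>real_of_int l\<bar>) / \<bar>real_of_int (k m)\<bar> \<le> 9 * ?N" using m by (simp add: divide_le_eq)
      from mult_left_mono[OF this that] show ?thesis by simp
    qed
    have Z: "compact (Z k l)" "measure lebesgue (Z k l) \<le> 288 * ?N * (2 * pi + 1) ^ ?N * \<mu>"
    proof -
      have l10: "0 \<le> l1 (x - y) / 2" for x y :: "real^'n" by (simp add: l1_def sum_nonneg)
      show "compact (Z k l)"
        unfolding Z_def using \<mu> m l10 by (intro measure_resonance(1)[OF Dle]) auto
      have "measure lebesgue (Z k l) \<le> 16 * (2 * \<mu> * (1 + \<bar>real_of_int l\<bar>) / \<bar>of_int (k m)\<bar>) * (2 * pi + 1) ^ ?N"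
        unfolding Z_def using \<mu> m l10 by (intro measure_resonance(2)[OF Dle]) auto
      also have "\<dots> \<le> 16 * (2 * \<mu> * (9 * ?N)) * (2 * pi + 1) ^ ?N"
        using \<mu> by (intro mult_right_mono mult_left_mono ratio) auto
      finally show "measure lebesgue (Z k l) \<le> 288 * ?N * (2 * pi + 1) ^ ?N * \<mu>" by (simp add: mult_ac)
    qed
    have Y: "compact (Y k l p)" "measure lebesgue (Y k l p) \<le> 144 * ?N * (2 * pi + 1) ^ ?N * \<kappa>" for p
    proof -
      have g: "\<bar>(2 * (real i - real j) + (lam x i - lam x j)) - (2 * (real i - real j) + (lam y i - lam y j))\<bar> \<le> l1 (x - y) / 2"
        if "x \<in> D" "y \<in> D" for x y i j
      proof -
        have "\<epsilon> * l1 (x - y) \<le> 1/4 * l1 (x - y)" using \<epsilon> by (intro mult_right_mono) (auto simp: l1_def sum_nonneg)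
        then show ?thesis using lip[OF that, of i] lip[OF that, of j] by linarith
      qed
      show "compact (Y k l p)"
        unfolding Y_def using \<kappa> m by (intro measure_resonance(1)[OF Dle _ g]) auto
      have "measure lebesgue (Y k l p) \<le> 16 * (\<kappa> * (1 + \<bar>real_of_int l\<bar>) / \<bar>of_int (k m)\<bar>) * (2 * pi + 1) ^ ?N"
        unfolding Y_def using \<kappa> m by (intro measure_resonance(2)[OF Dle _ g]) auto
      also have "\<dots> \<le> 16 * (\<kappa> * (9 * ?N)) * (2 * pi + 1) ^ ?N"
        using \<kappa> by (intro mult_right_mono mult_left_mono ratio) auto
      finally show "measure lebesgue (Y k l p) \<le> 144 * ?N * (2 * pi + 1) ^ ?N * \<kappa>" by (simp add: mult_ac)
    qed
    have mZ: "Z k l \<in> lmeasurable" and mY: "Y k l p \<in> lmeasurable" for p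
      using Z Y by (auto intro: lmeasurable_compact)
    have "measure lebesgue (W k l) \<le> measure lebesgue (Z k l) + measure lebesgue (\<Union>p<M. Y k l p)"
      using True mZ mY by (auto simp: W_def intro!: measure_Un_le fmeasurableD sets.finite_UN)
    also have "measure lebesgue (\<Union>p<M. Y k l p) \<le> (\<Sum>p<M. measure lebesgue (Y k l p))"
      using mY by (intro measure_UNION_le) (auto simp: fmeasurableD)
    also have "\<dots> \<le> (\<Sum>p<M. 144 * ?N * (2 * pi + 1) ^ ?N * \<kappa>)"
      by (intro sum_mono Y)
    also have "\<dots> = 144 * ?N * (2 * pi + 1) ^ ?N * (M * \<kappa>)" by simp
    also have "\<dots> \<le> 144 * ?N * (2 * pi + 1) ^ ?N * (2 * \<mu>)"
      using M\<kappa> by (intro mult_left_mono) auto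
    finally have "measure lebesgue (W k l) \<le> 576 * ?N * (2 * pi + 1) ^ ?N * \<mu>"
      using Z(2) by simp
    moreover have "W k l \<in> lmeasurable"
      using True mZ mY by (auto simp: W_def intro!: fmeasurable.Un fmeasurable.finite_UN)
    ultimately show ?thesis by simp
  next
    case False
    then show ?thesis using \<mu> by (simp add: W_def)
  qed
  define U where "U = (\<Union>(k, l)\<in>I. W k l)"
  have "measure lebesgue U \<le> (\<Sum>(k, l)\<in>I. measure lebesgue (W k l))"
    unfolding U_def using WM finI by (auto intro!: order_trans[OF measure_UNION_le] simp: fmeasurableD case_prod_unfold)
  also have "\<dots> \<le> (\<Sum>(k, l)\<in>I. 576 * ?N * (2 * pi + 1) ^ ?N * \<mu>)"
    using WM by (intro sum_mono) auto
  also have "\<dots> = real (card I) * (576 * ?N * (2 * pi + 1) ^ ?N) * \<mu>" by (simp add: mult_ac)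
  finally have mU: "measure lebesgue U \<le> real (card I) * (576 * ?N * (2 * pi + 1) ^ ?N) * \<mu>" .
  have "U \<in> lmeasurable"
    unfolding U_def using WM finI by (auto intro!: fmeasurable.finite_UN simp: case_prod_unfold)
  moreover have "D - nonresonant lam \<kappa> n D \<subseteq> U"
  proof
    fix x assume "x \<in> D - nonresonant lam \<kappa> n D"
    then obtain k i j where x: "x \<in> D" and k: "k \<in> freq_box n" and ij: "i \<noteq> j \<or> k \<noteq> (\<lambda>_. 0)"
      and small: "\<bar>divisor lam k x i j\<bar> < \<kappa> * (1 + \<bar>real i - real j\<bar>)"
      by (auto simp: nonresonant_def not_le)
    define l where "l = int i - int j"
    define p where "p = min i j"
    have ip: "i = ii l p" "j = jj l p" by (auto simp: ii_def jj_def l_def p_def)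
    have rl: "real i - real j = real_of_int l" by (simp add: l_def)
    \<comment> \<open>The direction in which slices are taken is that of a largest component of k,
      which also controls k \<cdot> \<omega>.\<close>
    have "Max (range (\<lambda>m. \<bar>k m\<bar>)) \<in> range (\<lambda>m. \<bar>k m\<bar>)" by (rule Max_in) auto
    then obtain m where "Max (range (\<lambda>m. \<bar>k m\<bar>)) = \<bar>k m\<bar>" by blast
    then have m: "\<bar>k m'\<bar> \<le> \<bar>k m\<bar>" for m'
      using Max_ge[of "range (\<lambda>m. \<bar>k m\<bar>)" "\<bar>k m'\<bar>"] by auto
    have "\<bar>dotk k x\<bar> \<le> real ?N * (of_int \<bar>k m\<bar> * (2 * pi))"
      using Dle[OF x] m by (intro dotk_bound) auto
    also have "\<dots> = (2 * pi) * (real ?N * real_of_int \<bar>k m\<bar>)" by simp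
    also have "\<dots> \<le> 7 * (real ?N * real_of_int \<bar>k m\<bar>)"
      using pi_less_4 pi_approx by (intro mult_right_mono) auto
    finally have dk: "\<bar>dotk k x\<bar> \<le> 7 * (real ?N * real_of_int \<bar>k m\<bar>)" .
    have range: "7 * \<bar>real_of_int l\<bar> \<le> 3 + 28 * (real ?N * real_of_int \<bar>k m\<bar>)"
      using bd[OF x, of i] bd[OF x, of j] \<epsilon> small
      by (intro resonance_range[of "lam x i" "lam x j" \<kappa> "dotk k x", OF _ _ \<kappa> dk]) (auto simp: divisor_def rl)
    \<comment> \<open>For k = 0 the range estimate gives 7 |l| \<le> 3, hence l = 0, and this pair
      of indices is excluded.\<close>
    have km: "\<bar>k m\<bar> \<ge> 1"
    proof (rule ccontr)
      assume "\<not> ?thesis"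
      then have 0: "\<bar>k m\<bar> = 0" by simp
      then have "k = (\<lambda>_. 0)" using m by (metis abs_le_zero_iff ext)
      then have "l \<noteq> 0" using ij by (simp add: l_def)
      then have "\<bar>real_of_int l\<bar> \<ge> 1" by linarith
      then show False using range 0 by simp
    qed
    define B where "B = ?N * real_of_int \<bar>k m\<bar>"
    have B: "B \<ge> 1"
    proof -
      have "1 * 1 \<le> real ?N * real_of_int \<bar>k m\<bar>" using km by (intro mult_mono) (auto simp: Suc_le_eq)
      then show ?thesis by (simp add: B_def)
    qed
    have l8: "\<bar>real_of_int l\<bar> \<le> 8 * B" using range B by (simp add: B_def)
    have "1 + \<bar>real_of_int l\<bar> \<le> 9 * B" using l8 B by linarith
    then have "adm k l" using km by (auto simp: adm_def B_def mult_ac)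
    have lI: "\<bar>l\<bar> \<le> int (8 * ?N * n)"
    proof -
      have "\<bar>k m\<bar> \<le> int n" using k by (simp add: freq_box_iff)
      then have "real_of_int \<bar>k m\<bar> \<le> real n" by linarith
      then have "B \<le> ?N * real n" unfolding B_def by (intro mult_left_mono) auto
      then have "\<bar>real_of_int l\<bar> \<le> real (8 * ?N * n)" using l8 by simp
      then show ?thesis by linarith
    qed
    have "(k, l) \<in> I" using k lI by (auto simp: I_def)
    moreover have "x \<in> W k l"
    proof (cases "p < M")
      case True
      have "x \<in> Y k l p"
        unfolding Y_def using x small
        by (intro subsetD[OF closure_subset]) (auto simp: ip[symmetric] divisor_def rl add_ac)
      then show ?thesis using True \<open>adm k l\<close> by (auto simp: W_def)
    next
      case False
      have "\<bar>lam x i - lam x j\<bar> \<le> \<bar>real_of_int l\<bar> * \<mu>"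
        using tele[OF x, of p "nat \<bar>l\<bar>"] False
        by (cases "l \<ge> 0") (auto simp: ip ii_def jj_def abs_minus_commute)
      moreover have "\<kappa> * (1 + \<bar>real_of_int l\<bar>) \<le> \<mu> * (1 + \<bar>real_of_int l\<bar>)"
        using \<kappa>\<mu> by (intro mult_right_mono) auto
      moreover have "\<bar>dotk k x + 2 * real_of_int l\<bar> \<le> \<bar>divisor lam k x i j\<bar> + \<bar>lam x i - lam x j\<bar>"
        unfolding divisor_def rl by linarith
      moreover have "0 < \<mu>" by (rule \<mu>)
      ultimately have "\<bar>dotk k x + 2 * real_of_int l\<bar> < 2 * \<mu> * (1 + \<bar>real_of_int l\<bar>)"
        using small unfolding rl by (simp add: algebra_simps)
      then have "x \<in> Z k l"
        unfolding Z_def using x by (intro subsetD[OF closure_subset]) auto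
      then show ?thesis using \<open>adm k l\<close> by (auto simp: W_def)
    qed
    ultimately show "x \<in> U" by (auto simp: U_def)
  qed
  ultimately show ?thesis using mU unfolding cardI \<mu>_def by blast
qed

subsection \<open>Whitney differentiability\<close>

lemma l1_nonneg: "l1 x \<ge> 0"
  by (simp add: l1_def sum_nonneg)

lemma l1_pos_iff: "l1 (x - y) > 0 \<longleftrightarrow> x \<noteq> y"
proof -
  have "l1 (x - y) = 0 \<longleftrightarrow> x = y"
    by (auto simp: l1_def sum_nonneg_eq_0_iff vec_eq_iff)
  then show ?thesis using l1_nonneg[of "x - y"] by linarith
qed

lemma l1_le_norm: "l1 (x :: real^'n) \<le> real CARD('n) * norm x"
proof -
  have "l1 x \<le> (\<Sum>m\<in>(UNIV :: 'n set). norm x)"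
    unfolding l1_def by (intro sum_mono component_le_norm_cart)
  then show ?thesis by simp
qed

lemma whitney_C1_deriv:
  assumes "whitney_C1 nrm D F dF" "a \<in> D" "e > 0"
  shows "\<exists>d>0. \<forall>x\<in>D \<inter> ball a d. nrm (\<lambda>i j. dF m x i j - dF m a i j) \<le> ennreal e"
  using assms by (simp add: whitney_C1_def)

lemma whitney_C1_remainder:
  assumes "whitney_C1 nrm D F dF" "a \<in> D" "e > 0"
  shows "\<exists>d>0. \<forall>x\<in>D \<inter> ball a d. \<forall>y\<in>D \<inter> ball a d.
        nrm (\<lambda>i j. F x i j - F y i j - (\<Sum>m\<in>UNIV. of_real (x $ m - y $ m) * dF m y i j)) \<le> ennreal (e * norm (x - y))"
  using assms by (simp add: whitney_C1_def)

lemma whitney_C1_finite: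
  assumes "whitney_C1 nrm D F dF" "a \<in> D"
  shows "nrm (F a) < \<infinity>" "nrm (dF m a) < \<infinity>"
  using assms by (simp_all add: whitney_C1_def)

context mat_seminorm
begin

lemma nrm_zero: "nrm (\<lambda>i j. 0) = 0"
  using hom[of 0 "\<lambda>i j. 0"] by simp

lemma add_le:
  assumes "nrm A \<le> ennreal a" "nrm B \<le> ennreal b" "a \<ge> 0" "b \<ge> 0"
  shows "nrm (\<lambda>i j. A i j + B i j) \<le> ennreal (a + b)"
  using tri[of A B] add_mono[OF assms(1,2)] assms(3,4) by simp

lemma cmult_le:
  assumes "nrm A \<le> ennreal a" "a \<ge> 0"
  shows "nrm (\<lambda>i j. c * A i j) \<le> ennreal (cmod c * a)"
  using order_trans[OF hom[of c A] mult_left_mono[OF assms(1), of "ennreal (cmod c)"]] assms(2)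
  by (simp add: ennreal_mult)

lemma diff_le:
  assumes "nrm A \<le> ennreal a" "nrm B \<le> ennreal b" "a \<ge> 0" "b \<ge> 0"
  shows "nrm (\<lambda>i j. A i j - B i j) \<le> ennreal (a + b)"
  using add_le[OF assms(1) cmult_le[OF assms(2,4), of "- 1"] assms(3)] assms(4) by simp

lemma sum_le:
  assumes "finite I" "\<And>a. a \<in> I \<Longrightarrow> nrm (F a) \<le> ennreal (b a)" "\<And>a. a \<in> I \<Longrightarrow> b a \<ge> 0"
  shows "nrm (\<lambda>i j. \<Sum>a\<in>I. c a * F a i j) \<le> ennreal (\<Sum>a\<in>I. cmod (c a) * b a)"
  using assms
proof (induction I rule: finite_induct)
  case (insert a I)
  have "nrm (\<lambda>i j. c a * F a i j + (\<Sum>a\<in>I. c a * F a i j)) \<le> ennreal (cmod (c a) * b a + (\<Sum>a\<in>I. cmod (c a) * b a))"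
    using insert by (intro add_le cmult_le insert.IH sum_nonneg mult_nonneg_nonneg) auto
  then show ?case using insert.hyps by simp
qed (simp add: nrm_zero)

lemma finite_nrm:
  assumes "nrm A < \<infinity>"
  shows "\<exists>a\<ge>0. nrm A \<le> ennreal a"
  using assms by (cases "nrm A") auto

text \<open>With the quotient multiplied out, the pairs x = y need no exclusion and the difference
  part becomes a Lipschitz bound in the distance \<open>l1\<close>. All norm estimates go through
  this form.\<close>

lemma whitney_norm_le_iff:
  fixes D :: "(real^'n) set"
  assumes M: "M \<ge> 0"
  shows "whitney_norm nrm D F dF \<le> ennreal M \<longleftrightarrow>
     (\<forall>x\<in>D. nrm (F x) \<le> ennreal M) \<and> (\<forall>x\<in>D. \<forall>m. nrm (dF m x) \<le> ennreal M) \<and>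
     (\<forall>x\<in>D. \<forall>y\<in>D. nrm (\<lambda>i j. F x i j - F y i j) \<le> ennreal (M * l1 (x - y)))"
proof -
  have q: "nrm (\<lambda>i j. F x i j - F y i j) / ennreal (\<Sum>m\<in>UNIV. \<bar>x $ m - y $ m\<bar>) \<le> ennreal M \<longleftrightarrow>
      nrm (\<lambda>i j. F x i j - F y i j) \<le> ennreal (M * l1 (x - y))" if "x \<noteq> y" for x y
  proof -
    have l: "(\<Sum>m\<in>UNIV. \<bar>x $ m - y $ m\<bar>) = l1 (x - y)" by (simp add: l1_def)
    have l0: "l1 (x - y) > 0" using that by (simp add: l1_pos_iff)
    show ?thesis
    proof (cases "nrm (\<lambda>i j. F x i j - F y i j)")
      case (real r)
      then show ?thesis using l0 M by (simp add: l divide_ennreal ennreal_le_iff pos_divide_le_eq)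
    next
      case top
      then show ?thesis using l0 by (simp add: l ennreal_top_divide top_unique)
    qed
  qed
  have z: "nrm (\<lambda>i j. F x i j - F x i j) \<le> ennreal (M * l1 (x - x))" for x
    by (simp add: nrm_zero)
  have "(SUP x\<in>D. SUP y\<in>D - {x}.
      nrm (\<lambda>i j. F x i j - F y i j) / ennreal (\<Sum>m\<in>UNIV. \<bar>x $ m - y $ m\<bar>)) \<le> ennreal M \<longleftrightarrow>
      (\<forall>x\<in>D. \<forall>y\<in>D. nrm (\<lambda>i j. F x i j - F y i j) \<le> ennreal (M * l1 (x - y)))"
    unfolding SUP_le_iff
  proof (intro iffI ballI)
    fix x y
    assume *: "\<forall>x\<in>D. \<forall>y\<in>D - {x}. nrm (\<lambda>i j. F x i j - F y i j) / ennreal (\<Sum>m\<in>UNIV. \<bar>x $ m - y $ m\<bar>) \<le> ennreal M"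
      and xy: "x \<in> D" "y \<in> D"
    show "nrm (\<lambda>i j. F x i j - F y i j) \<le> ennreal (M * l1 (x - y))"
    proof (cases "x = y")
      case True
      then show ?thesis using z by simp
    next
      case False
      then have "y \<in> D - {x}" using xy by blast
      with * xy(1) show ?thesis unfolding q[OF False, symmetric] by blast
    qed
  next
    fix x y
    assume *: "\<forall>x\<in>D. \<forall>y\<in>D. nrm (\<lambda>i j. F x i j - F y i j) \<le> ennreal (M * l1 (x - y))"
      and xy: "x \<in> D" "y \<in> D - {x}"
    then have "x \<noteq> y" by blast
    show "nrm (\<lambda>i j. F x i j - F y i j) / ennreal (\<Sum>m\<in>UNIV. \<bar>x $ m - y $ m\<bar>) \<le> ennreal M"
      unfolding q[OF \<open>x \<noteq> y\<close>] using * xy by blast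
  qed
  then show ?thesis
    unfolding whitney_norm_def by (simp add: SUP_le_iff)
qed

lemma whitney_C1_zero: "whitney_C1 nrm D (\<lambda>x i j. 0) (\<lambda>m x i j. 0)"
  by (auto simp: whitney_C1_def nrm_zero intro!: exI[of _ 1])

lemma whitney_C1_add_cmult:
  fixes D :: "(real^'n) set"
  assumes F: "whitney_C1 nrm D F dF" and G: "whitney_C1 nrm D G dG"
  shows "whitney_C1 nrm D (\<lambda>x i j. c * F x i j + G x i j) (\<lambda>m x i j. c * dF m x i j + dG m x i j)"
proof -
  have fin: "nrm (\<lambda>i j. c * A i j + B i j) < \<infinity>" if AB: "nrm A < \<infinity>" "nrm B < \<infinity>" for A B
  proof -
    obtain a where "a \<ge> 0" "nrm A \<le> ennreal a" using finite_nrm[OF AB(1)] by auto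
    moreover obtain b where "b \<ge> 0" "nrm B \<le> ennreal b" using finite_nrm[OF AB(2)] by auto
    ultimately have "nrm (\<lambda>i j. c * A i j + B i j) \<le> ennreal (cmod c * a + b)"
      by (intro add_le cmult_le) auto
    then show ?thesis by (simp add: order_le_less_trans)
  qed
  \<comment> \<open>The summand 1 in the denominator avoids a separate case for c = 0.\<close>
  define e' where "e' e = e / 2 / (cmod c + 1)" for e :: real
  have c1: "cmod c + 1 > 0" by (simp add: add_nonneg_pos)
  have e': "e' e > 0" "cmod c * (e' e * t) + e / 2 * t \<le> e * t" if "e > 0" "t \<ge> 0" for e t
  proof -
    show "e' e > 0" using that c1 by (simp add: e'_def)
    have "cmod c * e' e \<le> (cmod c + 1) * e' e" using \<open>e' e > 0\<close> by (intro mult_right_mono) auto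
    also have "\<dots> = e / 2"
    proof -
      have "t * (x / t) = x" if "t \<noteq> 0" for t x :: real using that by simp
      then show ?thesis unfolding e'_def using c1 by (metis less_irrefl)
    qed
    finally have "(cmod c * e' e) * t \<le> (e / 2) * t" using that by (intro mult_right_mono) auto
    then show "cmod c * (e' e * t) + e / 2 * t \<le> e * t" by (simp add: mult.assoc)
  qed
  have step: "nrm (\<lambda>i j. c * A i j + B i j) \<le> ennreal (e * t)"
    if "nrm A \<le> ennreal (e' e * t)" "nrm B \<le> ennreal (e / 2 * t)" "e > 0" "t \<ge> 0" for A B e t
  proof -
    have "nrm (\<lambda>i j. c * A i j + B i j) \<le> ennreal (cmod c * (e' e * t) + e / 2 * t)"
      using that e'[of e 1] by (intro add_le cmult_le) auto
    also have "\<dots> \<le> ennreal (e * t)" using e'(2)[OF that(3,4)] by (intro ennreal_leI)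
    finally show ?thesis .
  qed
  show ?thesis
    unfolding whitney_C1_def
  proof (intro conjI ballI allI impI)
    fix a assume a: "a \<in> D"
    show "nrm (\<lambda>i j. c * F a i j + G a i j) < \<infinity>" using whitney_C1_finite(1)[OF F a] whitney_C1_finite(1)[OF G a] by (rule fin)
    show "nrm (\<lambda>i j. c * dF m a i j + dG m a i j) < \<infinity>" for m using whitney_C1_finite(2)[OF F a] whitney_C1_finite(2)[OF G a] by (rule fin)
    fix e :: real assume e: "e > 0"
    show "\<exists>d>0. \<forall>x\<in>D \<inter> ball a d. nrm (\<lambda>i j. c * dF m x i j + dG m x i j - (c * dF m a i j + dG m a i j)) \<le> ennreal e" for m
    proof -
      obtain d1 where d1: "d1 > 0" "\<And>x. x \<in> D \<inter> ball a d1 \<Longrightarrow> nrm (\<lambda>i j. dF m x i j - dF m a i j) \<le> ennreal (e' e)"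
        using whitney_C1_deriv[OF F a e'(1)[OF e zero_le_one]] by blast
      obtain d2 where d2: "d2 > 0" "\<And>x. x \<in> D \<inter> ball a d2 \<Longrightarrow> nrm (\<lambda>i j. dG m x i j - dG m a i j) \<le> ennreal (e / 2)"
        using whitney_C1_deriv[OF G a half_gt_zero[OF e]] by blast
      show ?thesis
      proof (intro exI[of _ "min d1 d2"] conjI ballI)
        fix x assume x: "x \<in> D \<inter> ball a (min d1 d2)"
        have "(\<lambda>i j. c * dF m x i j + dG m x i j - (c * dF m a i j + dG m a i j))
          = (\<lambda>i j. c * (dF m x i j - dF m a i j) + (dG m x i j - dG m a i j))"
          by (simp add: fun_eq_iff algebra_simps)
        then show "nrm (\<lambda>i j. c * dF m x i j + dG m x i j - (c * dF m a i j + dG m a i j)) \<le> ennreal e"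
          using step[of "\<lambda>i j. dF m x i j - dF m a i j" e 1 "\<lambda>i j. dG m x i j - dG m a i j"] d1(2)[of x] d2(2)[of x] x e
          by simp
      qed (use d1 d2 in auto)
    qed
    show "\<exists>d>0. \<forall>x\<in>D \<inter> ball a d. \<forall>y\<in>D \<inter> ball a d.
        nrm (\<lambda>i j. c * F x i j + G x i j - (c * F y i j + G y i j)
           - (\<Sum>m\<in>UNIV. complex_of_real (x $ m - y $ m) * (c * dF m y i j + dG m y i j)))
          \<le> ennreal (e * norm (x - y))"
    proof -
      obtain d1 where d1: "d1 > 0" "\<And>x y. x \<in> D \<inter> ball a d1 \<Longrightarrow> y \<in> D \<inter> ball a d1 \<Longrightarrow>
        nrm (\<lambda>i j. F x i j - F y i j - (\<Sum>m\<in>UNIV. complex_of_real (x $ m - y $ m) * dF m y i j)) \<le> ennreal (e' e * norm (x - y))"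
        using whitney_C1_remainder[OF F a e'(1)[OF e zero_le_one]] by blast
      obtain d2 where d2: "d2 > 0" "\<And>x y. x \<in> D \<inter> ball a d2 \<Longrightarrow> y \<in> D \<inter> ball a d2 \<Longrightarrow>
        nrm (\<lambda>i j. G x i j - G y i j - (\<Sum>m\<in>UNIV. complex_of_real (x $ m - y $ m) * dG m y i j)) \<le> ennreal (e / 2 * norm (x - y))"
        using whitney_C1_remainder[OF G a half_gt_zero[OF e]] by blast
      show ?thesis
      proof (intro exI[of _ "min d1 d2"] conjI ballI)
        fix x y assume xy: "x \<in> D \<inter> ball a (min d1 d2)" "y \<in> D \<inter> ball a (min d1 d2)"
        have "(\<lambda>i j. c * F x i j + G x i j - (c * F y i j + G y i j)
           - (\<Sum>m\<in>UNIV. complex_of_real (x $ m - y $ m) * (c * dF m y i j + dG m y i j)))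
          = (\<lambda>i j. c * (F x i j - F y i j - (\<Sum>m\<in>UNIV. complex_of_real (x $ m - y $ m) * dF m y i j))
            + (G x i j - G y i j - (\<Sum>m\<in>UNIV. complex_of_real (x $ m - y $ m) * dG m y i j)))"
          by (intro ext) (simp add: distrib_left sum.distrib sum_distrib_left right_diff_distrib mult.left_commute)
        moreover have "nrm (\<lambda>i j. c * (F x i j - F y i j - (\<Sum>m\<in>UNIV. complex_of_real (x $ m - y $ m) * dF m y i j))
            + (G x i j - G y i j - (\<Sum>m\<in>UNIV. complex_of_real (x $ m - y $ m) * dG m y i j))) \<le> ennreal (e * norm (x - y))"
          using xy e by (intro step d1(2) d2(2)) auto
        ultimately show "nrm (\<lambda>i j. c * F x i j + G x i j - (c * F y i j + G y i j)
           - (\<Sum>m\<in>UNIV. complex_of_real (x $ m - y $ m) * (c * dF m y i j + dG m y i j))) \<le> ennreal (e * norm (x - y))"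
          by simp
      qed (use d1 d2 in auto)
    qed
  qed
qed

lemma whitney_C1_sum:
  assumes "finite I" "\<And>a. a \<in> I \<Longrightarrow> whitney_C1 nrm D (F a) (dF a)"
  shows "whitney_C1 nrm D (\<lambda>x i j. \<Sum>a\<in>I. c a * F a x i j) (\<lambda>m x i j. \<Sum>a\<in>I. c a * dF a m x i j)"
  using assms
proof (induction I rule: finite_induct)
  case (insert a I)
  then show ?case
    using whitney_C1_add_cmult[of D "F a" "dF a" "\<lambda>x i j. \<Sum>a\<in>I. c a * F a x i j" "\<lambda>m x i j. \<Sum>a\<in>I. c a * dF a m x i j" "c a"]
    by simp
qed (simp add: whitney_C1_zero)

end

lemma whitney_C1_subset:
  assumes F: "whitney_C1 nrm D F dF" and sub: "D' \<subseteq> D"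
  shows "whitney_C1 nrm D' F dF"
  unfolding whitney_C1_def
proof (intro conjI ballI allI impI)
  fix a assume "a \<in> D'"
  then have a: "a \<in> D" using sub by blast
  show "nrm (F a) < \<infinity>" "nrm (dF m a) < \<infinity>" for m using whitney_C1_finite[OF F a] by auto
  fix e :: real assume e: "e > 0"
  show "\<exists>d>0. \<forall>x\<in>D' \<inter> ball a d. nrm (\<lambda>i j. dF m x i j - dF m a i j) \<le> ennreal e" for m
  proof -
    obtain d where "d > 0" and d: "\<forall>x\<in>D \<inter> ball a d. nrm (\<lambda>i j. dF m x i j - dF m a i j) \<le> ennreal e"
      using whitney_C1_deriv[OF F a e, of m] by (elim exE conjE)
    have "D' \<inter> ball a d \<subseteq> D \<inter> ball a d" using sub by blast
    then show ?thesis using \<open>d > 0\<close> d by (intro exI[of _ d] conjI ballI) (assumption, blast)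
  qed
  show "\<exists>d>0. \<forall>x\<in>D' \<inter> ball a d. \<forall>y\<in>D' \<inter> ball a d.
        nrm (\<lambda>i j. F x i j - F y i j - (\<Sum>m\<in>UNIV. of_real (x $ m - y $ m) * dF m y i j)) \<le> ennreal (e * norm (x - y))"
  proof -
    obtain d where "d > 0" and d: "\<forall>x\<in>D \<inter> ball a d. \<forall>y\<in>D \<inter> ball a d.
        nrm (\<lambda>i j. F x i j - F y i j - (\<Sum>m\<in>UNIV. of_real (x $ m - y $ m) * dF m y i j)) \<le> ennreal (e * norm (x - y))"
      using whitney_C1_remainder[OF F a e] by (elim exE conjE)
    have "D' \<inter> ball a d \<subseteq> D \<inter> ball a d" using sub by blast
    then show ?thesis using \<open>d > 0\<close> d by (intro exI[of _ d] conjI ballI) (assumption, blast)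
  qed
qed

text \<open>Here \<open>w\<close> is the reciprocal of the divisor \<open>d\<close>: differences and derivatives of \<open>B = p / d\<close> are
  controlled by applying \<open>w\<close> once more, since \<open>w x - w y = - w x (d x - d y) w y\<close>.\<close>

lemma whitney_quotient:
  fixes D :: "(real^'n) set" and w d :: "real^'n \<Rightarrow> imat" and dd :: "'n \<Rightarrow> real^'n \<Rightarrow> imat"
  assumes n1: "mat_seminorm n1" and n2: "mat_seminorm n2" and n12: "\<And>A. n1 A \<le> n2 A"
    and pos: "\<tau> \<ge> 0" "L \<ge> 0" "H \<ge> 0"
    and w: "\<And>x Q h. x \<in> D \<Longrightarrow> h \<ge> 0 \<Longrightarrow> n1 Q \<le> ennreal h \<Longrightarrow> n2 (\<lambda>i j. w x i j * Q i j) \<le> ennreal (\<tau> * h)"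
    and d: "\<And>x y Q h. x \<in> D \<Longrightarrow> y \<in> D \<Longrightarrow> h \<ge> 0 \<Longrightarrow> n1 Q \<le> ennreal h \<Longrightarrow>
        n1 (\<lambda>i j. (d x i j - d y i j) * Q i j) \<le> ennreal (L * l1 (x - y) * h)"
    and dd: "\<And>x m Q h. x \<in> D \<Longrightarrow> h \<ge> 0 \<Longrightarrow> n1 Q \<le> ennreal h \<Longrightarrow> n1 (\<lambda>i j. dd m x i j * Q i j) \<le> ennreal (L * h)"
    and dd_cont: "\<And>a m e. a \<in> D \<Longrightarrow> e > 0 \<Longrightarrow> \<exists>\<delta>>0. \<forall>x\<in>D \<inter> ball a \<delta>. \<forall>Q h. h \<ge> 0 \<longrightarrow> n1 Q \<le> ennreal h \<longrightarrow>
        n1 (\<lambda>i j. (dd m x i j - dd m a i j) * Q i j) \<le> ennreal (e * h)"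
    and d_rem: "\<And>a e. a \<in> D \<Longrightarrow> e > 0 \<Longrightarrow> \<exists>\<delta>>0. \<forall>x\<in>D \<inter> ball a \<delta>. \<forall>y\<in>D \<inter> ball a \<delta>. \<forall>Q h. h \<ge> 0 \<longrightarrow> n1 Q \<le> ennreal h \<longrightarrow>
        n1 (\<lambda>i j. (d x i j - d y i j - (\<Sum>m\<in>UNIV. complex_of_real (x $ m - y $ m) * dd m y i j)) * Q i j)
          \<le> ennreal (e * norm (x - y) * h)"
    and inv: "\<And>x y i j. x \<in> D \<Longrightarrow> y \<in> D \<Longrightarrow> w x i j - w y i j = - (w x i j * (d x i j - d y i j) * w y i j)"
    and p: "whitney_C1 n1 D p dp" and pn: "whitney_norm n1 D p dp \<le> ennreal H"
  defines "B \<equiv> \<lambda>x i j. w x i j * p x i j"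
  defines "dB \<equiv> \<lambda>m x i j. w x i j * (dp m x i j - dd m x i j * B x i j)"
  shows "whitney_C1 n2 D B dB" and "whitney_norm n2 D B dB \<le> ennreal (\<tau> * (1 + L * \<tau>) * H)"
proof -
  interpret n1: mat_seminorm n1 by (rule n1)
  interpret n2: mat_seminorm n2 by (rule n2)
  \<comment> \<open>Differentiating p = d B gives d dB = dp - dd B. Here \<open>q\<close> is the
    right-hand side, so that dB = w q, and H' is its bound.\<close>
  define q where "q m x = (\<lambda>i j. dp m x i j - dd m x i j * B x i j)" for m x
  define H' where "H' = (1 + L * \<tau>) * H"
  have H': "H' \<ge> 0" "H' = H + L * (\<tau> * H)" using pos by (simp_all add: H'_def algebra_simps)
  have \<tau>H: "\<tau> * H \<ge> 0" using pos by simp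
  have pb: "n1 (p x) \<le> ennreal H" "n1 (dp m x) \<le> ennreal H"
    "y \<in> D \<Longrightarrow> n1 (\<lambda>i j. p x i j - p y i j) \<le> ennreal (H * l1 (x - y))" if "x \<in> D" for x y m
    using pn that unfolding n1.whitney_norm_le_iff[OF pos(3)] by simp_all
  have B2: "n2 (B x) \<le> ennreal (\<tau> * H)" if "x \<in> D" for x
    unfolding B_def using that pos pb by (intro w) auto
  have B1: "n1 (B x) \<le> ennreal (\<tau> * H)" if "x \<in> D" for x
    using n12 B2[OF that] order_trans by blast
  have q1: "n1 (q m x) \<le> ennreal H'" if "x \<in> D" for x m
    unfolding q_def H'(2) using that pos by (intro n1.diff_le pb dd B1) auto
  have dB2: "n2 (dB m x) \<le> ennreal (\<tau> * H')" if "x \<in> D" for x m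
    using w[OF that H'(1) q1[OF that]] by (simp add: dB_def q_def)
  \<comment> \<open>By \<open>inv\<close> the factor \<open>w y\<close> is absorbed into
    \<open>B y\<close>, so a single explicit multiplication by \<open>w x\<close> remains and the
    gain from n1 to n2 applies to the whole difference.\<close>
  have Bdiff: "B x i j - B y i j = w x i j * (p x i j - p y i j - (d x i j - d y i j) * B y i j)"
    if "x \<in> D" "y \<in> D" for x y i j
  proof -
    have "B x i j - B y i j = w x i j * (p x i j - p y i j) + (w x i j - w y i j) * p y i j"
      by (simp add: B_def algebra_simps)
    then show ?thesis unfolding inv[OF that] by (simp add: B_def algebra_simps)
  qed
  have BB: "n2 (\<lambda>i j. B x i j - B y i j) \<le> ennreal (\<tau> * H' * l1 (x - y))" if "x \<in> D" "y \<in> D" for x y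
  proof -
    have "n1 (\<lambda>i j. p x i j - p y i j - (d x i j - d y i j) * B y i j) \<le> ennreal (H * l1 (x - y) + L * l1 (x - y) * (\<tau> * H))"
      using that pos \<tau>H l1_nonneg[of "x - y"] by (intro n1.diff_le pb d B1) auto
    also have "H * l1 (x - y) + L * l1 (x - y) * (\<tau> * H) = H' * l1 (x - y)"
      unfolding H'(2) by (simp add: algebra_simps)
    finally have "n2 (\<lambda>i j. w x i j * (p x i j - p y i j - (d x i j - d y i j) * B y i j)) \<le> ennreal (\<tau> * (H' * l1 (x - y)))"
      using that H' l1_nonneg[of "x - y"] by (intro w) auto
    then show ?thesis by (simp add: Bdiff[OF that] mult.assoc)
  qed
  show "whitney_norm n2 D B dB \<le> ennreal (\<tau> * (1 + L * \<tau>) * H)"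
  proof (subst n2.whitney_norm_le_iff; (intro conjI ballI allI)?)
    have le: "\<tau> * H \<le> \<tau> * H'" using pos H' by (intro mult_left_mono) auto
    have eq: "\<tau> * (1 + L * \<tau>) * H = \<tau> * H'" by (simp add: H'_def)
    show "0 \<le> \<tau> * (1 + L * \<tau>) * H" using pos by simp
    show "n2 (B x) \<le> ennreal (\<tau> * (1 + L * \<tau>) * H)" if "x \<in> D" for x
      unfolding eq using B2[OF that] le by (meson ennreal_leI order_trans)
    show "n2 (dB m x) \<le> ennreal (\<tau> * (1 + L * \<tau>) * H)" if "x \<in> D" for x m
      unfolding eq by (rule dB2[OF that])
    show "n2 (\<lambda>i j. B x i j - B y i j) \<le> ennreal (\<tau> * (1 + L * \<tau>) * H * l1 (x - y))" if "x \<in> D" "y \<in> D" for x y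
      unfolding eq by (rule BB[OF that])
  qed
  let ?n = "real CARD('n)"
  show "whitney_C1 n2 D B dB"
    unfolding whitney_C1_def
  proof (intro conjI ballI allI impI)
    fix a assume a: "a \<in> D"
    show "n2 (B a) < \<infinity>" by (rule order_le_less_trans[OF B2[OF a]]) simp
    show "n2 (dB m a) < \<infinity>" for m by (rule order_le_less_trans[OF dB2[OF a]]) simp
    fix e :: real assume e: "e > 0"
    \<comment> \<open>\<open>e1\<close> is the tolerance for \<open>p\<close> and \<open>d\<close>,
      \<open>\<delta>0\<close> the distance that controls the terms quadratic in the increment, and
      each takes half of \<open>e\<close>. The summands 1 prevent division by zero; \<open>c\<close>
      is large enough for both the continuity of \<open>dB\<close> and the Taylor remainder.\<close>
    define e1 where "e1 = e / (2 * (\<tau> + 1) * (1 + \<tau> * H))"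
    define c where "c = 2 * L * (\<tau> * H') * ?n * (1 + ?n)"
    define \<delta>0 where "\<delta>0 = e / (2 * (\<tau> + 1) * (c + 1))"
    have c0: "c \<ge> 0" using pos H' by (simp add: c_def)
    have e1: "e1 > 0" using e pos \<tau>H by (simp add: e1_def add_pos_nonneg add_nonneg_pos)
    have \<delta>0: "\<delta>0 > 0" using e pos c0 by (simp add: \<delta>0_def add_nonneg_pos)
    have "\<tau> * (e1 * (1 + \<tau> * H) + c * \<delta>0) \<le> (\<tau> + 1) * (e1 * (1 + \<tau> * H) + (c + 1) * \<delta>0)"
      using pos e1 \<delta>0 \<tau>H c0 by (intro mult_mono add_mono) auto
    also have "\<dots> = (\<tau> + 1) * (e / (2 * (\<tau> + 1)) + e / (2 * (\<tau> + 1)))"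
      using \<tau>H c0 by (simp add: e1_def \<delta>0_def)
    also have "\<dots> = e"
    proof -
      have "t * (x / (2 * t) + x / (2 * t)) = x" if "t > 0" for t x :: real
        using that by (simp add: field_simps)
      then show ?thesis using pos by (metis add_nonneg_pos zero_less_one)
    qed
    finally have small: "\<tau> * (e1 * (1 + \<tau> * H) + c * \<delta>0) \<le> e" .
    show "\<exists>\<delta>>0. \<forall>x\<in>D \<inter> ball a \<delta>. n2 (\<lambda>i j. dB m x i j - dB m a i j) \<le> ennreal e" for m
    proof -
      obtain \<delta>1 where \<delta>1: "\<delta>1 > 0" "\<And>x. x \<in> D \<inter> ball a \<delta>1 \<Longrightarrow> n1 (\<lambda>i j. dp m x i j - dp m a i j) \<le> ennreal e1"
        using whitney_C1_deriv[OF p a e1] by blast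
      obtain \<delta>2 where \<delta>2: "\<delta>2 > 0" and \<delta>2': "\<forall>x\<in>D \<inter> ball a \<delta>2. \<forall>Q h. h \<ge> 0 \<longrightarrow> n1 Q \<le> ennreal h \<longrightarrow>
        n1 (\<lambda>i j. (dd m x i j - dd m a i j) * Q i j) \<le> ennreal (e1 * h)"
        using dd_cont[OF a e1, of m] by (elim exE conjE)
      show ?thesis
      proof (intro exI[of _ "min \<delta>0 (min \<delta>1 \<delta>2)"] conjI ballI)
        fix x assume x: "x \<in> D \<inter> ball a (min \<delta>0 (min \<delta>1 \<delta>2))"
        then have xD: "x \<in> D" and xa: "norm (x - a) < \<delta>0" by (auto simp: dist_norm norm_minus_commute)
        define l where "l = l1 (x - a)"
        have l: "l \<ge> 0" "l \<le> ?n * \<delta>0"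
        proof -
          show "l \<ge> 0" by (simp add: l_def l1_nonneg)
          have "?n * norm (x - a) \<le> ?n * \<delta>0" using xa by (intro mult_left_mono) auto
          then show "l \<le> ?n * \<delta>0" using l1_le_norm[of "x - a"] unfolding l_def by linarith
        qed
        \<comment> \<open>This is q x - q a - (d x - d a) dB a written out; multiplied by
          \<open>w x\<close> it equals dB x - dB a, by the same use of \<open>inv\<close> as for
          \<open>Bdiff\<close>.\<close>
        have "n1 (\<lambda>i j. ((dp m x i j - dp m a i j - (dd m x i j - dd m a i j) * B x i j) - dd m a i j * (B x i j - B a i j))
            - (d x i j - d a i j) * dB m a i j)
          \<le> ennreal (((e1 + e1 * (\<tau> * H)) + L * (\<tau> * H' * l)) + L * l * (\<tau> * H'))"
        proof (intro n1.diff_le)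
          show "n1 (\<lambda>i j. (dd m x i j - dd m a i j) * B x i j) \<le> ennreal (e1 * (\<tau> * H))"
            using x \<tau>H B1[OF xD] by (intro \<delta>2'[rule_format]) auto
          have "n1 (\<lambda>i j. B x i j - B a i j) \<le> ennreal (\<tau> * H' * l)"
            using n12 BB[OF xD a] order_trans unfolding l_def by blast
          then show "n1 (\<lambda>i j. dd m a i j * (B x i j - B a i j)) \<le> ennreal (L * (\<tau> * H' * l))"
            using pos H' l by (intro dd a) auto
          have "n1 (dB m a) \<le> ennreal (\<tau> * H')"
            using n12 dB2[OF a] order_trans by blast
          then show "n1 (\<lambda>i j. (d x i j - d a i j) * dB m a i j) \<le> ennreal (L * l * (\<tau> * H'))"
            unfolding l_def using pos H' by (intro d xD a) auto
        qed (use x \<delta>1 e1 \<tau>H pos H' l in auto)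
        also have "\<dots> \<le> ennreal (e1 * (1 + \<tau> * H) + c * \<delta>0)"
        proof (rule ennreal_leI)
          have "2 * L * (\<tau> * H') * l \<le> 2 * L * (\<tau> * H') * (?n * \<delta>0)"
            using l pos H' by (intro mult_left_mono) auto
          also have "\<dots> \<le> 2 * L * (\<tau> * H') * (?n * \<delta>0) * (1 + ?n)"
            using mult_left_mono[of 1 "1 + ?n" "2 * L * (\<tau> * H') * (?n * \<delta>0)"] pos H'(1) \<delta>0 by simp
          also have "\<dots> = c * \<delta>0" by (simp add: c_def)
          finally show "((e1 + e1 * (\<tau> * H)) + L * (\<tau> * H' * l)) + L * l * (\<tau> * H') \<le> e1 * (1 + \<tau> * H) + c * \<delta>0"
            by (simp add: algebra_simps)
        qed
        finally have "n2 (\<lambda>i j. w x i j * (((dp m x i j - dp m a i j - (dd m x i j - dd m a i j) * B x i j) - dd m a i j * (B x i j - B a i j))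
            - (d x i j - d a i j) * dB m a i j)) \<le> ennreal (\<tau> * (e1 * (1 + \<tau> * H) + c * \<delta>0))"
          using e1 \<tau>H c0 \<delta>0 by (intro w xD) auto
        also have "\<dots> \<le> ennreal e" using small by (rule ennreal_leI)
        also have "(\<lambda>i j. w x i j * (((dp m x i j - dp m a i j - (dd m x i j - dd m a i j) * B x i j) - dd m a i j * (B x i j - B a i j))
            - (d x i j - d a i j) * dB m a i j)) = (\<lambda>i j. dB m x i j - dB m a i j)"
        proof (intro ext)
          fix i j
          have "dB m x i j - dB m a i j = w x i j * (q m x i j - q m a i j) + (w x i j - w a i j) * q m a i j"
            by (simp add: dB_def q_def algebra_simps)
          also have "\<dots> = w x i j * (q m x i j - q m a i j - (d x i j - d a i j) * dB m a i j)"
            unfolding inv[OF xD a] by (simp add: dB_def q_def algebra_simps)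
          finally show "w x i j * (((dp m x i j - dp m a i j - (dd m x i j - dd m a i j) * B x i j) - dd m a i j * (B x i j - B a i j))
            - (d x i j - d a i j) * dB m a i j) = dB m x i j - dB m a i j"
            by (simp add: q_def algebra_simps)
        qed
        finally show "n2 (\<lambda>i j. dB m x i j - dB m a i j) \<le> ennreal e" .
      qed (use \<delta>0 \<delta>1 \<delta>2 in auto)
    qed
    show "\<exists>\<delta>>0. \<forall>x\<in>D \<inter> ball a \<delta>. \<forall>y\<in>D \<inter> ball a \<delta>.
        n2 (\<lambda>i j. B x i j - B y i j - (\<Sum>m\<in>UNIV. complex_of_real (x $ m - y $ m) * dB m y i j)) \<le> ennreal (e * norm (x - y))"
    proof -
      obtain \<delta>1 where \<delta>1: "\<delta>1 > 0" "\<And>x y. x \<in> D \<inter> ball a \<delta>1 \<Longrightarrow> y \<in> D \<inter> ball a \<delta>1 \<Longrightarrow>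
        n1 (\<lambda>i j. p x i j - p y i j - (\<Sum>m\<in>UNIV. complex_of_real (x $ m - y $ m) * dp m y i j)) \<le> ennreal (e1 * norm (x - y))"
        using whitney_C1_remainder[OF p a e1] by blast
      obtain \<delta>2 where \<delta>2: "\<delta>2 > 0" and \<delta>2': "\<forall>x\<in>D \<inter> ball a \<delta>2. \<forall>y\<in>D \<inter> ball a \<delta>2. \<forall>Q h. h \<ge> 0 \<longrightarrow> n1 Q \<le> ennreal h \<longrightarrow>
        n1 (\<lambda>i j. (d x i j - d y i j - (\<Sum>m\<in>UNIV. complex_of_real (x $ m - y $ m) * dd m y i j)) * Q i j) \<le> ennreal (e1 * norm (x - y) * h)"
        using d_rem[OF a e1] by (elim exE conjE)
      show ?thesis
      proof (intro exI[of _ "min \<delta>0 (min \<delta>1 \<delta>2)"] conjI ballI)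
        fix x y assume x: "x \<in> D \<inter> ball a (min \<delta>0 (min \<delta>1 \<delta>2))" and y: "y \<in> D \<inter> ball a (min \<delta>0 (min \<delta>1 \<delta>2))"
        have xD: "x \<in> D" "y \<in> D" using x y by auto
        define N where "N = norm (x - y)"
        have "dist x a < \<delta>0" "dist y a < \<delta>0" using x y by (auto simp: dist_commute)
        then have N: "N \<ge> 0" "N \<le> 2 * \<delta>0"
          unfolding N_def dist_norm[symmetric] using dist_triangle2[of x y a] by auto
        define l where "l = l1 (x - y)"
        have l: "l \<ge> 0" "l \<le> ?n * N"
          using l1_nonneg[of "x - y"] l1_le_norm[of "x - y"] by (auto simp: l_def N_def)
        define G where "G = (\<lambda>i j. \<Sum>m\<in>UNIV. complex_of_real (x $ m - y $ m) * q m y i j)"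
        have G: "n1 G \<le> ennreal (l * H')"
        proof -
          have "n1 G \<le> ennreal (\<Sum>m\<in>UNIV. cmod (complex_of_real (x $ m - y $ m)) * H')"
            unfolding G_def using q1 xD H' by (intro n1.sum_le) auto
          also have "(\<Sum>m\<in>UNIV. cmod (complex_of_real (x $ m - y $ m)) * H') = l * H'"
            by (simp only: norm_of_real l_def l1_def sum_distrib_right vector_minus_component)
          finally show ?thesis .
        qed
        \<comment> \<open>The first-order increment predicted for \<open>B\<close>. Its product with
          d x - d y is quadratic in x - y; the other two terms of the remainder are the Taylor
          remainders of \<open>p\<close> and of \<open>d\<close>.\<close>
        define wG where "wG = (\<lambda>i j. w y i j * G i j)"
        have "n2 wG \<le> ennreal (\<tau> * (l * H'))" unfolding wG_def using xD G l H' by (intro w) auto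
        then have wG: "n1 wG \<le> ennreal (\<tau> * (l * H'))" using n12 order_trans by blast
        let ?rp = "\<lambda>i j. p x i j - p y i j - (\<Sum>m\<in>UNIV. complex_of_real (x $ m - y $ m) * dp m y i j)"
        let ?rd = "\<lambda>i j. d x i j - d y i j - (\<Sum>m\<in>UNIV. complex_of_real (x $ m - y $ m) * dd m y i j)"
        have "n1 (\<lambda>i j. ?rp i j - ?rd i j * B y i j - (d x i j - d y i j) * wG i j)
          \<le> ennreal (e1 * N + e1 * N * (\<tau> * H) + L * l * (\<tau> * (l * H')))"
        proof (intro n1.diff_le)
          show "n1 ?rp \<le> ennreal (e1 * N)" unfolding N_def using x y by (intro \<delta>1) auto
          show "n1 (\<lambda>i j. ?rd i j * B y i j) \<le> ennreal (e1 * N * (\<tau> * H))"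
            unfolding N_def using x y \<tau>H xD by (intro \<delta>2'[rule_format] B1) auto
          show "n1 (\<lambda>i j. (d x i j - d y i j) * wG i j) \<le> ennreal (L * l * (\<tau> * (l * H')))"
            unfolding l_def using xD wG pos H' l by (intro d) (auto simp: l_def)
        qed (use e1 N pos H' l in auto)
        also have "\<dots> \<le> ennreal ((e1 * (1 + \<tau> * H) + c * \<delta>0) * N)"
        proof (rule ennreal_leI)
          \<comment> \<open>Of the two factors of size |x - y| one is kept for the remainder
            estimate and the other is at most 2 \<open>\<delta>0\<close>.\<close>
          have "L * l * (\<tau> * (l * H')) = (L * (\<tau> * H')) * (l * l)" by simp
          also have "\<dots> \<le> (L * (\<tau> * H')) * ((?n * (2 * \<delta>0)) * (?n * N))"
            using l N pos H' by (intro mult_left_mono mult_mono order_trans[OF l(2)]) auto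
          also have "\<dots> \<le> (L * (\<tau> * H')) * (((1 + ?n) * (2 * \<delta>0)) * (?n * N))"
            using N \<delta>0 pos H' by (intro mult_left_mono mult_right_mono) auto
          also have "\<dots> = c * \<delta>0 * N" by (simp add: c_def)
          finally show "e1 * N + e1 * N * (\<tau> * H) + L * l * (\<tau> * (l * H')) \<le> (e1 * (1 + \<tau> * H) + c * \<delta>0) * N"
            by (simp add: algebra_simps)
        qed
        finally have "n2 (\<lambda>i j. w x i j * (?rp i j - ?rd i j * B y i j - (d x i j - d y i j) * wG i j))
          \<le> ennreal (\<tau> * ((e1 * (1 + \<tau> * H) + c * \<delta>0) * N))"
          using e1 \<tau>H c0 \<delta>0 N xD by (intro w) auto
        also have "\<dots> \<le> ennreal (e * N)"
          using mult_right_mono[OF small N(1)] by (intro ennreal_leI) (simp add: mult.assoc)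
        also have "(\<lambda>i j. w x i j * (?rp i j - ?rd i j * B y i j - (d x i j - d y i j) * wG i j))
          = (\<lambda>i j. B x i j - B y i j - (\<Sum>m\<in>UNIV. complex_of_real (x $ m - y $ m) * dB m y i j))"
        proof (intro ext)
          fix i j
          have Gs: "(\<Sum>m\<in>UNIV. complex_of_real (x $ m - y $ m) * dB m y i j) = w y i j * G i j"
            by (simp add: G_def dB_def q_def sum_distrib_left mult_ac)
          have G': "G i j = (\<Sum>m\<in>UNIV. complex_of_real (x $ m - y $ m) * dp m y i j)
              - (\<Sum>m\<in>UNIV. complex_of_real (x $ m - y $ m) * dd m y i j) * B y i j"
            unfolding G_def q_def sum_distrib_right sum_subtractf[symmetric]
            by (intro sum.cong) (simp_all only: right_diff_distrib mult.assoc)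
          have "B x i j - B y i j - w y i j * G i j
            = w x i j * (p x i j - p y i j - (d x i j - d y i j) * B y i j) - w x i j * G i j + (w x i j - w y i j) * G i j"
            unfolding Bdiff[OF xD] by (simp add: algebra_simps)
          also have "\<dots> = w x i j * ((p x i j - p y i j - (d x i j - d y i j) * B y i j) - G i j - (d x i j - d y i j) * wG i j)"
            unfolding inv[OF xD] wG_def by (simp add: algebra_simps)
          finally show "w x i j * (?rp i j - ?rd i j * B y i j - (d x i j - d y i j) * wG i j)
            = B x i j - B y i j - (\<Sum>m\<in>UNIV. complex_of_real (x $ m - y $ m) * dB m y i j)"
            unfolding Gs G' by (simp add: algebra_simps)
        qed
        finally show "n2 (\<lambda>i j. B x i j - B y i j - (\<Sum>m\<in>UNIV. complex_of_real (x $ m - y $ m) * dB m y i j)) \<le> ennreal (e * norm (x - y))"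
          by (simp add: N_def)
      qed (use \<delta>0 \<delta>1 \<delta>2 in auto)
    qed
  qed
qed

subsection \<open>Analytic maps on the torus\<close>

lemma strip_eq_box_strip: "strip \<rho> = box_strip (\<lambda>_. \<rho>)"
  by (simp add: strip_def box_strip_def)

lemma strip_mono: "\<rho>' \<le> \<rho> \<Longrightarrow> strip \<rho>' \<subseteq> strip \<rho>"
  by (auto simp: strip_def intro: less_le_trans)

lemma upd_eq_plus_axis: "upd \<theta> m (z + t) = upd \<theta> m z + axis m (t :: 'a :: monoid_add)"
  by (simp add: vec_eq_iff axis_def)

definition torus_exp :: "('n \<Rightarrow> int) \<Rightarrow> complex^'n \<Rightarrow> complex" where
  "torus_exp k \<theta> = exp (\<i> * (\<Sum>m\<in>UNIV. of_int (k m) * \<theta> $ m))"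

lemma torus_exp_add: "torus_exp k (\<theta> + h) = torus_exp k \<theta> * torus_exp k h"
  by (simp add: torus_exp_def distrib_left sum.distrib exp_add)

lemma sum_axis:
  fixes f :: "'n::finite \<Rightarrow> complex"
  shows "(\<Sum>m'\<in>UNIV. axis m z $ m' * f m') = z * f m"
proof -
  have "(\<Sum>m'\<in>UNIV. axis m z $ m' * f m') = (\<Sum>m'\<in>{m}. axis m z $ m' * f m')"
    by (intro sum.mono_neutral_right) (auto simp: axis_def)
  then show ?thesis by simp
qed

lemma torus_exp_axis: "torus_exp k (axis m z) = exp (\<i> * of_int (k m) * z)"
  using sum_axis[of m z "\<lambda>m. of_int (k m)"] by (simp add: torus_exp_def mult_ac)

lemma torus_exp_periodic: "torus_exp k (\<theta> + axis m (of_real (2 * pi))) = torus_exp k \<theta>"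
  using exp_int_periodic[of "k m" 0] by (simp add: torus_exp_add torus_exp_axis)

lemma norm_torus_exp_le:
  assumes "\<theta> \<in> strip \<rho>"
  shows "cmod (torus_exp k \<theta>) \<le> exp (real_of_int (\<Sum>m\<in>UNIV. \<bar>k m\<bar>) * \<rho>)"
proof -
  have "- (\<Sum>m\<in>UNIV. of_int (k m) * Im (\<theta> $ m)) \<le> (\<Sum>m\<in>UNIV. real_of_int \<bar>k m\<bar> * \<rho>)"
    unfolding sum_negf[symmetric]
  proof (rule sum_mono)
    fix m
    have "- (of_int (k m) * Im (\<theta> $ m)) \<le> \<bar>of_int (k m) * Im (\<theta> $ m)\<bar>" by simp
    also have "\<dots> \<le> real_of_int \<bar>k m\<bar> * \<rho>"
      using assms by (simp add: abs_mult strip_def mult_left_mono less_imp_le)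
    finally show "- (of_int (k m) * Im (\<theta> $ m)) \<le> real_of_int \<bar>k m\<bar> * \<rho>" .
  qed
  then show ?thesis
    by (simp add: torus_exp_def Im_sum Re_sum sum_distrib_right)
qed

text \<open>As \<open>torus_exp\<close> is multiplicative, only the derivative of exp at 0 is
  needed, applied to a linear form in h whose norm is at most c.\<close>

lemma torus_exp_first_order:
  assumes "e > 0"
  shows "\<exists>d>0. \<forall>h. norm h < d \<longrightarrow>
    cmod (torus_exp k (\<theta> + h) - torus_exp k \<theta> - (\<Sum>m\<in>UNIV. h $ m * (\<i> * of_int (k m) * torus_exp k \<theta>))) \<le> e * norm h"
proof -
  define w where "w h = \<i> * (\<Sum>m\<in>UNIV. of_int (k m) * h $ m)" for h :: "complex^'a"
  define c where "c = (\<Sum>m\<in>UNIV. real_of_int \<bar>k m\<bar>) + 1"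
  have c: "c > 0" unfolding c_def by (intro add_nonneg_pos sum_nonneg) auto
  have wb: "cmod (w h) \<le> c * norm h" for h
  proof -
    have "cmod (w h) \<le> (\<Sum>m\<in>UNIV. real_of_int \<bar>k m\<bar> * norm h)"
      unfolding w_def norm_mult norm_ii mult_1
      by (intro order_trans[OF norm_sum] sum_mono) (simp add: norm_mult mult_left_mono Finite_Cartesian_Product.norm_nth_le)
    also have "\<dots> \<le> c * norm h" by (simp add: c_def sum_distrib_right[symmetric] distrib_right)
    finally show ?thesis .
  qed
  define e' where "e' = e / (c * (cmod (torus_exp k \<theta>) + 1))"
  have t1: "cmod (torus_exp k \<theta>) + 1 > 0" by (simp add: add_nonneg_pos)
  have e': "e' > 0" using assms c t1 by (simp add: e'_def)
  have "(exp has_derivative (\<lambda>h. exp 0 * h)) (at (0::complex))"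
    using DERIV_exp[of "0::complex"] unfolding has_field_derivative_def .
  then obtain d where d: "d > 0" "\<And>z. cmod z < d \<Longrightarrow> cmod (exp z - 1 - z) \<le> e' * cmod z"
    unfolding has_derivative_at_alt using e' by (auto dest!: spec[of _ e'])
  show ?thesis
  proof (intro exI[of _ "d / c"] conjI allI impI)
    show "d / c > 0" using d c by simp
    fix h :: "complex^'a" assume "norm h < d / c"
    then have "c * norm h < d" using c by (simp add: pos_less_divide_eq mult.commute)
    then have "cmod (w h) < d" using wb[of h] by linarith
    then have "cmod (exp (w h) - 1 - w h) \<le> e' * (c * norm h)"
      using d(2)[of "w h"] wb[of h] e' mult_left_mono[OF wb[of h], of e'] by linarith
    then have "cmod (torus_exp k \<theta>) * cmod (exp (w h) - 1 - w h) \<le> (cmod (torus_exp k \<theta>) + 1) * (e' * (c * norm h))"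
      by (intro mult_mono) auto
    also have "\<dots> = e * norm h"
    proof -
      have "t * (x / (c * t) * (c * y)) = x * y" if "t > 0" for t x y :: real using that c by simp
      then show ?thesis unfolding e'_def using t1 by blast
    qed
    also have "cmod (torus_exp k \<theta>) * cmod (exp (w h) - 1 - w h)
      = cmod (torus_exp k (\<theta> + h) - torus_exp k \<theta> - (\<Sum>m\<in>UNIV. h $ m * (\<i> * of_int (k m) * torus_exp k \<theta>)))"
    proof -
      have "torus_exp k h = exp (w h)" by (simp add: torus_exp_def w_def)
      moreover have "(\<Sum>m\<in>UNIV. h $ m * (\<i> * of_int (k m) * torus_exp k \<theta>)) = torus_exp k \<theta> * w h"
        by (simp add: w_def sum_distrib_left sum_distrib_right mult_ac)
      ultimately have "torus_exp k (\<theta> + h) - torus_exp k \<theta> - (\<Sum>m\<in>UNIV. h $ m * (\<i> * of_int (k m) * torus_exp k \<theta>))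
         = torus_exp k \<theta> * (exp (w h) - 1 - w h)"
        by (simp add: torus_exp_add right_diff_distrib)
      then show ?thesis by (simp add: norm_mult)
    qed
    finally show "cmod (torus_exp k (\<theta> + h) - torus_exp k \<theta> - (\<Sum>m\<in>UNIV. h $ m * (\<i> * of_int (k m) * torus_exp k \<theta>))) \<le> e * norm h" .
  qed
qed

context mat_seminorm
begin

lemma torus_analytic_zero: "torus_analytic nrm \<rho> (\<lambda>\<theta> i j. 0)"
  unfolding torus_analytic_def by (auto simp: nrm_zero intro!: exI[of _ "\<lambda>_ _ _. 0"] exI[of _ 1])

lemma torus_analytic_add_cmult:
  assumes F: "torus_analytic nrm \<rho> F" and G: "torus_analytic nrm \<rho> G"
  shows "torus_analytic nrm \<rho> (\<lambda>\<theta> i j. c * F \<theta> i j + G \<theta> i j)"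
  unfolding torus_analytic_def
proof (intro conjI ballI allI)
  have fin: "nrm (\<lambda>i j. c * A i j + B i j) < \<infinity>" if AB: "nrm A < \<infinity>" "nrm B < \<infinity>" for A B
  proof -
    obtain a where "a \<ge> 0" "nrm A \<le> ennreal a" using finite_nrm[OF AB(1)] by auto
    moreover obtain b where "b \<ge> 0" "nrm B \<le> ennreal b" using finite_nrm[OF AB(2)] by auto
    ultimately have "nrm (\<lambda>i j. c * A i j + B i j) \<le> ennreal (cmod c * a + b)"
      by (intro add_le cmult_le) auto
    then show ?thesis by (rule order_le_less_trans) simp
  qed
  fix \<theta> :: "complex^'a" assume \<theta>: "\<theta> \<in> strip \<rho>"
  show "(\<lambda>i j. c * F (\<theta> + axis m (complex_of_real (2 * pi))) i j + G (\<theta> + axis m (complex_of_real (2 * pi))) i j)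
      = (\<lambda>i j. c * F \<theta> i j + G \<theta> i j)" for m
    using F G \<theta> unfolding torus_analytic_def by simp
  show "nrm (\<lambda>i j. c * F \<theta> i j + G \<theta> i j) < \<infinity>"
    using F G \<theta> unfolding torus_analytic_def by (intro fin) auto
  obtain L1 where L1: "\<And>m. nrm (L1 m) < \<infinity>" and L1': "\<And>e. e > 0 \<Longrightarrow> \<exists>d>0. \<forall>h. norm h < d \<longrightarrow>
     nrm (\<lambda>i j. F (\<theta> + h) i j - F \<theta> i j - (\<Sum>m\<in>UNIV. h $ m * L1 m i j)) \<le> ennreal (e * norm h)"
    using F \<theta> unfolding torus_analytic_def by blast
  obtain L2 where L2: "\<And>m. nrm (L2 m) < \<infinity>" and L2': "\<And>e. e > 0 \<Longrightarrow> \<exists>d>0. \<forall>h. norm h < d \<longrightarrow>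
     nrm (\<lambda>i j. G (\<theta> + h) i j - G \<theta> i j - (\<Sum>m\<in>UNIV. h $ m * L2 m i j)) \<le> ennreal (e * norm h)"
    using G \<theta> unfolding torus_analytic_def by blast
  show "\<exists>L. (\<forall>m. nrm (L m) < \<infinity>) \<and> (\<forall>e>0. \<exists>d>0. \<forall>h. norm h < d \<longrightarrow>
     nrm (\<lambda>i j. c * F (\<theta> + h) i j + G (\<theta> + h) i j - (c * F \<theta> i j + G \<theta> i j) - (\<Sum>m\<in>UNIV. h $ m * L m i j)) \<le> ennreal (e * norm h))"
  proof (intro exI[of _ "\<lambda>m i j. c * L1 m i j + L2 m i j"] conjI allI impI)
    show "nrm (\<lambda>i j. c * L1 m i j + L2 m i j) < \<infinity>" for m using L1 L2 by (rule fin)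
    fix e :: real assume e: "e > 0"
    define e' where "e' = e / 2 / (cmod c + 1)"
    have c1: "cmod c + 1 > 0" by (simp add: add_nonneg_pos)
    have e': "e' > 0" using e c1 by (simp add: e'_def)
    have "cmod c * e' \<le> (cmod c + 1) * e'" using e' by (intro mult_right_mono) auto
    also have "\<dots> = e / 2"
    proof -
      have "t * (x / t) = x" if "t \<noteq> 0" for t x :: real using that by simp
      then show ?thesis unfolding e'_def using c1 by (metis less_irrefl)
    qed
    finally have ce: "cmod c * e' \<le> e / 2" .
    obtain d1 where d1: "d1 > 0" "\<And>h. norm h < d1 \<Longrightarrow>
      nrm (\<lambda>i j. F (\<theta> + h) i j - F \<theta> i j - (\<Sum>m\<in>UNIV. h $ m * L1 m i j)) \<le> ennreal (e' * norm h)"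
      using L1'[OF e'] by blast
    obtain d2 where d2: "d2 > 0" "\<And>h. norm h < d2 \<Longrightarrow>
      nrm (\<lambda>i j. G (\<theta> + h) i j - G \<theta> i j - (\<Sum>m\<in>UNIV. h $ m * L2 m i j)) \<le> ennreal (e / 2 * norm h)"
      using L2'[of "e / 2"] e by auto
    show "\<exists>d>0. \<forall>h. norm h < d \<longrightarrow> nrm (\<lambda>i j. c * F (\<theta> + h) i j + G (\<theta> + h) i j - (c * F \<theta> i j + G \<theta> i j)
        - (\<Sum>m\<in>UNIV. h $ m * (c * L1 m i j + L2 m i j))) \<le> ennreal (e * norm h)"
    proof (intro exI[of _ "min d1 d2"] conjI allI impI)
      fix h :: "complex^'a" assume h: "norm h < min d1 d2"
      have "nrm (\<lambda>i j. c * (F (\<theta> + h) i j - F \<theta> i j - (\<Sum>m\<in>UNIV. h $ m * L1 m i j))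
          + (G (\<theta> + h) i j - G \<theta> i j - (\<Sum>m\<in>UNIV. h $ m * L2 m i j))) \<le> ennreal (cmod c * (e' * norm h) + e / 2 * norm h)"
        using h e e' by (intro add_le cmult_le d1(2) d2(2)) auto
      also have "\<dots> \<le> ennreal (e * norm h)"
      proof (rule ennreal_leI)
        have "(cmod c * e') * norm h \<le> e / 2 * norm h" using ce by (rule mult_right_mono) simp
        then show "cmod c * (e' * norm h) + e / 2 * norm h \<le> e * norm h" by (simp add: mult.assoc)
      qed
      also have "(\<lambda>i j. c * (F (\<theta> + h) i j - F \<theta> i j - (\<Sum>m\<in>UNIV. h $ m * L1 m i j))
          + (G (\<theta> + h) i j - G \<theta> i j - (\<Sum>m\<in>UNIV. h $ m * L2 m i j)))
        = (\<lambda>i j. c * F (\<theta> + h) i j + G (\<theta> + h) i j - (c * F \<theta> i j + G \<theta> i j)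
        - (\<Sum>m\<in>UNIV. h $ m * (c * L1 m i j + L2 m i j)))"
        by (intro ext) (simp add: distrib_left sum.distrib sum_distrib_left right_diff_distrib mult.left_commute)
      finally show "nrm (\<lambda>i j. c * F (\<theta> + h) i j + G (\<theta> + h) i j - (c * F \<theta> i j + G \<theta> i j)
        - (\<Sum>m\<in>UNIV. h $ m * (c * L1 m i j + L2 m i j))) \<le> ennreal (e * norm h)" .
    qed (use d1 d2 in auto)
  qed
qed

lemma torus_analytic_exp:
  assumes A: "nrm A < \<infinity>"
  shows "torus_analytic nrm \<rho> (\<lambda>\<theta> i j. torus_exp k \<theta> * A i j)"
  unfolding torus_analytic_def
proof (intro conjI ballI allI)
  obtain a where a: "a \<ge> 0" "nrm A \<le> ennreal a" using finite_nrm[OF A] by auto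
  have fin: "nrm (\<lambda>i j. c * A i j) < \<infinity>" for c
    by (rule order_le_less_trans[OF cmult_le[OF a(2,1)]]) simp
  fix \<theta> :: "complex^'a" assume \<theta>: "\<theta> \<in> strip \<rho>"
  show "(\<lambda>i j. torus_exp k (\<theta> + axis m (complex_of_real (2 * pi))) * A i j) = (\<lambda>i j. torus_exp k \<theta> * A i j)" for m
    by (simp only: torus_exp_periodic)
  show "nrm (\<lambda>i j. torus_exp k \<theta> * A i j) < \<infinity>" by (rule fin)
  show "\<exists>L. (\<forall>m. nrm (L m) < \<infinity>) \<and> (\<forall>e>0. \<exists>d>0. \<forall>h. norm h < d \<longrightarrow>
     nrm (\<lambda>i j. torus_exp k (\<theta> + h) * A i j - torus_exp k \<theta> * A i j - (\<Sum>m\<in>UNIV. h $ m * L m i j)) \<le> ennreal (e * norm h))"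
  proof (intro exI[of _ "\<lambda>m i j. (\<i> * of_int (k m) * torus_exp k \<theta>) * A i j"] conjI allI impI fin)
    fix e :: real assume e: "e > 0"
    have a1: "a + 1 > 0" using a by simp
    obtain d where d: "d > 0" "\<And>h. norm h < d \<Longrightarrow>
      cmod (torus_exp k (\<theta> + h) - torus_exp k \<theta> - (\<Sum>m\<in>UNIV. h $ m * (\<i> * of_int (k m) * torus_exp k \<theta>))) \<le> e / (a + 1) * norm h"
      using torus_exp_first_order[of "e / (a + 1)" k \<theta>] e a1 by auto
    show "\<exists>d>0. \<forall>h. norm h < d \<longrightarrow> nrm (\<lambda>i j. torus_exp k (\<theta> + h) * A i j - torus_exp k \<theta> * A i j
      - (\<Sum>m\<in>UNIV. h $ m * (\<i> * of_int (k m) * torus_exp k \<theta> * A i j))) \<le> ennreal (e * norm h)"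
    proof (intro exI[of _ d] conjI allI impI)
      fix h :: "complex^'a" assume h: "norm h < d"
      let ?r = "torus_exp k (\<theta> + h) - torus_exp k \<theta> - (\<Sum>m\<in>UNIV. h $ m * (\<i> * of_int (k m) * torus_exp k \<theta>))"
      have "nrm (\<lambda>i j. ?r * A i j) \<le> ennreal (cmod ?r * a)" by (rule cmult_le[OF a(2,1)])
      also have "\<dots> \<le> ennreal (e * norm h)"
      proof (rule ennreal_leI)
        have "cmod ?r * a \<le> (e / (a + 1) * norm h) * (a + 1)"
          using d(2)[OF h] a e by (intro mult_mono) auto
        then show "cmod ?r * a \<le> e * norm h" using a1 by simp
      qed
      also have "(\<lambda>i j. ?r * A i j) = (\<lambda>i j. torus_exp k (\<theta> + h) * A i j - torus_exp k \<theta> * A i j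
        - (\<Sum>m\<in>UNIV. h $ m * (\<i> * of_int (k m) * torus_exp k \<theta> * A i j)))"
        by (intro ext) (simp only: left_diff_distrib sum_distrib_right mult.assoc)
      finally show "nrm (\<lambda>i j. torus_exp k (\<theta> + h) * A i j - torus_exp k \<theta> * A i j
        - (\<Sum>m\<in>UNIV. h $ m * (\<i> * of_int (k m) * torus_exp k \<theta> * A i j))) \<le> ennreal (e * norm h)" .
    qed (use d in auto)
  qed
qed

lemma torus_analytic_exp_sum:
  assumes "finite I" "\<And>k. k \<in> I \<Longrightarrow> nrm (A k) < \<infinity>"
  shows "torus_analytic nrm \<rho> (\<lambda>\<theta> i j. \<Sum>k\<in>I. c * torus_exp k \<theta> * A k i j)"
  using assms
proof (induction I rule: finite_induct)
  case (insert k I)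
  have "torus_analytic nrm \<rho> (\<lambda>\<theta> i j. c * (torus_exp k \<theta> * A k i j) + (\<Sum>k\<in>I. c * torus_exp k \<theta> * A k i j))"
    using insert by (intro torus_analytic_add_cmult torus_analytic_exp) auto
  then show ?case using insert.hyps by (simp add: mult.assoc)
qed (simp add: torus_analytic_zero)

lemma whitney_norm_sum_le:
  fixes D :: "(real^'n) set"
  assumes I: "finite I" and F: "\<And>a. a \<in> I \<Longrightarrow> whitney_norm nrm D (F a) (dF a) \<le> ennreal (b a)" "\<And>a. a \<in> I \<Longrightarrow> b a \<ge> 0"
  shows "whitney_norm nrm D (\<lambda>x i j. \<Sum>a\<in>I. c a * F a x i j) (\<lambda>m x i j. \<Sum>a\<in>I. c a * dF a m x i j)
    \<le> ennreal (\<Sum>a\<in>I. cmod (c a) * b a)"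
proof -
  have nn: "(\<Sum>a\<in>I. cmod (c a) * b a) \<ge> 0" using F(2) by (intro sum_nonneg) auto
  have *: "nrm (F a x) \<le> ennreal (b a)" "nrm (dF a m x) \<le> ennreal (b a)"
    "y \<in> D \<Longrightarrow> nrm (\<lambda>i j. F a x i j - F a y i j) \<le> ennreal (b a * l1 (x - y))" if "a \<in> I" "x \<in> D" for a m x y
    using F(1)[OF that(1)] that(2) unfolding whitney_norm_le_iff[OF F(2)[OF that(1)]] by simp_all
  show ?thesis
    unfolding whitney_norm_le_iff[OF nn]
  proof (intro conjI ballI allI)
    fix x assume x: "x \<in> D"
    show "nrm (\<lambda>i j. \<Sum>a\<in>I. c a * F a x i j) \<le> ennreal (\<Sum>a\<in>I. cmod (c a) * b a)"
      using * x F(2) by (intro sum_le I) auto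
    show "nrm (\<lambda>i j. \<Sum>a\<in>I. c a * dF a m x i j) \<le> ennreal (\<Sum>a\<in>I. cmod (c a) * b a)" for m
      using * x F(2) by (intro sum_le I) auto
    fix y assume y: "y \<in> D"
    have "nrm (\<lambda>i j. \<Sum>a\<in>I. c a * (F a x i j - F a y i j)) \<le> ennreal (\<Sum>a\<in>I. cmod (c a) * (b a * l1 (x - y)))"
      using * x y F(2) by (intro sum_le I) (auto intro!: mult_nonneg_nonneg l1_nonneg)
    then show "nrm (\<lambda>i j. (\<Sum>a\<in>I. c a * F a x i j) - (\<Sum>a\<in>I. c a * F a y i j)) \<le> ennreal ((\<Sum>a\<in>I. cmod (c a) * b a) * l1 (x - y))"
      by (simp add: right_diff_distrib sum_subtractf sum_distrib_right mult.assoc)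
  qed
qed

end

section \<open>Sampled coefficients of matrix-valued maps\<close>

lemma iter_coef_indep:
  assumes "\<And>m. m \<notin> set ms \<Longrightarrow> \<theta> $ m = \<theta>' $ m"
  shows "iter_coef N ms k g \<theta> = iter_coef N ms k g \<theta>'"
  using assms
proof (induction ms arbitrary: \<theta> \<theta>')
  case Nil
  then have "\<theta> = \<theta>'" by (simp add: vec_eq_iff)
  then show ?case by simp
next
  case (Cons m ms)
  have "iter_coef N ms k g (upd \<theta> m x) = iter_coef N ms k g (upd \<theta>' m x)" for x
    using Cons.prems by (intro Cons.IH) auto
  then show ?case by (simp add: partial_coef_eq)
qed

lemma hat_norm_entry_le: "hat_norm \<alpha> A \<le> ennreal M \<Longrightarrow> M \<ge> 0 \<Longrightarrow> cmod (A i j) \<le> M"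
  using hat_norm_le_iff op_bound_entry by blast

text \<open>Entries are bounded by the operator norm, so the Frechet derivative in
  \<open>hat_norm\<close>, restricted to a coordinate axis, is a complex derivative of each
  entry.\<close>

lemma torus_analytic_entry:
  assumes F: "torus_analytic (hat_norm \<alpha>) \<rho> F"
  shows "sep_periodic \<rho> (\<lambda>\<theta>. F \<theta> i j)"
  unfolding sep_periodic_def
proof (intro ballI allI conjI)
  fix \<theta> :: "complex^'a" and m assume \<theta>: "\<theta> \<in> box_strip (\<lambda>_. \<rho>)"
  have up: "upd \<theta> m z \<in> strip \<rho>" if "z \<in> hstrip \<rho>" for z
    using \<theta> that by (auto simp: strip_eq_box_strip hstrip_def intro: box_strip_upd)
  show "F (upd \<theta> m (z + complex_of_real (2 * pi))) i j = F (upd \<theta> m z) i j" if "z \<in> hstrip \<rho>" for z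
    using F up[OF that] by (simp only: upd_eq_plus_axis torus_analytic_def)
  show "(\<lambda>z. F (upd \<theta> m z) i j) holomorphic_on hstrip \<rho>"
    unfolding holomorphic_on_open[OF open_hstrip]
  proof (intro ballI)
    fix z assume z: "z \<in> hstrip \<rho>"
    obtain L where L: "\<And>e. e > 0 \<Longrightarrow> \<exists>d>0. \<forall>h. norm h < d \<longrightarrow>
       hat_norm \<alpha> (\<lambda>i j. F (upd \<theta> m z + h) i j - F (upd \<theta> m z) i j - (\<Sum>m\<in>UNIV. h $ m * L m i j)) \<le> ennreal (e * norm h)"
      using F up[OF z] unfolding torus_analytic_def by blast
    have "((\<lambda>z. F (upd \<theta> m z) i j) has_field_derivative L m i j) (at z)"
      unfolding DERIV_def LIM_eq
    proof (intro allI impI)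
      fix e :: real assume e: "e > 0"
      obtain d where d: "d > 0" "\<And>h. norm h < d \<Longrightarrow>
        hat_norm \<alpha> (\<lambda>i j. F (upd \<theta> m z + h) i j - F (upd \<theta> m z) i j - (\<Sum>m\<in>UNIV. h $ m * L m i j)) \<le> ennreal (e / 2 * norm h)"
        using L[of "e / 2"] e by auto
      show "\<exists>s>0. \<forall>t. t \<noteq> 0 \<and> norm (t - 0) < s \<longrightarrow> norm ((F (upd \<theta> m (z + t)) i j - F (upd \<theta> m z) i j) / t - L m i j) < e"
      proof (intro exI[of _ d] conjI allI impI)
        fix t :: complex assume t: "t \<noteq> 0 \<and> norm (t - 0) < d"
        have nt: "norm (axis m t :: complex^'a) = cmod t"
          by (simp add: norm_vec_def L2_set_def axis_def if_distrib[of norm] if_distrib[of "\<lambda>x. x\<^sup>2"] cong: if_cong)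
        have "hat_norm \<alpha> (\<lambda>i j. F (upd \<theta> m z + axis m t) i j - F (upd \<theta> m z) i j - (\<Sum>m'\<in>UNIV. axis m t $ m' * L m' i j)) \<le> ennreal (e / 2 * cmod t)"
          using d(2)[of "axis m t"] t nt by simp
        from hat_norm_entry_le[OF this, of i j] e
        have "cmod (F (upd \<theta> m (z + t)) i j - F (upd \<theta> m z) i j - t * L m i j) \<le> e / 2 * cmod t"
          by (simp add: upd_eq_plus_axis sum_axis)
        then have "cmod (F (upd \<theta> m (z + t)) i j - F (upd \<theta> m z) i j - t * L m i j) / cmod t \<le> e / 2"
          using t by (simp add: divide_le_eq)
        moreover have "(F (upd \<theta> m (z + t)) i j - F (upd \<theta> m z) i j) / t - L m i j
           = (F (upd \<theta> m (z + t)) i j - F (upd \<theta> m z) i j - t * L m i j) / t"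
          using t by (simp add: diff_divide_distrib)
        ultimately show "norm ((F (upd \<theta> m (z + t)) i j - F (upd \<theta> m z) i j) / t - L m i j) < e"
          using e by (simp only: norm_divide)
      qed (rule d(1))
    qed
    then show "\<exists>f'. ((\<lambda>z. F (upd \<theta> m z) i j) has_field_derivative f') (at z)" by blast
  qed
qed

text \<open>The point 0 is immaterial once \<open>ms\<close> lists every variable: the coefficient
  is then constant in \<theta> by \<open>iter_coef_indep\<close>.\<close>

definition mat_coef :: "nat \<Rightarrow> 'n list \<Rightarrow> ('n \<Rightarrow> int) \<Rightarrow> (complex^'n \<Rightarrow> imat) \<Rightarrow> imat" where
  "mat_coef N ms k F = (\<lambda>i j. iter_coef N ms k (\<lambda>\<theta>. F \<theta> i j) 0)"

lemma mat_coef_test: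
  assumes "f \<in> hat_tests \<alpha>"
  shows "f (mat_coef N ms k F) = iter_coef N ms k (\<lambda>\<theta>. f (F \<theta>)) 0"
proof -
  obtain I w where "finite I" and f: "\<And>A. f A = (\<Sum>p\<in>I. w p * A (fst p) (snd p))"
    using hat_tests_finite_sum[OF assms] by blast
  show ?thesis unfolding f mat_coef_def iter_coef_sum ..
qed

lemma test_diff_sum:
  assumes "f \<in> hat_tests \<alpha>"
  shows "f (\<lambda>i j. A i j - (\<Sum>k\<in>K. c k * B k i j)) = f A - (\<Sum>k\<in>K. c k * f (B k))"
proof -
  obtain I w where "finite I" and f: "\<And>A. f A = (\<Sum>p\<in>I. w p * A (fst p) (snd p))"
    using hat_tests_finite_sum[OF assms] by blast
  have "(\<Sum>p\<in>I. w p * (\<Sum>k\<in>K. c k * B k (fst p) (snd p))) = (\<Sum>k\<in>K. c k * (\<Sum>p\<in>I. w p * B k (fst p) (snd p)))"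
    unfolding sum_distrib_left by (subst sum.swap) (simp add: mult_ac)
  then show ?thesis unfolding f by (simp add: right_diff_distrib sum_subtractf)
qed

lemma sep_periodic_test:
  assumes "f \<in> hat_tests \<alpha>" "\<And>i j. sep_periodic \<rho> (\<lambda>\<theta>. F \<theta> i j)"
  shows "sep_periodic \<rho> (\<lambda>\<theta>. f (F \<theta>))"
proof -
  obtain I w where "finite I" and f: "\<And>A. f A = (\<Sum>p\<in>I. w p * A (fst p) (snd p))"
    using hat_tests_finite_sum[OF assms(1)] by blast
  then show ?thesis unfolding f by (intro sep_periodic_sum assms)
qed

text \<open>Every test applied to F is a scalar function with the same bound M, and testing commutes
  with sampling; the scalar estimate therefore holds for all tests at once.\<close>

lemma mat_coef_bound:
  fixes F :: "complex^'n \<Rightarrow> imat"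
  assumes good: "good_sampling N n \<rho>' s" and s: "0 < \<rho>'" "0 < s" and \<rho>: "\<rho> = \<rho>' + 2 * s"
    and F: "\<And>i j. sep_periodic \<rho> (\<lambda>\<theta>. F \<theta> i j)" "\<And>\<theta>. \<theta> \<in> strip \<rho> \<Longrightarrow> hat_norm \<alpha> (F \<theta>) \<le> ennreal M" and M: "M \<ge> 0"
    and ms: "set ms = UNIV" "distinct ms" and k: "k \<in> freq_box n"
  shows "hat_norm \<alpha> (mat_coef N ms k F) \<le> ennreal (2 ^ CARD('n) * M * exp (- (real_of_int (\<Sum>m\<in>UNIV. \<bar>k m\<bar>) * (\<rho>' + s))))"
proof -
  have nn: "0 \<le> 2 ^ CARD('n) * M * exp (- (real_of_int (\<Sum>m\<in>UNIV. \<bar>k m\<bar>) * (\<rho>' + s)))" using M by simp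
  show ?thesis
    unfolding hat_norm_le_iff_tests[OF nn]
  proof
    have len: "length ms = CARD('n)" using ms distinct_card by metis
    have sum: "(\<Sum>m\<leftarrow>ms. \<bar>k m\<bar>) = (\<Sum>m\<in>UNIV. \<bar>k m\<bar>)" using ms by (simp add: sum_list_distinct_conv_sum_set)
    fix f assume f: "f \<in> hat_tests \<alpha>"
    have "cmod (iter_coef N ms k (\<lambda>\<theta>. f (F \<theta>)) 0) \<le> 2 ^ length ms * M * exp (- (real_of_int (\<Sum>m\<leftarrow>ms. \<bar>k m\<bar>) * (\<rho>' + s)))"
    proof (rule iter_coef_bound[OF good s \<rho> sep_periodic_test[OF f F(1)]])
      show "cmod (f (F \<theta>)) \<le> M" if "\<theta> \<in> box_strip (\<lambda>_. \<rho>)" for \<theta>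
        using F(2)[of \<theta>] that f hat_norm_le_iff_tests[OF M] unfolding strip_eq_box_strip by blast
      show "\<bar>k m\<bar> \<le> int n" for m using k by (simp add: freq_box_iff)
    qed (use s \<rho> in \<open>auto simp: box_strip_def\<close>)
    then show "cmod (f (mat_coef N ms k F)) \<le> 2 ^ CARD('n) * M * exp (- (real_of_int (\<Sum>m\<in>UNIV. \<bar>k m\<bar>) * (\<rho>' + s)))"
      unfolding mat_coef_test[OF f] len sum .
  qed
qed

lemma mat_coef_bound_0:
  fixes F :: "complex^'n \<Rightarrow> imat"
  assumes N: "N > 0" and \<rho>: "\<rho> > 0" and F: "\<And>\<theta>. \<theta> \<in> strip \<rho> \<Longrightarrow> hat_norm \<alpha> (F \<theta>) \<le> ennreal M" and M: "M \<ge> 0"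
  shows "hat_norm \<alpha> (mat_coef N ms (\<lambda>_. 0) F) \<le> ennreal M"
  unfolding hat_norm_le_iff_tests[OF M]
proof
  fix f assume f: "f \<in> hat_tests \<alpha>"
  show "cmod (f (mat_coef N ms (\<lambda>_. 0) F)) \<le> M"
    unfolding mat_coef_test[OF f]
  proof (rule iter_coef_bound_0[OF N])
    fix \<theta> :: "complex^'n" assume "\<And>m. Im (\<theta> $ m) = 0"
    then have "\<theta> \<in> strip \<rho>" using \<rho> by (simp add: strip_def)
    then show "cmod (f (F \<theta>)) \<le> M" using F f hat_norm_le_iff_tests[OF M] by blast
  qed simp
qed

lemma mat_coef_error:
  fixes F :: "complex^'n \<Rightarrow> imat"
  assumes good: "good_sampling N n \<rho>' s" and s: "0 < \<rho>'" "0 < s" and \<rho>: "\<rho> = \<rho>' + 2 * s"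
    and F: "\<And>i j. sep_periodic \<rho> (\<lambda>\<theta>. F \<theta> i j)" "\<And>\<theta>. \<theta> \<in> strip \<rho> \<Longrightarrow> hat_norm \<alpha> (F \<theta>) \<le> ennreal M" and M: "M \<ge> 0"
    and ms: "set ms = UNIV" "distinct ms" and \<theta>: "\<theta> \<in> strip \<rho>'"
  shows "hat_norm \<alpha> (\<lambda>i j. F \<theta> i j - (\<Sum>k\<in>freq_box n. torus_exp k \<theta> * mat_coef N ms k F i j))
    \<le> ennreal (CARD('n) * (5 / (1 - exp (- s))) ^ CARD('n) * exp (- (real (n + 1) * s)) * M)"
proof -
  have nn: "0 \<le> CARD('n) * (5 / (1 - exp (- s))) ^ CARD('n) * exp (- (real (n + 1) * s)) * M" using M s by simp
  show ?thesis
    unfolding hat_norm_le_iff_tests[OF nn]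
  proof
    have len: "length ms = CARD('n)" using ms distinct_card by metis
    fix f assume f: "f \<in> hat_tests \<alpha>"
    have "cmod (f (F \<theta>) - iter_trunc N n ms (\<lambda>\<theta>. f (F \<theta>)) \<theta>)
       \<le> length ms * (5 / (1 - exp (- s))) ^ length ms * exp (- (real (n + 1) * s)) * M"
    proof (rule iter_trunc_error[OF good s \<rho> sep_periodic_test[OF f F(1)]])
      show "cmod (f (F \<theta>)) \<le> M" if "\<theta> \<in> box_strip (\<lambda>_. \<rho>)" for \<theta>
        using F(2)[of \<theta>] that f hat_norm_le_iff_tests[OF M] unfolding strip_eq_box_strip by blast
      show "\<theta> \<in> box_strip (\<lambda>m. if m \<in> set ms then \<rho>' else \<rho>)"
        using \<theta> by (simp add: ms strip_eq_box_strip)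
    qed (rule ms)
    also have "iter_trunc N n ms (\<lambda>\<theta>. f (F \<theta>)) \<theta> = (\<Sum>k\<in>freq_box n. torus_exp k \<theta> * f (mat_coef N ms k F))"
      unfolding iter_trunc_eq[OF ms(2)] ms(1) freq_box_def torus_exp_def mat_coef_test[OF f]
      using iter_coef_indep[of ms \<theta> 0] ms(1) by simp
    finally show "cmod (f (\<lambda>i j. F \<theta> i j - (\<Sum>k\<in>freq_box n. torus_exp k \<theta> * mat_coef N ms k F i j)))
      \<le> CARD('n) * (5 / (1 - exp (- s))) ^ CARD('n) * exp (- (real (n + 1) * s)) * M"
      unfolding test_diff_sum[OF f] len .
  qed
qed

lemma whitney_C1_iter_coef:
  assumes nrm: "mat_seminorm nrm" and \<rho>: "\<rho> > 0"
    and P: "\<And>\<theta>. \<theta> \<in> strip \<rho> \<Longrightarrow> whitney_C1 nrm D (\<lambda>\<omega>. P \<omega> \<theta>) (\<lambda>m \<omega>. dP m \<omega> \<theta>)"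
    and \<theta>: "\<And>m. Im (\<theta> $ m) = 0"
  shows "whitney_C1 nrm D (\<lambda>\<omega> i j. iter_coef N ms k (\<lambda>\<theta>. P \<omega> \<theta> i j) \<theta>) (\<lambda>m \<omega> i j. iter_coef N ms k (\<lambda>\<theta>. dP m \<omega> \<theta> i j) \<theta>)"
  using \<theta>
proof (induction ms arbitrary: \<theta>)
  case Nil
  then show ?case using P[of \<theta>] \<rho> by (simp add: strip_def)
next
  case (Cons m ms)
  interpret mat_seminorm nrm by (rule nrm)
  show ?case
    unfolding iter_coef.simps partial_coef_eq using Cons.prems
    by (intro whitney_C1_sum Cons.IH) auto
qed

text \<open>\<open>T\<close> stands for a sampled coefficient or for the truncation remainder at a
  point. Values, derivatives and differences in \<omega> of \<open>T\<close> applied to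
  \<open>P\<close> are all \<open>T\<close> applied to some analytic map of \<theta>, so one
  estimate at fixed \<omega> controls the whole Whitney norm.\<close>

lemma whitney_norm_mat_coef:
  fixes P :: "real^'n \<Rightarrow> complex^'n \<Rightarrow> imat"
  assumes P: "C1_analytic (hat_norm \<alpha>) D \<rho> P dP" and Pn: "param_norm (hat_norm \<alpha>) D \<rho> P dP \<le> ennreal M" and M: "M \<ge> 0" and b: "b \<ge> 0"
    and coef: "\<And>F h. (\<And>i j. sep_periodic \<rho> (\<lambda>\<theta>. F \<theta> i j)) \<Longrightarrow> (\<And>\<theta>. \<theta> \<in> strip \<rho> \<Longrightarrow> hat_norm \<alpha> (F \<theta>) \<le> ennreal h) \<Longrightarrow> h \<ge> 0 \<Longrightarrow>
        hat_norm \<alpha> (\<lambda>i j. T (\<lambda>\<theta>. F \<theta> i j)) \<le> ennreal (b * h)"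
    and Tdiff: "\<And>f g. T (\<lambda>\<theta>. f \<theta> - g \<theta>) = T f - T g"
  shows "whitney_norm (hat_norm \<alpha>) D (\<lambda>\<omega> i j. T (\<lambda>\<theta>. P \<omega> \<theta> i j)) (\<lambda>m \<omega> i j. T (\<lambda>\<theta>. dP m \<omega> \<theta> i j)) \<le> ennreal (b * M)"
proof -
  interpret mat_seminorm "hat_norm \<alpha>" by (rule mat_seminorm_hat)
  have w: "whitney_norm (hat_norm \<alpha>) D (\<lambda>\<omega>. P \<omega> \<theta>) (\<lambda>m \<omega>. dP m \<omega> \<theta>) \<le> ennreal M" if "\<theta> \<in> strip \<rho>" for \<theta>
    using Pn that unfolding param_norm_def SUP_le_iff by blast
  have bd: "hat_norm \<alpha> (P \<omega> \<theta>) \<le> ennreal M" "hat_norm \<alpha> (dP m \<omega> \<theta>) \<le> ennreal M"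
    "y \<in> D \<Longrightarrow> hat_norm \<alpha> (\<lambda>i j. P \<omega> \<theta> i j - P y \<theta> i j) \<le> ennreal (M * l1 (\<omega> - y))"
    if "\<theta> \<in> strip \<rho>" "\<omega> \<in> D" for \<theta> \<omega> m y
    using w[OF that(1)] that(2) unfolding whitney_norm_le_iff[OF M] by simp_all
  have sp: "sep_periodic \<rho> (\<lambda>\<theta>. P \<omega> \<theta> i j)" "sep_periodic \<rho> (\<lambda>\<theta>. dP m \<omega> \<theta> i j)" if "\<omega> \<in> D" for \<omega> m i j
    using P that unfolding C1_analytic_def
    by (auto intro: torus_analytic_entry[of \<alpha> \<rho> "P \<omega>"] torus_analytic_entry[of \<alpha> \<rho> "dP m \<omega>"])
  have bM: "b * M \<ge> 0" using b M by simp
  show ?thesis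
    unfolding whitney_norm_le_iff[OF bM]
  proof (intro conjI ballI allI)
    fix \<omega> assume \<omega>: "\<omega> \<in> D"
    show "hat_norm \<alpha> (\<lambda>i j. T (\<lambda>\<theta>. P \<omega> \<theta> i j)) \<le> ennreal (b * M)"
      by (rule coef[OF sp(1)[OF \<omega>] bd(1)[OF _ \<omega>] M])
    show "hat_norm \<alpha> (\<lambda>i j. T (\<lambda>\<theta>. dP m \<omega> \<theta> i j)) \<le> ennreal (b * M)" for m
      by (rule coef[OF sp(2)[OF \<omega>] bd(2)[OF _ \<omega>] M])
    fix y assume y: "y \<in> D"
    have "hat_norm \<alpha> (\<lambda>i j. T (\<lambda>\<theta>. P \<omega> \<theta> i j - P y \<theta> i j)) \<le> ennreal (b * (M * l1 (\<omega> - y)))"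
      using M by (intro coef[of "\<lambda>\<theta> i j. P \<omega> \<theta> i j - P y \<theta> i j"] sep_periodic_diff sp \<omega> y bd mult_nonneg_nonneg l1_nonneg) auto
    then show "hat_norm \<alpha> (\<lambda>i j. T (\<lambda>\<theta>. P \<omega> \<theta> i j) - T (\<lambda>\<theta>. P y \<theta> i j)) \<le> ennreal (b * M * l1 (\<omega> - y))"
      by (simp add: Tdiff mult.assoc)
  qed
qed

lemma iter_coef_diff:
  "iter_coef N ms k (\<lambda>\<theta>. f \<theta> - g \<theta>) = (\<lambda>\<theta>. iter_coef N ms k f \<theta> - iter_coef N ms k g \<theta>)"
proof (induction ms)
  case (Cons m ms)
  show ?case unfolding iter_coef.simps Cons.IH by (rule ext) (rule partial_coef_diff)
qed simp

subsection \<open>Small divisors\<close>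

definition cdivisor :: "(real^'n \<Rightarrow> nat \<Rightarrow> real) \<Rightarrow> ('n \<Rightarrow> int) \<Rightarrow> real^'n \<Rightarrow> imat" where
  "cdivisor lam k \<omega> = (\<lambda>i j. of_real (divisor lam k \<omega> i j))"

lemma dotk_l1_bound:
  assumes k: "k \<in> freq_box n"
  shows "\<bar>dotk k x\<bar> \<le> real n * l1 x"
  unfolding dotk_def l1_def sum_distrib_left
proof (intro order_trans[OF sum_abs] sum_mono)
  fix m
  have "\<bar>k m\<bar> \<le> int n" using k by (simp add: freq_box_iff)
  then have "\<bar>real_of_int (k m)\<bar> \<le> real n" by linarith
  then show "\<bar>real_of_int (k m) * x $ m\<bar> \<le> real n * \<bar>x $ m\<bar>"
    unfolding abs_mult by (rule mult_right_mono) simp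
qed

text \<open>The divisors with \<open>k = 0\<close> and \<open>i = j\<close> vanish identically; since \<open>inverse 0 = 0\<close>, dividing by them
  removes the diagonal of the mean value, which is exactly what has to be put into \<open>A'\<close>.\<close>

lemma nonresonant_cases:
  assumes "\<omega> \<in> nonresonant lam \<kappa> n D" "k \<in> freq_box n" "\<kappa> > 0"
  shows "cdivisor lam k \<omega> i j = 0 \<and> i = j \<and> k = (\<lambda>_. 0) \<or>
    cdivisor lam k \<omega> i j \<noteq> 0 \<and> (i \<noteq> j \<or> k \<noteq> (\<lambda>_. 0)) \<and> cmod (inverse (cdivisor lam k \<omega> i j)) \<le> decay i j / \<kappa>"
proof (cases "i \<noteq> j \<or> k \<noteq> (\<lambda>_. 0)")
  case True
  then have le: "\<kappa> * (1 + \<bar>real i - real j\<bar>) \<le> \<bar>divisor lam k \<omega> i j\<bar>"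
    using assms by (auto simp: nonresonant_def)
  have pos: "\<kappa> * (1 + \<bar>real i - real j\<bar>) > 0" using assms(3) by (intro mult_pos_pos) auto
  have "inverse \<bar>divisor lam k \<omega> i j\<bar> \<le> inverse (\<kappa> * (1 + \<bar>real i - real j\<bar>))"
    using le pos by (rule le_imp_inverse_le)
  also have "\<dots> = decay i j / \<kappa>" by (simp add: decay_def divide_inverse mult_ac)
  finally show ?thesis
    using True le pos by (auto simp: cdivisor_def norm_inverse)
next
  case False
  then show ?thesis by (simp add: cdivisor_def divisor_def dotk_def)
qed

definition lam_bound :: "real \<Rightarrow> real \<Rightarrow> (real^'n) set \<Rightarrow> (real^'n \<Rightarrow> nat \<Rightarrow> real) \<Rightarrow> bool" where
  "lam_bound \<alpha> \<epsilon> D lam \<longleftrightarrow>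
     (\<forall>x\<in>D. \<forall>i. \<bar>lam x i\<bar> \<le> \<epsilon> \<and> real (i + 1) powr \<alpha> * \<bar>lam x (Suc i) - lam x i\<bar> \<le> \<epsilon>)"

text \<open>Checks the hypotheses \<open>w\<close>, \<open>tail\<close> and \<open>dw\<close> of
  \<open>hat_plus_norm_multiplier\<close> for the reciprocal divisor. What remains of the divisor
  besides 2 (i - j) is at most 2 \<epsilon> + 8 N n with N = \<open>CARD('n)\<close>, half of which
  is below c = 1 + 4 N n; and 2 c + 4 = 6 + 8 N n.\<close>

lemma divisor_multiplier:
  fixes k :: "'n::finite \<Rightarrow> int"
  assumes lam: "lam_bound \<alpha> \<epsilon> D lam" and \<epsilon>: "0 < \<epsilon>" "\<epsilon> \<le> 1/4" and \<kappa>: "0 < \<kappa>" "\<kappa> \<le> 1/4" and \<alpha>: "\<alpha> \<ge> 0"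
    and D: "\<And>x m. x \<in> D \<Longrightarrow> \<bar>x $ m\<bar> \<le> 2 * pi"
    and n: "n \<ge> 1" and k: "k \<in> freq_box n" and \<omega>: "\<omega> \<in> nonresonant lam \<kappa> n D"
    and Q: "hat_norm \<alpha> Q \<le> ennreal H" "H \<ge> 0"
  shows "hat_plus_norm \<alpha> (\<lambda>i j. inverse (cdivisor lam k \<omega> i j) * Q i j) \<le> ennreal ((6 + 8 * CARD('n) * n) / \<kappa>\<^sup>2 * H)"
proof -
  define c where "c = 1 + 4 * real CARD('n) * real n"
  have c: "c \<ge> 1" by (simp add: c_def)
  have \<omega>D: "\<omega> \<in> D" using \<omega> by (simp add: nonresonant_def)
  have la: "\<bar>lam \<omega> i\<bar> \<le> \<epsilon>" "real (i + 1) powr \<alpha> * \<bar>lam \<omega> (Suc i) - lam \<omega> i\<bar> \<le> \<epsilon>" for i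
    using lam \<omega>D by (auto simp: lam_bound_def)
  note cases = nonresonant_cases[OF \<omega> k \<kappa>(1)]
  have w: "cmod (inverse (cdivisor lam k \<omega> i j)) \<le> decay i j / \<kappa>" for i j
    using cases[of i j] decay_pos[of i j] \<kappa> by (auto simp: less_imp_le)
  have "\<bar>dotk k \<omega>\<bar> \<le> real CARD('n) * (real_of_int (int n) * (2 * pi))"
    using D[OF \<omega>D] k by (intro dotk_bound) (auto simp: freq_box_iff)
  also have "\<dots> = 2 * pi * (real CARD('n) * real n)" by simp
  also have "\<dots> \<le> 8 * (real CARD('n) * real n)"
    using pi_less_4 by (intro mult_right_mono) auto
  finally have dk: "\<bar>dotk k \<omega>\<bar> \<le> 8 * (real CARD('n) * real n)" .
  have tail: "cmod (1/2 - (of_nat i - of_nat j) * inverse (cdivisor lam k \<omega> i j)) \<le> c / \<kappa> * decay i j" for i j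
  proof (cases "i = j")
    case True
    have "1 / 2 \<le> c / \<kappa>" using c \<kappa> by (simp add: le_divide_eq)
    then show ?thesis using True by simp
  next
    case False
    then have d0: "cdivisor lam k \<omega> i j \<noteq> 0" using cases[of i j] by auto
    define r where "r = divisor lam k \<omega> i j - 2 * (real i - real j)"
    have "\<bar>r\<bar> \<le> \<bar>lam \<omega> i\<bar> + \<bar>lam \<omega> j\<bar> + \<bar>dotk k \<omega>\<bar>"
      unfolding r_def divisor_def by linarith
    then have r: "\<bar>r / 2\<bar> \<le> c" using la(1)[of i] la(1)[of j] dk \<epsilon> by (simp add: c_def)
    have "cdivisor lam k \<omega> i j = 2 * (of_nat i - of_nat j) + of_real r"
      by (simp add: cdivisor_def r_def)
    then have "1/2 - (of_nat i - of_nat j) * inverse (cdivisor lam k \<omega> i j)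
       = of_real (r / 2) * inverse (cdivisor lam k \<omega> i j)"
      using d0 by (simp add: field_simps)
    then have "cmod (1/2 - (of_nat i - of_nat j) * inverse (cdivisor lam k \<omega> i j))
       = \<bar>r / 2\<bar> * cmod (inverse (cdivisor lam k \<omega> i j))"
      by (simp only: norm_mult norm_of_real)
    also have "\<dots> \<le> c * (decay i j / \<kappa>)"
      using r w by (intro mult_mono) (use c in auto)
    finally show ?thesis by simp
  qed
  \<comment> \<open>Along a diagonal of the matrix neither 2 (i - j) nor k \<cdot> \<omega> changes,
    so the divisor moves only by increments of \<open>lam\<close>, and these pay for the
    weight.\<close>
  have dw: "real (min i j + 1) powr \<alpha> * cmod (inverse (cdivisor lam k \<omega> (Suc i) (Suc j)) - inverse (cdivisor lam k \<omega> i j))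
      \<le> 2 / \<kappa>\<^sup>2 * (decay i j)\<^sup>2" for i j
  proof -
    let ?d = "cdivisor lam k \<omega> i j" and ?d' = "cdivisor lam k \<omega> (Suc i) (Suc j)"
    let ?W = "real (min i j + 1) powr \<alpha>"
    define r where "r = (lam \<omega> (Suc i) - lam \<omega> i) - (lam \<omega> (Suc j) - lam \<omega> j)"
    have dd: "?d' - ?d = of_real r"
      by (simp add: cdivisor_def divisor_def r_def)
    \<comment> \<open>The two divisors vanish together, namely for k = 0 and i = j, and then the
      identity reads 0 = 0.\<close>
    have "inverse ?d' - inverse ?d = - (inverse ?d' * of_real r * inverse ?d)"
    proof (cases "?d = 0")
      case True
      then have "?d' = 0" using cases[of i j] cases[of "Suc i" "Suc j"] by auto
      then show ?thesis using True by simp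
    next
      case False
      then have "?d' \<noteq> 0" using cases[of i j] cases[of "Suc i" "Suc j"] by auto
      then show ?thesis using False unfolding dd[symmetric] by (simp add: field_simps)
    qed
    then have eq: "cmod (inverse ?d' - inverse ?d) = cmod (inverse ?d') * \<bar>r\<bar> * cmod (inverse ?d)"
      by (simp only: norm_minus_cancel norm_mult norm_of_real)
    have W: "?W * \<bar>lam \<omega> (Suc l) - lam \<omega> l\<bar> \<le> \<epsilon>" if "l = i \<or> l = j" for l
    proof -
      have "?W \<le> real (l + 1) powr \<alpha>" using that \<alpha> by (intro powr_mono2) auto
      then show ?thesis using la(2)[of l] mult_right_mono[of ?W "real (l + 1) powr \<alpha>" "\<bar>lam \<omega> (Suc l) - lam \<omega> l\<bar>"] by simp
    qed
    have "?W * \<bar>r\<bar> \<le> ?W * (\<bar>lam \<omega> (Suc i) - lam \<omega> i\<bar> + \<bar>lam \<omega> (Suc j) - lam \<omega> j\<bar>)"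
      unfolding r_def by (intro mult_left_mono) auto
    also have "\<dots> \<le> 2" using W[of i] W[of j] \<epsilon> by (simp add: distrib_left)
    finally have Wr: "?W * \<bar>r\<bar> \<le> 2" .
    have "?W * cmod (inverse ?d' - inverse ?d) = (?W * \<bar>r\<bar>) * (cmod (inverse ?d') * cmod (inverse ?d))"
      unfolding eq by simp
    also have "\<dots> \<le> 2 * (decay i j / \<kappa> * (decay i j / \<kappa>))"
      using Wr w[of "Suc i" "Suc j"] w[of i j] decay_pos[of i j] \<kappa> by (intro mult_mono) (auto simp: less_imp_le)
    also have "\<dots> = 2 / \<kappa>\<^sup>2 * (decay i j)\<^sup>2" by (simp add: power2_eq_square)
    finally show ?thesis .
  qed
  have "hat_plus_norm \<alpha> (\<lambda>i j. inverse (cdivisor lam k \<omega> i j) * Q i j) \<le> ennreal ((2 * c + 4) / \<kappa>\<^sup>2 * H)"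
    using \<kappa> c by (intro hat_plus_norm_multiplier[OF Q _ _ _ w tail dw]) auto
  then show ?thesis by (simp add: c_def algebra_simps)
qed

text \<open>An instance of \<open>whitney_quotient\<close> with division from
  \<open>hat_norm\<close> to \<open>hat_plus_norm\<close>. Here \<open>\<tau>\<close> is of order n
  / \<kappa>^2 and \<open>L\<close> of order n, which yields n^3 / \<kappa>^4.\<close>

lemma homological_quotient:
  fixes D :: "(real^'n) set" and k :: "'n \<Rightarrow> int"
  assumes lam: "lam_bound \<alpha> \<epsilon> D lam" and \<epsilon>: "0 < \<epsilon>" "\<epsilon> \<le> 1/4" and \<kappa>: "0 < \<kappa>" "\<kappa> \<le> 1/4" and \<alpha>: "\<alpha> \<ge> 0"
    and D: "\<And>x m. x \<in> D \<Longrightarrow> \<bar>x $ m\<bar> \<le> 2 * pi"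
    and LC: "whitney_C1 (hat_norm \<alpha>) D (\<lambda>\<omega>. diag (\<lambda>i. of_real (lam \<omega> i))) (\<lambda>m \<omega>. diag (\<lambda>i. of_real (dlam m \<omega> i)))"
    and LN: "whitney_norm (hat_norm \<alpha>) D (\<lambda>\<omega>. diag (\<lambda>i. of_real (lam \<omega> i))) (\<lambda>m \<omega>. diag (\<lambda>i. of_real (dlam m \<omega> i))) \<le> ennreal \<epsilon>"
    and n: "n \<ge> 1" and k: "k \<in> freq_box n"
    and p: "whitney_C1 (hat_norm \<alpha>) (nonresonant lam \<kappa> n D) p dp"
    and pn: "whitney_norm (hat_norm \<alpha>) (nonresonant lam \<kappa> n D) p dp \<le> ennreal H" and H: "H \<ge> 0"
  defines "B \<equiv> \<lambda>x i j. inverse (cdivisor lam k x i j) * p x i j"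
  defines "dB \<equiv> \<lambda>m x i j. inverse (cdivisor lam k x i j) *
      (dp m x i j - (of_real (dlam m x i) - of_real (dlam m x j) + of_int (k m)) * B x i j)"
  shows "whitney_C1 (hat_plus_norm \<alpha>) (nonresonant lam \<kappa> n D) B dB"
    and "whitney_norm (hat_plus_norm \<alpha>) (nonresonant lam \<kappa> n D) B dB \<le> ennreal (406 * CARD('n)\<^sup>2 * n ^ 3 / \<kappa> ^ 4 * H)"
proof -
  interpret hat: mat_seminorm "hat_norm \<alpha>" by (rule mat_seminorm_hat)
  let ?D = "nonresonant lam \<kappa> n D"
  have sub: "x \<in> D" if "x \<in> ?D" for x using that by (simp add: nonresonant_def)
  define \<tau> where "\<tau> = (6 + 8 * CARD('n) * n) / \<kappa>\<^sup>2"
  \<comment> \<open>The deviation \<open>lam\<close> contributes 4 \<epsilon> \<le> 1 and the term k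
    \<cdot> \<omega> contributes max |k m| \<le> n.\<close>
  define L where "L = 1 + real n"
  have dx: "diag (\<lambda>i. of_real (f i)) i j - diag (\<lambda>i. of_real (g i)) i j = diag (\<lambda>i. of_real (f i - g i)) i j" for f g :: "nat \<Rightarrow> real" and i j
    by (simp add: diag_def)
  have ln: "hat_norm \<alpha> (diag (\<lambda>i. of_real (dlam m x i))) \<le> ennreal \<epsilon>"
    "y \<in> D \<Longrightarrow> hat_norm \<alpha> (diag (\<lambda>i. of_real (lam x i - lam y i))) \<le> ennreal (\<epsilon> * l1 (x - y))" if "x \<in> D" for x y m
    using LN that \<epsilon> unfolding hat.whitney_norm_le_iff[OF less_imp_le[OF \<epsilon>(1)]] dx by auto
  have knorm: "cmod (of_int (k m)) \<le> real n" for m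
  proof -
    have "\<bar>k m\<bar> \<le> int n" using k by (simp add: freq_box_iff)
    then have "\<bar>real_of_int (k m)\<bar> \<le> real n" by linarith
    then show ?thesis by simp
  qed
  have cd: "cdivisor lam k x i j - cdivisor lam k y i j
     = (of_real (lam x i - lam y i) - of_real (lam x j - lam y j)) + of_real (dotk k (x - y))" for x y i j
    by (simp add: cdivisor_def divisor_def dotk_diff)
  have w: "hat_plus_norm \<alpha> (\<lambda>i j. inverse (cdivisor lam k x i j) * Q i j) \<le> ennreal (\<tau> * h)"
    if "x \<in> ?D" "h \<ge> 0" "hat_norm \<alpha> Q \<le> ennreal h" for x Q h
    unfolding \<tau>_def by (rule divisor_multiplier[OF lam \<epsilon> \<kappa> \<alpha> D n k that(1,3,2)])
  have d: "hat_norm \<alpha> (\<lambda>i j. (cdivisor lam k x i j - cdivisor lam k y i j) * Q i j) \<le> ennreal (L * l1 (x - y) * h)"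
    if "x \<in> ?D" "y \<in> ?D" "h \<ge> 0" "hat_norm \<alpha> Q \<le> ennreal h" for x y Q h
  proof -
    have "hat_norm \<alpha> (\<lambda>i j. (cdivisor lam k x i j - cdivisor lam k y i j) * Q i j) \<le> ennreal ((4 * (\<epsilon> * l1 (x - y)) + real n * l1 (x - y)) * h)"
      unfolding cd using dotk_l1_bound[OF k] \<epsilon> that sub
      by (intro hat_norm_diag_commutator ln \<alpha> mult_nonneg_nonneg l1_nonneg) auto
    also have "\<dots> \<le> ennreal (L * l1 (x - y) * h)"
    proof (rule ennreal_leI)
      have "4 * \<epsilon> * l1 (x - y) \<le> 1 * l1 (x - y)" using \<epsilon> l1_nonneg[of "x - y"] by (intro mult_right_mono) auto
      then have "4 * (\<epsilon> * l1 (x - y)) + real n * l1 (x - y) \<le> L * l1 (x - y)" by (simp add: L_def distrib_right)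
      then show "(4 * (\<epsilon> * l1 (x - y)) + real n * l1 (x - y)) * h \<le> L * l1 (x - y) * h"
        using that by (intro mult_right_mono) auto
    qed
    finally show ?thesis .
  qed
  have dd: "hat_norm \<alpha> (\<lambda>i j. (of_real (dlam m x i) - of_real (dlam m x j) + of_int (k m)) * Q i j) \<le> ennreal (L * h)"
    if "x \<in> ?D" "h \<ge> 0" "hat_norm \<alpha> Q \<le> ennreal h" for x m Q h
  proof -
    have "hat_norm \<alpha> (\<lambda>i j. (of_real (dlam m x i) - of_real (dlam m x j) + of_int (k m)) * Q i j) \<le> ennreal ((4 * \<epsilon> + real n) * h)"
      using knorm \<epsilon> that sub by (intro hat_norm_diag_commutator ln \<alpha>) auto
    also have "\<dots> \<le> ennreal (L * h)"
      using \<epsilon> that by (intro ennreal_leI mult_right_mono) (auto simp: L_def)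
    finally show ?thesis .
  qed
  have ddc: "\<exists>\<delta>>0. \<forall>x\<in>?D \<inter> ball a \<delta>. \<forall>Q h. h \<ge> 0 \<longrightarrow> hat_norm \<alpha> Q \<le> ennreal h \<longrightarrow>
        hat_norm \<alpha> (\<lambda>i j. ((of_real (dlam m x i) - of_real (dlam m x j) + of_int (k m)) - (of_real (dlam m a i) - of_real (dlam m a j) + of_int (k m))) * Q i j) \<le> ennreal (e * h)"
    if ae: "a \<in> ?D" "e > 0" for a m e
  proof -
    \<comment> \<open>The quarter compensates the factor 4 of
      \<open>hat_norm_diag_commutator\<close>; the constant derivative of k \<cdot> \<omega>
      cancels.\<close>
    obtain \<delta> where \<delta>: "\<delta> > 0" "\<forall>x\<in>D \<inter> ball a \<delta>. hat_norm \<alpha> (diag (\<lambda>i. of_real (dlam m x i - dlam m a i))) \<le> ennreal (e / 4)"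
      using whitney_C1_deriv[OF LC sub[OF ae(1)], of "e / 4" m] ae(2) unfolding dx by auto
    show ?thesis
    proof (intro exI[of _ \<delta>] conjI ballI allI impI)
      fix x Q h assume x: "x \<in> ?D \<inter> ball a \<delta>" and h: "(h::real) \<ge> 0" "hat_norm \<alpha> Q \<le> ennreal h"
      have "hat_norm \<alpha> (\<lambda>i j. (of_real (dlam m x i - dlam m a i) - of_real (dlam m x j - dlam m a j) + 0) * Q i j) \<le> ennreal ((4 * (e / 4) + 0) * h)"
        using \<delta>(2) x sub h ae(2) by (intro hat_norm_diag_commutator \<alpha>) auto
      then show "hat_norm \<alpha> (\<lambda>i j. ((of_real (dlam m x i) - of_real (dlam m x j) + of_int (k m)) - (of_real (dlam m a i) - of_real (dlam m a j) + of_int (k m))) * Q i j) \<le> ennreal (e * h)"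
        by (simp add: algebra_simps)
    qed (rule \<delta>(1))
  qed
  have drem: "\<exists>\<delta>>0. \<forall>x\<in>?D \<inter> ball a \<delta>. \<forall>y\<in>?D \<inter> ball a \<delta>. \<forall>Q h. h \<ge> 0 \<longrightarrow> hat_norm \<alpha> Q \<le> ennreal h \<longrightarrow>
        hat_norm \<alpha> (\<lambda>i j. (cdivisor lam k x i j - cdivisor lam k y i j
          - (\<Sum>m\<in>UNIV. complex_of_real (x $ m - y $ m) * (of_real (dlam m y i) - of_real (dlam m y j) + of_int (k m)))) * Q i j)
          \<le> ennreal (e * norm (x - y) * h)"
    if ae: "a \<in> ?D" "e > 0" for a e
  proof -
    obtain \<delta> where \<delta>: "\<delta> > 0" "\<forall>x\<in>D \<inter> ball a \<delta>. \<forall>y\<in>D \<inter> ball a \<delta>. hat_norm \<alpha> (\<lambda>i j. diag (\<lambda>i. of_real (lam x i)) i j - diag (\<lambda>i. of_real (lam y i)) i j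
         - (\<Sum>m\<in>UNIV. of_real (x $ m - y $ m) * diag (\<lambda>i. of_real (dlam m y i)) i j)) \<le> ennreal (e / 4 * norm (x - y))"
      using whitney_C1_remainder[OF LC sub[OF ae(1)], of "e / 4"] ae(2) by auto
    define r where "r x y i = lam x i - lam y i - (\<Sum>m\<in>UNIV. (x $ m - y $ m) * dlam m y i)" for x y i
    have dr: "(\<lambda>i j. diag (\<lambda>i. of_real (lam x i)) i j - diag (\<lambda>i. of_real (lam y i)) i j
         - (\<Sum>m\<in>UNIV. of_real (x $ m - y $ m) * diag (\<lambda>i. of_real (dlam m y i)) i j)) = diag (\<lambda>i. complex_of_real (r x y i))" for x y
      by (intro ext) (simp add: diag_def r_def)
    \<comment> \<open>k \<cdot> \<omega> is linear and 2 (i - j) constant, so the Taylor remainder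
      of the divisor is that of \<open>lam\<close>.\<close>
    have eq: "cdivisor lam k x i j - cdivisor lam k y i j
          - (\<Sum>m\<in>UNIV. complex_of_real (x $ m - y $ m) * (of_real (dlam m y i) - of_real (dlam m y j) + of_int (k m)))
        = of_real (r x y i) - of_real (r x y j) + 0" for x y i j
    proof -
      have dk: "of_real (dotk k (x - y)) = (\<Sum>m\<in>UNIV. complex_of_real (x $ m - y $ m) * of_int (k m))"
        by (simp add: dotk_def mult.commute)
      show ?thesis unfolding cd dk r_def
        by (simp add: distrib_left right_diff_distrib sum.distrib sum_subtractf)
    qed
    show ?thesis
    proof (intro exI[of _ \<delta>] conjI ballI allI impI)
      fix x y Q h assume x: "x \<in> ?D \<inter> ball a \<delta>" and y: "y \<in> ?D \<inter> ball a \<delta>" and h: "(h::real) \<ge> 0" "hat_norm \<alpha> Q \<le> ennreal h"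
      have "hat_norm \<alpha> (diag (\<lambda>i. complex_of_real (r x y i))) \<le> ennreal (e / 4 * norm (x - y))"
        using \<delta>(2) x y sub unfolding dr by auto
      then have "hat_norm \<alpha> (\<lambda>i j. (of_real (r x y i) - of_real (r x y j) + 0) * Q i j) \<le> ennreal ((4 * (e / 4 * norm (x - y)) + 0) * h)"
        using h ae(2) by (intro hat_norm_diag_commutator \<alpha>) auto
      then show "hat_norm \<alpha> (\<lambda>i j. (cdivisor lam k x i j - cdivisor lam k y i j
          - (\<Sum>m\<in>UNIV. complex_of_real (x $ m - y $ m) * (of_real (dlam m y i) - of_real (dlam m y j) + of_int (k m)))) * Q i j)
          \<le> ennreal (e * norm (x - y) * h)"
        unfolding eq by simp
    qed (rule \<delta>(1))
  qed
  have inv: "inverse (cdivisor lam k x i j) - inverse (cdivisor lam k y i j)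
      = - (inverse (cdivisor lam k x i j) * (cdivisor lam k x i j - cdivisor lam k y i j) * inverse (cdivisor lam k y i j))"
    if "x \<in> ?D" "y \<in> ?D" for x y i j
    using nonresonant_cases[OF that(1) k \<kappa>(1), of i j] nonresonant_cases[OF that(2) k \<kappa>(1), of i j]
    by (elim disjE conjE) (simp_all add: field_simps)
  have pos: "\<tau> \<ge> 0" "L \<ge> 0" by (simp_all add: \<tau>_def L_def)
  note Q = whitney_quotient[OF mat_seminorm_hat mat_seminorm_hat_plus hat_norm_le_hat_plus_norm pos H,
      where d = "cdivisor lam k" and dd = "\<lambda>m x i j. of_real (dlam m x i) - of_real (dlam m x j) + of_int (k m)"]
  show "whitney_C1 (hat_plus_norm \<alpha>) ?D B dB"
    unfolding B_def dB_def
    by (rule Q(1)) (rule p pn | (rule w d dd ddc drem inv, assumption+))+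
  have BN: "whitney_norm (hat_plus_norm \<alpha>) ?D B dB \<le> ennreal (\<tau> * (1 + L * \<tau>) * H)"
    unfolding B_def dB_def
    by (rule Q(2)) (rule p pn | (rule w d dd ddc drem inv, assumption+))+
  \<comment> \<open>With q = \<open>CARD('n)\<close> n: 6 + 8 q \<le> 14 q and 1 + L
    \<open>\<tau>\<close> \<le> 29 n q / \<kappa>^2, and 14 * 29 = 406.\<close>
  have "\<tau> * (1 + L * \<tau>) \<le> 406 * CARD('n)\<^sup>2 * n ^ 3 / \<kappa> ^ 4"
  proof -
    define q where "q = real CARD('n) * real n"
    have q: "q \<ge> 1" "q \<ge> n" using n mult_mono[of 1 "real CARD('n)" 1 "real n"] mult_right_mono[of 1 "real CARD('n)" "real n"]
      by (auto simp: q_def Suc_le_eq)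
    have k2: "0 < \<kappa>\<^sup>2" "\<kappa>\<^sup>2 \<le> 1" using \<kappa> by (auto intro!: power_le_one)
    have "real (6 + 8 * CARD('n) * n) = 6 + 8 * q" by (simp add: q_def)
    then have "real (6 + 8 * CARD('n) * n) \<le> 14 * q" using q(1) by linarith
    then have t: "\<tau> \<le> 14 * q / \<kappa>\<^sup>2" unfolding \<tau>_def using k2 by (intro divide_right_mono) auto
    have n1: "real n \<ge> 1" using n by simp
    have "1 + L * \<tau> \<le> n * q / \<kappa>\<^sup>2 + (2 * n) * (14 * q / \<kappa>\<^sup>2)"
    proof (intro add_mono mult_mono t)
      have "1 * 1 \<le> real n * q" using q n1 by (intro mult_mono) auto
      then show "1 \<le> n * q / \<kappa>\<^sup>2" using k2 by (simp add: le_divide_eq)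
      show "L \<le> 2 * n" using n1 by (simp add: L_def)
    qed (use pos in auto)
    also have "\<dots> = 29 * (n * q) / \<kappa>\<^sup>2" by (simp add: add_divide_distrib[symmetric])
    finally have "\<tau> * (1 + L * \<tau>) \<le> (14 * q / \<kappa>\<^sup>2) * (29 * (n * q) / \<kappa>\<^sup>2)"
      using t pos q by (intro mult_mono) auto
    also have "\<dots> = 406 * CARD('n)\<^sup>2 * n ^ 3 / \<kappa> ^ 4"
      by (simp add: q_def power2_eq_square power3_eq_cube power4_eq_xxxx mult_ac)
    finally show ?thesis .
  qed
  then have "\<tau> * (1 + L * \<tau>) * H \<le> 406 * CARD('n)\<^sup>2 * n ^ 3 / \<kappa> ^ 4 * H" using H by (rule mult_right_mono)
  then show "whitney_norm (hat_plus_norm \<alpha>) ?D B dB \<le> ennreal (406 * CARD('n)\<^sup>2 * n ^ 3 / \<kappa> ^ 4 * H)"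
    by (intro order_trans[OF BN] ennreal_leI)
qed

text \<open>Passing to the diagonal is the entrywise product with the identity matrix. So
  \<open>whitney_quotient\<close> applies with a constant multiplier and a divisor that does not
  vary, and the constant is 1.\<close>

lemma whitney_diag_part:
  fixes D :: "(real^'n) set"
  assumes p: "whitney_C1 (hat_norm \<alpha>) D p dp" and pn: "whitney_norm (hat_norm \<alpha>) D p dp \<le> ennreal H" and H: "H \<ge> 0"
  shows "whitney_C1 (hat_norm \<alpha>) D (\<lambda>x. diag (\<lambda>i. p x i i)) (\<lambda>m x. diag (\<lambda>i. dp m x i i))"
    and "whitney_norm (hat_norm \<alpha>) D (\<lambda>x. diag (\<lambda>i. p x i i)) (\<lambda>m x. diag (\<lambda>i. dp m x i i)) \<le> ennreal H"
proof -
  interpret hat: mat_seminorm "hat_norm \<alpha>" by (rule mat_seminorm_hat)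
  define I :: imat where "I = (\<lambda>i j. if i = j then 1 else 0)"
  have D: "(\<lambda>i j. I i j * A i j) = diag (\<lambda>i. A i i)" for A :: imat
    by (auto simp: I_def diag_def fun_eq_iff)
  have z: "hat_norm \<alpha> (\<lambda>i j. 0 * Q i j) \<le> ennreal h" for Q h by (simp add: hat.nrm_zero)
  have ex: "\<exists>\<delta>>0. P \<delta>" if "\<And>\<delta>. P \<delta>" for P :: "real \<Rightarrow> bool" using that by (intro exI[of _ 1]) auto
  note Q = whitney_quotient[OF mat_seminorm_hat[of \<alpha>] mat_seminorm_hat[of \<alpha>] order_refl, of 1 0 H D "\<lambda>_. I" "\<lambda>_ i j. 0" "\<lambda>_ _ i j. 0" p dp]
  have "whitney_C1 (hat_norm \<alpha>) D (\<lambda>x i j. I i j * p x i j) (\<lambda>m x i j. I i j * (dp m x i j - 0 * (I i j * p x i j)))"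
    by (rule Q(1)) (use H p pn z in \<open>auto simp: D hat.nrm_zero intro: hat_norm_diag_part intro!: ex\<close>)
  then show "whitney_C1 (hat_norm \<alpha>) D (\<lambda>x. diag (\<lambda>i. p x i i)) (\<lambda>m x. diag (\<lambda>i. dp m x i i))"
    by (simp add: D)
  have "whitney_norm (hat_norm \<alpha>) D (\<lambda>x i j. I i j * p x i j) (\<lambda>m x i j. I i j * (dp m x i j - 0 * (I i j * p x i j))) \<le> ennreal (1 * (1 + 0 * 1) * H)"
    by (rule Q(2)) (use H p pn z in \<open>auto simp: D hat.nrm_zero intro: hat_norm_diag_part intro!: ex\<close>)
  then show "whitney_norm (hat_norm \<alpha>) D (\<lambda>x. diag (\<lambda>i. p x i i)) (\<lambda>m x. diag (\<lambda>i. dp m x i i)) \<le> ennreal H"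
    by (simp add: D)
qed

lemma whitney_norm_subset:
  assumes "mat_seminorm nrm" "D' \<subseteq> D" "whitney_norm nrm D F dF \<le> ennreal M" "M \<ge> 0"
  shows "whitney_norm nrm D' F dF \<le> ennreal M"
  using assms(2,3) unfolding mat_seminorm.whitney_norm_le_iff[OF assms(1,4)] by blast

subsection \<open>The homological equation\<close>

lemma torus_analytic_mono:
  "torus_analytic nrm \<rho> F \<Longrightarrow> \<rho>' \<le> \<rho> \<Longrightarrow> torus_analytic nrm \<rho>' F"
  using strip_mono[of \<rho>' \<rho>] unfolding torus_analytic_def by blast

lemma sum_freq_box_exp:
  assumes s: "s > 0"
  shows "(\<Sum>k\<in>(freq_box n :: ('n::finite \<Rightarrow> int) set). exp (- (real_of_int (\<Sum>m\<in>UNIV. \<bar>k m\<bar>) * s))) \<le> (2 / (1 - exp (- s))) ^ CARD('n)"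
proof -
  have "(\<Sum>k\<in>(freq_box n :: ('n \<Rightarrow> int) set). exp (- (real_of_int (\<Sum>m\<in>UNIV. \<bar>k m\<bar>) * s)))
      = (\<Sum>k\<in>freq_box n. \<Prod>m\<in>(UNIV::'n set). exp (- (real_of_int \<bar>k m\<bar> * s)))"
    by (intro sum.cong refl) (simp add: exp_sum[symmetric] sum_distrib_right sum_negf)
  also have "\<dots> = (\<Prod>m\<in>(UNIV::'n set). \<Sum>b\<in>{-int n..int n}. exp (- (real_of_int \<bar>b\<bar> * s)))"
    unfolding freq_box_def by (rule prod_sum_PiE[symmetric]) auto
  also have "\<dots> \<le> (\<Prod>m\<in>(UNIV::'n set). 2 / (1 - exp (- s)))"
    using sum_exp_abs_bound[OF s] by (intro prod_mono) (auto intro: sum_nonneg)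
  finally show ?thesis by simp
qed

lemma sum_freq_box_uminus:
  "(\<Sum>k\<in>freq_box n. f (\<lambda>m. - k m)) = (\<Sum>k\<in>freq_box n. f k)"
  by (rule sum.reindex_bij_witness[where i = "\<lambda>k m. - k m" and j = "\<lambda>k m. - k m"]) (auto simp: freq_box_iff)

lemma cnj_torus_exp_real:
  "cnj (torus_exp k (\<chi> m. of_real (t $ m))) = torus_exp (\<lambda>m. - k m) (\<chi> m. of_real (t $ m))"
  by (simp add: torus_exp_def exp_cnj sum_negf)

text \<open>Turns the geometric series constants into powers of 1 / (\<rho> -
  \<open>\<rho>'\<close>); this is where \<sigma> enters the final constant.\<close>

lemma inverse_one_minus_exp_le:
  assumes "0 < s" "s \<le> \<sigma>"
  shows "1 / (1 - exp (- s)) \<le> (1 + \<sigma>) / (s :: real)"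
proof -
  have "(1 + s) * exp (- s) \<le> 1"
    using exp_ge_add_one_self[of s] mult_right_mono[of "1 + s" "exp s" "exp (- s)"] by (simp flip: exp_add)
  then have "s \<le> (1 + s) * (1 - exp (- s))" by (simp add: algebra_simps)
  then have "1 / (1 - exp (- s)) \<le> (1 + s) / s" using assms by (simp add: divide_simps mult.commute)
  also have "\<dots> \<le> (1 + \<sigma>) / s" using assms by (intro divide_right_mono) auto
  finally show ?thesis .
qed

text \<open>Everything for a fixed integer cutoff \<open>n\<close>. Of the width 2 s, one half
  yields the decay exp (-|k| s) of the modes on the smaller strip, the other half is the room in
  which the grids are moved.\<close>

lemma homological_equation:
  fixes D :: "(real^'n) set" and P :: "real^'n \<Rightarrow> complex^'n \<Rightarrow> imat"
  assumes lam: "lam_bound \<alpha> \<epsilon> D lam" and \<epsilon>: "0 < \<epsilon>" "\<epsilon> \<le> 1/4" and \<kappa>: "0 < \<kappa>" "\<kappa> \<le> 1/4" and \<alpha>: "\<alpha> \<ge> 0"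
    and D_sub: "D \<subseteq> {x. \<forall>m. \<bar>x $ m\<bar> \<le> 2 * pi}"
    and LC: "whitney_C1 (hat_norm \<alpha>) D (\<lambda>\<omega>. diag (\<lambda>i. of_real (lam \<omega> i))) (\<lambda>m \<omega>. diag (\<lambda>i. of_real (dlam m \<omega> i)))"
    and LN: "whitney_norm (hat_norm \<alpha>) D (\<lambda>\<omega>. diag (\<lambda>i. of_real (lam \<omega> i))) (\<lambda>m \<omega>. diag (\<lambda>i. of_real (dlam m \<omega> i))) \<le> ennreal \<epsilon>"
    and n: "n \<ge> 1" and s: "0 < \<rho>'" "0 < s" and \<rho>: "\<rho> = \<rho>' + 2 * s"
    and P: "C1_analytic (hat_norm \<alpha>) D \<rho> P dP" and Pn: "param_norm (hat_norm \<alpha>) D \<rho> P dP \<le> ennreal M" and M: "M \<ge> 0"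
    and herm: "hermitian_map D P"
  defines "D' \<equiv> nonresonant lam \<kappa> n D"
  shows "\<exists>A' dA' R dR S dS.
     whitney_C1 (hat_norm \<alpha>) D' A' dA' \<and> (\<forall>\<omega>\<in>D'. is_diagonal (A' \<omega>)) \<and>
     C1_analytic (hat_norm \<alpha>) D' \<rho>' R dR \<and> hermitian_map D' R \<and>
     C1_analytic (hat_plus_norm \<alpha>) D' \<rho>' S dS \<and> antihermitian_map D' S \<and>
     (\<forall>\<omega>\<in>D'. \<forall>\<theta>\<in>strip \<rho>'. \<forall>i j.
        of_real (2 * (real i - real j) + (lam \<omega> i - lam \<omega> j)) * S \<omega> \<theta> i j - \<i> * time_deriv S \<omega> \<theta> i j
          = A' \<omega> i j - P \<omega> \<theta> i j + R \<omega> \<theta> i j) \<and>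
     whitney_norm (hat_norm \<alpha>) D' A' dA' \<le> ennreal M \<and>
     param_norm (hat_norm \<alpha>) D' \<rho>' R dR
       \<le> ennreal (CARD('n) * (5 / (1 - exp (- s))) ^ CARD('n) * exp (- (real (n + 1) * s)) * M) \<and>
     param_norm (hat_plus_norm \<alpha>) D' \<rho>' S dS
       \<le> ennreal (406 * CARD('n)\<^sup>2 * n ^ 3 / \<kappa> ^ 4 * (4 / (1 - exp (- s))) ^ CARD('n) * M)"
proof -
  interpret hat: mat_seminorm "hat_norm \<alpha>" by (rule mat_seminorm_hat)
  interpret hatp: mat_seminorm "hat_plus_norm \<alpha>" by (rule mat_seminorm_hat_plus)
  have D: "\<bar>x $ m\<bar> \<le> 2 * pi" if "x \<in> D" for x m using D_sub that by blast
  have \<rho>0: "\<rho> > 0" "\<rho>' \<le> \<rho>" using s \<rho> by auto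
  obtain N where good: "good_sampling N n \<rho>' s" using ex_good_sampling[OF s] by blast
  then have N: "N > 0" by (simp add: good_sampling_def)
  obtain ms :: "'n list" where ms: "set ms = UNIV" "distinct ms"
    using finite_distinct_list[of "UNIV :: 'n set"] by auto
  have D'D: "D' \<subseteq> D" by (auto simp: D'_def nonresonant_def)
  have PW: "whitney_C1 (hat_norm \<alpha>) D (\<lambda>\<omega>. P \<omega> \<theta>) (\<lambda>m \<omega>. dP m \<omega> \<theta>)" if "\<theta> \<in> strip \<rho>" for \<theta>
    using P that by (simp add: C1_analytic_def)
  have PT: "torus_analytic (hat_norm \<alpha>) \<rho> (P \<omega>)" "torus_analytic (hat_norm \<alpha>) \<rho> (dP m \<omega>)" if "\<omega> \<in> D" for \<omega> m
    using P that by (auto simp: C1_analytic_def)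
  define p where "p k \<omega> = mat_coef N ms k (P \<omega>)" for k \<omega>
  define dp where "dp k m \<omega> = mat_coef N ms k (dP m \<omega>)" for k m \<omega>
  define H where "H k = 2 ^ CARD('n) * exp (- (real_of_int (\<Sum>m\<in>UNIV. \<bar>k m\<bar>) * (\<rho>' + s))) * M" for k :: "'n \<Rightarrow> int"
  have H: "H k \<ge> 0" for k using M by (simp add: H_def)
  have pC: "whitney_C1 (hat_norm \<alpha>) D' (p k) (dp k)" for k
  proof (rule whitney_C1_subset[OF _ D'D])
    show "whitney_C1 (hat_norm \<alpha>) D (p k) (dp k)"
      unfolding p_def dp_def mat_coef_def
      by (rule whitney_C1_iter_coef[OF mat_seminorm_hat \<rho>0(1) PW]) auto
  qed
  have pN: "whitney_norm (hat_norm \<alpha>) D' (p k) (dp k) \<le> ennreal (H k)" if "k \<in> freq_box n" for k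
  proof (rule whitney_norm_subset[OF mat_seminorm_hat D'D _ H])
    show "whitney_norm (hat_norm \<alpha>) D (p k) (dp k) \<le> ennreal (H k)"
      unfolding p_def dp_def mat_coef_def H_def
    proof (rule whitney_norm_mat_coef[OF P Pn M, where T = "\<lambda>g. iter_coef N ms k g 0"])
      show "hat_norm \<alpha> (\<lambda>i j. iter_coef N ms k (\<lambda>\<theta>. F \<theta> i j) 0)
        \<le> ennreal (2 ^ CARD('n) * exp (- (real_of_int (\<Sum>m\<in>UNIV. \<bar>k m\<bar>) * (\<rho>' + s))) * h)"
        if "\<And>i j. sep_periodic \<rho> (\<lambda>\<theta>. F \<theta> i j)" "\<And>\<theta>. \<theta> \<in> strip \<rho> \<Longrightarrow> hat_norm \<alpha> (F \<theta>) \<le> ennreal h" "0 \<le> h" for F h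
        using mat_coef_bound[OF good s \<rho> that ms \<open>k \<in> freq_box n\<close>] by (simp add: mat_coef_def mult_ac)
    qed (simp_all add: iter_coef_diff)
  qed
  \<comment> \<open>A separate estimate for the mean value: the general one would bring a factor
    2^\<open>CARD('n)\<close>, and the bound for A' has constant 1.\<close>
  have p0N: "whitney_norm (hat_norm \<alpha>) D' (p (\<lambda>_. 0)) (dp (\<lambda>_. 0)) \<le> ennreal M"
  proof (rule whitney_norm_subset[OF mat_seminorm_hat D'D _ M])
    have "whitney_norm (hat_norm \<alpha>) D (p (\<lambda>_. 0)) (dp (\<lambda>_. 0)) \<le> ennreal (1 * M)"
      unfolding p_def dp_def mat_coef_def
    proof (rule whitney_norm_mat_coef[OF P Pn M, where T = "\<lambda>g. iter_coef N ms (\<lambda>_. 0) g 0"])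
      show "hat_norm \<alpha> (\<lambda>i j. iter_coef N ms (\<lambda>_. 0) (\<lambda>\<theta>. F \<theta> i j) 0) \<le> ennreal (1 * h)"
        if "\<And>\<theta>. \<theta> \<in> strip \<rho> \<Longrightarrow> hat_norm \<alpha> (F \<theta>) \<le> ennreal h" "0 \<le> h" for F h
        using mat_coef_bound_0[OF N \<rho>0(1) that] by (simp add: mat_coef_def)
    qed (simp_all add: iter_coef_diff)
    then show "whitney_norm (hat_norm \<alpha>) D (p (\<lambda>_. 0)) (dp (\<lambda>_. 0)) \<le> ennreal M" by simp
  qed
  define B where "B k x = (\<lambda>i j. inverse (cdivisor lam k x i j) * p k x i j)" for k x
  define dB where "dB k m x = (\<lambda>i j. inverse (cdivisor lam k x i j) *
      (dp k m x i j - (of_real (dlam m x i) - of_real (dlam m x j) + of_int (k m)) * B k x i j))" for k m x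
  define T where "T = 406 * CARD('n)\<^sup>2 * n ^ 3 / \<kappa> ^ 4"
  have T: "T \<ge> 0" by (simp add: T_def)
  have BC: "whitney_C1 (hat_plus_norm \<alpha>) D' (B k) (dB k)"
    and BN: "whitney_norm (hat_plus_norm \<alpha>) D' (B k) (dB k) \<le> ennreal (T * H k)" if "k \<in> freq_box n" for k
    using homological_quotient[OF lam \<epsilon> \<kappa> \<alpha> D LC LN n that pC[unfolded D'_def] pN[OF that, unfolded D'_def] H]
    unfolding B_def dB_def D'_def T_def by blast+
  \<comment> \<open>The minus sign is that of -P: the left-hand side of the equation multiplies the
    mode k by its divisor.\<close>
  define S where "S \<omega> \<theta> = (\<lambda>i j. \<Sum>k\<in>freq_box n. - 1 * torus_exp k \<theta> * B k \<omega> i j)" for \<omega> \<theta>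
  define dS where "dS m \<omega> \<theta> = (\<lambda>i j. \<Sum>k\<in>freq_box n. - 1 * torus_exp k \<theta> * dB k m \<omega> i j)" for m \<omega> \<theta>
  \<comment> \<open>R is by definition what the truncated sum misses of P. The equation therefore
    holds exactly, although the coefficients are only sampled ones.\<close>
  define R where "R \<omega> \<theta> = (\<lambda>i j. - 1 * (\<Sum>k\<in>freq_box n. 1 * torus_exp k \<theta> * p k \<omega> i j) + P \<omega> \<theta> i j)" for \<omega> \<theta>
  define dR where "dR m \<omega> \<theta> = (\<lambda>i j. - 1 * (\<Sum>k\<in>freq_box n. 1 * torus_exp k \<theta> * dp k m \<omega> i j) + dP m \<omega> \<theta> i j)" for m \<omega> \<theta>
  have SC: "C1_analytic (hat_plus_norm \<alpha>) D' \<rho>' S dS"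
    unfolding C1_analytic_def
  proof (intro conjI ballI allI)
    show "whitney_C1 (hat_plus_norm \<alpha>) D' (\<lambda>\<omega>. S \<omega> \<theta>) (\<lambda>m \<omega>. dS m \<omega> \<theta>)" for \<theta>
      unfolding S_def dS_def by (intro hatp.whitney_C1_sum BC) auto
    fix \<omega> assume \<omega>: "\<omega> \<in> D'"
    show "torus_analytic (hat_plus_norm \<alpha>) \<rho>' (S \<omega>)"
      unfolding S_def using whitney_C1_finite[OF BC \<omega>] by (intro hatp.torus_analytic_exp_sum) auto
    show "torus_analytic (hat_plus_norm \<alpha>) \<rho>' (dS m \<omega>)" for m
      unfolding dS_def using whitney_C1_finite[OF BC \<omega>] by (intro hatp.torus_analytic_exp_sum) auto
  qed
  have RC: "C1_analytic (hat_norm \<alpha>) D' \<rho>' R dR"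
    unfolding C1_analytic_def
  proof (intro conjI ballI allI)
    show "whitney_C1 (hat_norm \<alpha>) D' (\<lambda>\<omega>. R \<omega> \<theta>) (\<lambda>m \<omega>. dR m \<omega> \<theta>)" if "\<theta> \<in> strip \<rho>'" for \<theta>
      unfolding R_def dR_def using that strip_mono[OF \<rho>0(2)]
      by (intro hat.whitney_C1_add_cmult hat.whitney_C1_sum pC whitney_C1_subset[OF PW D'D]) auto
    fix \<omega> assume \<omega>: "\<omega> \<in> D'"
    then have \<omega>D: "\<omega> \<in> D" using D'D by blast
    show "torus_analytic (hat_norm \<alpha>) \<rho>' (R \<omega>)"
      unfolding R_def using whitney_C1_finite[OF pC \<omega>]
      by (intro hat.torus_analytic_add_cmult hat.torus_analytic_exp_sum torus_analytic_mono[OF PT(1)[OF \<omega>D] \<rho>0(2)]) auto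
    show "torus_analytic (hat_norm \<alpha>) \<rho>' (dR m \<omega>)" for m
      unfolding dR_def using whitney_C1_finite[OF pC \<omega>]
      by (intro hat.torus_analytic_add_cmult hat.torus_analytic_exp_sum torus_analytic_mono[OF PT(2)[OF \<omega>D] \<rho>0(2)]) auto
  qed
  have RN: "param_norm (hat_norm \<alpha>) D' \<rho>' R dR
       \<le> ennreal (CARD('n) * (5 / (1 - exp (- s))) ^ CARD('n) * exp (- (real (n + 1) * s)) * M)" (is "_ \<le> ennreal ?b")
    unfolding param_norm_def
  proof (rule SUP_least)
    fix \<theta> :: "complex^'n" assume \<theta>: "\<theta> \<in> strip \<rho>'"
    have b: "?b \<ge> 0" using M s by simp
    show "whitney_norm (hat_norm \<alpha>) D' (\<lambda>\<omega>. R \<omega> \<theta>) (\<lambda>m \<omega>. dR m \<omega> \<theta>) \<le> ennreal ?b"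
    proof (rule whitney_norm_subset[OF mat_seminorm_hat D'D _ b])
      have "whitney_norm (hat_norm \<alpha>) D
         (\<lambda>\<omega> i j. P \<omega> \<theta> i j - (\<Sum>k\<in>freq_box n. torus_exp k \<theta> * iter_coef N ms k (\<lambda>\<theta>. P \<omega> \<theta> i j) 0))
         (\<lambda>m \<omega> i j. dP m \<omega> \<theta> i j - (\<Sum>k\<in>freq_box n. torus_exp k \<theta> * iter_coef N ms k (\<lambda>\<theta>. dP m \<omega> \<theta> i j) 0)) \<le> ennreal ?b"
      proof (rule whitney_norm_mat_coef[OF P Pn M, where T = "\<lambda>g. g \<theta> - (\<Sum>k\<in>freq_box n. torus_exp k \<theta> * iter_coef N ms k g 0)"])
        show "hat_norm \<alpha> (\<lambda>i j. F \<theta> i j - (\<Sum>k\<in>freq_box n. torus_exp k \<theta> * iter_coef N ms k (\<lambda>\<theta>. F \<theta> i j) 0))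
          \<le> ennreal (CARD('n) * (5 / (1 - exp (- s))) ^ CARD('n) * exp (- (real (n + 1) * s)) * h)"
          if "\<And>i j. sep_periodic \<rho> (\<lambda>\<theta>. F \<theta> i j)" "\<And>\<theta>. \<theta> \<in> strip \<rho> \<Longrightarrow> hat_norm \<alpha> (F \<theta>) \<le> ennreal h" "0 \<le> h" for F h
          using mat_coef_error[OF good s \<rho> that ms \<theta>] by (simp add: mat_coef_def)
        show "0 \<le> CARD('n) * (5 / (1 - exp (- s))) ^ CARD('n) * exp (- (real (n + 1) * s))" using s by simp
        show "f \<theta> - g \<theta> - (\<Sum>k\<in>freq_box n. torus_exp k \<theta> * iter_coef N ms k (\<lambda>\<theta>. f \<theta> - g \<theta>) 0)
          = f \<theta> - (\<Sum>k\<in>freq_box n. torus_exp k \<theta> * iter_coef N ms k f 0) - (g \<theta> - (\<Sum>k\<in>freq_box n. torus_exp k \<theta> * iter_coef N ms k g 0))" for f g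
          by (simp add: iter_coef_diff right_diff_distrib sum_subtractf)
      qed
      then show "whitney_norm (hat_norm \<alpha>) D (\<lambda>\<omega>. R \<omega> \<theta>) (\<lambda>m \<omega>. dR m \<omega> \<theta>) \<le> ennreal ?b"
        by (simp add: R_def dR_def p_def dp_def mat_coef_def)
    qed
  qed
  have SN: "param_norm (hat_plus_norm \<alpha>) D' \<rho>' S dS \<le> ennreal (T * (4 / (1 - exp (- s))) ^ CARD('n) * M)"
    unfolding param_norm_def
  proof (rule SUP_least)
    fix \<theta> :: "complex^'n" assume \<theta>: "\<theta> \<in> strip \<rho>'"
    have "whitney_norm (hat_plus_norm \<alpha>) D' (\<lambda>\<omega>. S \<omega> \<theta>) (\<lambda>m \<omega>. dS m \<omega> \<theta>)
      \<le> ennreal (\<Sum>k\<in>freq_box n. cmod (- 1 * torus_exp k \<theta>) * (T * H k))"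
      unfolding S_def dS_def using T H by (intro hatp.whitney_norm_sum_le BN) auto
    also have "\<dots> \<le> ennreal (T * (4 / (1 - exp (- s))) ^ CARD('n) * M)"
    proof (rule ennreal_leI)
      have "(\<Sum>k\<in>freq_box n. cmod (- 1 * torus_exp k \<theta>) * (T * H k))
        \<le> (\<Sum>k\<in>(freq_box n :: ('n \<Rightarrow> int) set). T * 2 ^ CARD('n) * M * exp (- (real_of_int (\<Sum>m\<in>UNIV. \<bar>k m\<bar>) * s)))"
      proof (rule sum_mono)
        fix k :: "'n \<Rightarrow> int"
        let ?k = "real_of_int (\<Sum>m\<in>UNIV. \<bar>k m\<bar>)"
        have "cmod (- 1 * torus_exp k \<theta>) * (T * H k) \<le> exp (?k * \<rho>') * (T * H k)"
          using norm_torus_exp_le[OF \<theta>, of k] T H by (intro mult_right_mono) (auto simp: norm_mult)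
        also have "\<dots> = T * 2 ^ CARD('n) * M * (exp (?k * \<rho>') * exp (- (?k * (\<rho>' + s))))"
          by (simp add: H_def mult_ac)
        also have "exp (?k * \<rho>') * exp (- (?k * (\<rho>' + s))) = exp (- (?k * s))"
          by (simp only: exp_add[symmetric]) (simp add: distrib_left)
        finally show "cmod (- 1 * torus_exp k \<theta>) * (T * H k) \<le> T * 2 ^ CARD('n) * M * exp (- (?k * s))" .
      qed
      \<comment> \<open>The 2^\<open>CARD('n)\<close> of the coefficient bound and the 2 / (1 - exp
        (-s)) of each geometric sum combine to (4 / (1 - exp (-s)))^\<open>CARD('n)\<close>.\<close>
      also have "\<dots> \<le> T * 2 ^ CARD('n) * M * (2 / (1 - exp (- s))) ^ CARD('n)"
        unfolding sum_distrib_left[symmetric] using T M by (intro mult_left_mono sum_freq_box_exp s) auto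
      also have "\<dots> = T * (4 / (1 - exp (- s))) ^ CARD('n) * M"
      proof -
        have "(4 / (1 - exp (- s))) ^ CARD('n) = (2 * (2 / (1 - exp (- s)))) ^ CARD('n)" by simp
        also have "\<dots> = 2 ^ CARD('n) * (2 / (1 - exp (- s))) ^ CARD('n)" by (rule power_mult_distrib)
        finally show ?thesis by simp
      qed
      finally show "(\<Sum>k\<in>freq_box n. cmod (- 1 * torus_exp k \<theta>) * (T * H k)) \<le> T * (4 / (1 - exp (- s))) ^ CARD('n) * M" .
    qed
    finally show "whitney_norm (hat_plus_norm \<alpha>) D' (\<lambda>\<omega>. S \<omega> \<theta>) (\<lambda>m \<omega>. dS m \<omega> \<theta>) \<le> ennreal (T * (4 / (1 - exp (- s))) ^ CARD('n) * M)" .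
  qed
  have pcnj: "cnj (p k \<omega> i j) = p (\<lambda>m. - k m) \<omega> j i" if "\<omega> \<in> D" for k \<omega> i j
    unfolding p_def mat_coef_def
  proof (rule iter_coef_cnj)
    fix \<theta> :: "complex^'n" assume "\<And>m. Im (\<theta> $ m) = 0"
    then have "\<theta> = (\<chi> m. of_real ((\<chi> m. Re (\<theta> $ m)) $ m))"
      by (simp add: vec_eq_iff complex_eq_iff)
    then show "cnj (P \<omega> \<theta> i j) = P \<omega> \<theta> j i"
      using herm that unfolding hermitian_map_def by metis
  qed simp
  \<comment> \<open>Transposition together with k \<mapsto> -k changes the sign of the divisor; this
    turns the Hermitian symmetry of the coefficients into the anti-Hermitian symmetry of S.\<close>
  have divneg: "cdivisor lam (\<lambda>m. - k m) \<omega> j i = - cdivisor lam k \<omega> i j" for k \<omega> i j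
    by (simp add: cdivisor_def divisor_def dotk_def sum_negf)
  have Rherm: "hermitian_map D' R"
    unfolding hermitian_map_def
  proof (intro ballI allI)
    fix \<omega> and t :: "real^'n" and i j assume "\<omega> \<in> D'"
    then have \<omega>: "\<omega> \<in> D" using D'D by blast
    let ?t = "\<chi> m. complex_of_real (t $ m)"
    have "(\<Sum>k\<in>freq_box n. cnj (torus_exp k ?t * p k \<omega> i j)) = (\<Sum>k\<in>freq_box n. torus_exp (\<lambda>m. - k m) ?t * p (\<lambda>m. - k m) \<omega> j i)"
      by (simp add: cnj_torus_exp_real pcnj[OF \<omega>])
    also have "\<dots> = (\<Sum>k\<in>freq_box n. torus_exp k ?t * p k \<omega> j i)"
      by (rule sum_freq_box_uminus)
    finally have *: "(\<Sum>k\<in>freq_box n. cnj (torus_exp k ?t * p k \<omega> i j)) = (\<Sum>k\<in>freq_box n. torus_exp k ?t * p k \<omega> j i)" .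
    have hP: "P \<omega> ?t j i = cnj (P \<omega> ?t i j)"
      using herm \<omega> unfolding hermitian_map_def by blast
    have "cnj (R \<omega> ?t i j) = - (\<Sum>k\<in>freq_box n. cnj (torus_exp k ?t * p k \<omega> i j)) + cnj (P \<omega> ?t i j)"
      by (simp add: R_def)
    also have "\<dots> = R \<omega> ?t j i"
      unfolding * hP by (simp add: R_def hP)
    finally show "R \<omega> ?t j i = cnj (R \<omega> ?t i j)" ..
  qed
  have Santi: "antihermitian_map D' S"
    unfolding antihermitian_map_def
  proof (intro ballI allI)
    fix \<omega> and t :: "real^'n" and i j assume "\<omega> \<in> D'"
    then have \<omega>: "\<omega> \<in> D" using D'D by blast
    let ?t = "\<chi> m. complex_of_real (t $ m)"
    have cr: "cnj (cdivisor lam k \<omega> i j) = cdivisor lam k \<omega> i j" for k by (simp add: cdivisor_def)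
    have "(\<Sum>k\<in>freq_box n. cnj (torus_exp k ?t * B k \<omega> i j)) = (\<Sum>k\<in>freq_box n. - (torus_exp (\<lambda>m. - k m) ?t * B (\<lambda>m. - k m) \<omega> j i))"
      by (simp add: cnj_torus_exp_real pcnj[OF \<omega>] B_def divneg cr)
    also have "\<dots> = (\<Sum>k\<in>freq_box n. - (torus_exp k ?t * B k \<omega> j i))"
      by (rule sum_freq_box_uminus)
    finally show "S \<omega> ?t j i = - cnj (S \<omega> ?t i j)"
      by (simp add: S_def sum_negf)
  qed
  have eq: "of_real (2 * (real i - real j) + (lam \<omega> i - lam \<omega> j)) * S \<omega> \<theta> i j - \<i> * time_deriv S \<omega> \<theta> i j
          = diag (\<lambda>i. p (\<lambda>_. 0) \<omega> i i) i j - P \<omega> \<theta> i j + R \<omega> \<theta> i j" if \<omega>: "\<omega> \<in> D'" for \<omega> \<theta> i j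
  proof -
    define X where "X = 2 * (real i - real j) + (lam \<omega> i - lam \<omega> j)"
    have "((\<lambda>z. S \<omega> (\<theta> + axis m z) i j) has_field_derivative
        (\<Sum>k\<in>freq_box n. - 1 * (torus_exp k \<theta> * (\<i> * of_int (k m))) * B k \<omega> i j)) (at 0)" for m
      unfolding S_def torus_exp_add torus_exp_axis
      by (rule derivative_eq_intros refl | simp add: mult_ac)+
    then have td: "time_deriv S \<omega> \<theta> i j = (\<Sum>m\<in>UNIV. of_real (\<omega> $ m) * (\<Sum>k\<in>freq_box n. - 1 * (torus_exp k \<theta> * (\<i> * of_int (k m))) * B k \<omega> i j))"
      unfolding time_deriv_def by (intro sum.cong refl arg_cong2[where f = "(*)"] DERIV_imp_deriv)
    also have "\<dots> = (\<Sum>k\<in>freq_box n. - \<i> * torus_exp k \<theta> * of_real (dotk k \<omega>) * B k \<omega> i j)"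
      unfolding sum_distrib_left by (subst sum.swap) (simp add: dotk_def sum_distrib_left sum_distrib_right mult_ac sum_negf)
    finally have td: "\<i> * time_deriv S \<omega> \<theta> i j = (\<Sum>k\<in>freq_box n. torus_exp k \<theta> * (of_real (dotk k \<omega>) * B k \<omega> i j))"
      by (simp add: sum_distrib_left mult_ac)
    have "of_real X * S \<omega> \<theta> i j = - (\<Sum>k\<in>freq_box n. torus_exp k \<theta> * (of_real X * B k \<omega> i j))"
      by (simp add: S_def sum_distrib_left sum_negf mult_ac)
    then have "of_real X * S \<omega> \<theta> i j - \<i> * time_deriv S \<omega> \<theta> i j
      = - (\<Sum>k\<in>freq_box n. torus_exp k \<theta> * (cdivisor lam k \<omega> i j * B k \<omega> i j))"
      unfolding td by (simp add: cdivisor_def divisor_def X_def distrib_left distrib_right sum.distrib)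
    \<comment> \<open>Divisor and reciprocal cancel wherever the divisor is not zero. For k = 0 and
      i = j the product is 0, so the diagonal of the mean value is missing from the sum and becomes
      A'.\<close>
    also have "(\<Sum>k\<in>freq_box n. torus_exp k \<theta> * (cdivisor lam k \<omega> i j * B k \<omega> i j))
      = (\<Sum>k\<in>freq_box n. torus_exp k \<theta> * p k \<omega> i j - (if k = (\<lambda>_. 0) then diag (\<lambda>i. p (\<lambda>_. 0) \<omega> i i) i j else 0))"
    proof (intro sum.cong refl)
      fix k :: "'n \<Rightarrow> int" assume k: "k \<in> freq_box n"
      have "torus_exp (\<lambda>_. 0) \<theta> = 1" by (simp add: torus_exp_def)
      then show "torus_exp k \<theta> * (cdivisor lam k \<omega> i j * B k \<omega> i j)
        = torus_exp k \<theta> * p k \<omega> i j - (if k = (\<lambda>_. 0) then diag (\<lambda>i. p (\<lambda>_. 0) \<omega> i i) i j else 0)"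
        using nonresonant_cases[OF \<omega>[unfolded D'_def] k \<kappa>(1), of i j]
        by (auto simp: B_def diag_def)
    qed
    also have "\<dots> = (\<Sum>k\<in>freq_box n. torus_exp k \<theta> * p k \<omega> i j) - diag (\<lambda>i. p (\<lambda>_. 0) \<omega> i i) i j"
      by (simp add: sum_subtractf freq_box_iff)
    finally show ?thesis
      unfolding X_def[symmetric] by (simp add: R_def)
  qed
  show ?thesis
    using whitney_diag_part[OF pC p0N M] RC Rherm SC Santi eq RN SN
    unfolding T_def by (intro exI[of _ "\<lambda>x. diag (\<lambda>i. p (\<lambda>_. 0) x i i)"] exI[of _ "\<lambda>m x. diag (\<lambda>i. dp (\<lambda>_. 0) m x i i)"]
       exI[of _ R] exI[of _ dR] exI[of _ S] exI[of _ dS]) (auto simp: is_diagonal_def diag_def)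
qed

section \<open>Choice of the cutoff and of the constants\<close>

text \<open>\<open>D'\<close> is fixed before the widths and P, since the divisors involve only
  \<Lambda>, \<kappa> and K. The set D need not be measurable, hence the outer measure.\<close>

theorem proposition3p1:
  fixes \<sigma> \<delta> \<alpha> \<gamma> \<nu>1 \<nu>2 :: real and Pi0 :: "(real^'n) set"
  assumes "\<sigma> > 0"
    and "Pi0 = {\<omega>. \<forall>m. 0 \<le> \<omega> $ m \<and> \<omega> $ m < 2 * pi}"
    and "0 < \<delta>" "\<delta> < 1" and "\<alpha> = (1 - \<delta>) / 2"
    and "0 < \<gamma>" "\<gamma> < 1 / 4"
    and "\<nu>1 = \<alpha> / (\<alpha> + 2)" and "\<nu>2 = real CARD('n) + 1"
  shows
    "\<exists>C>0. \<exists>\<epsilon>0>0. \<exists>\<kappa>0>0. \<forall>\<epsilon> \<kappa> :: real.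
       0 < \<epsilon> \<and> \<epsilon> < 1 - 2 * \<gamma> \<and> \<epsilon> < \<epsilon>0 \<and> 0 < \<kappa> \<and> \<kappa> \<le> \<gamma> \<and> \<kappa> < \<kappa>0 \<longrightarrow>
       (\<forall>(D :: (real^'n) set) (\<Lambda> :: real^'n \<Rightarrow> nat \<Rightarrow> real) (d\<Lambda> :: 'n \<Rightarrow> real^'n \<Rightarrow> nat \<Rightarrow> real) (K :: real).
          D \<subseteq> Pi0 \<and>
          whitney_C1 (hat_norm \<alpha>) D (\<lambda>\<omega>. diag (\<lambda>i. of_real (\<Lambda> \<omega> i) - odd_diag i))
            (\<lambda>m \<omega>. diag (\<lambda>i. of_real (d\<Lambda> m \<omega> i))) \<and>
          whitney_norm (hat_norm \<alpha>) D (\<lambda>\<omega>. diag (\<lambda>i. of_real (\<Lambda> \<omega> i) - odd_diag i))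
            (\<lambda>m \<omega>. diag (\<lambda>i. of_real (d\<Lambda> m \<omega> i))) \<le> ennreal \<epsilon> \<and>
          1 \<le> K \<longrightarrow>
          (\<exists>D'\<subseteq>D.
             (D \<in> sets lebesgue \<longrightarrow> D' \<in> sets lebesgue) \<and>
             outer_measure_of lebesgue (D - D') \<le> ennreal (C * \<kappa> powr \<nu>1 * K powr \<nu>2) \<and>
             (\<forall>(\<rho> :: real) (\<rho>' :: real) P dP.
                0 < \<rho>' \<and> \<rho>' < \<rho> \<and> \<rho> \<le> \<sigma> \<and>
                C1_analytic (hat_norm \<alpha>) D \<rho> P dP \<and>
                param_norm (hat_norm \<alpha>) D \<rho> P dP < \<infinity> \<and>
                hermitian_map D P \<longrightarrow>
                (\<exists>A' dA' R dR S dS.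
                   whitney_C1 (hat_norm \<alpha>) D' A' dA' \<and>
                   (\<forall>\<omega>\<in>D'. is_diagonal (A' \<omega>)) \<and>
                   C1_analytic (hat_norm \<alpha>) D' \<rho>' R dR \<and>
                   hermitian_map D' R \<and>
                   C1_analytic (hat_plus_norm \<alpha>) D' \<rho>' S dS \<and>
                   antihermitian_map D' S \<and>
                   (\<forall>\<omega>\<in>D'. \<forall>\<theta>\<in>strip \<rho>'. \<forall>i j.
                      commutator_diag (\<lambda>i. of_real (\<Lambda> \<omega> i)) (S \<omega> \<theta>) i j
                        - \<i> * time_deriv S \<omega> \<theta> i j
                      = A' \<omega> i j - P \<omega> \<theta> i j + R \<omega> \<theta> i j) \<and>
                   whitney_norm (hat_norm \<alpha>) D' A' dA'
                     \<le> param_norm (hat_norm \<alpha>) D \<rho> P dP \<and>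
                   param_norm (hat_norm \<alpha>) D' \<rho>' R dR
                     \<le> ennreal (C * exp (- (K / 2) * (\<rho> - \<rho>')) / (\<rho> - \<rho>') ^ CARD('n))
                       * param_norm (hat_norm \<alpha>) D \<rho> P dP \<and>
                   param_norm (hat_plus_norm \<alpha>) D' \<rho>' S dS
                     \<le> ennreal (C * K ^ 3 / (\<kappa> ^ 4 * (\<rho> - \<rho>') ^ CARD('n)))
                       * param_norm (hat_norm \<alpha>) D \<rho> P dP))))"
proof -
  let ?N = "CARD('n)"
  \<comment> \<open>C1 serves the measure, C2 the remainder R and C3 the solution S. The numbers 10
    and 8 are twice the 5 and 4 of \<open>homological_equation\<close>, because 1 / s = 2 / (\<rho>
    - \<open>\<rho>'\<close>).\<close>
  define C1 where "C1 = 3 ^ ?N * 17 * ?N * (576 * ?N * (2 * pi + 1) ^ ?N)"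
  define C2 where "C2 = ?N * (10 * (1 + \<sigma>)) ^ ?N"
  define C3 where "C3 = 406 * (real ?N)\<^sup>2 * (8 * (1 + \<sigma>)) ^ ?N"
  define C where "C = C1 + C2 + C3"
  have C0: "C1 > 0" "C2 > 0" "C3 > 0"
    using \<open>\<sigma> > 0\<close> by (auto simp: C1_def C2_def C3_def intro!: mult_pos_pos zero_less_power add_pos_pos)
  have CC: "C > 0" "C1 \<le> C" "C2 \<le> C" "C3 \<le> C" using C0 by (auto simp: C_def)
  have \<alpha>: "\<alpha> > 0" using assms by simp
  show ?thesis
  proof (rule exI[of _ C], rule conjI[OF CC(1)], rule exI[of _ "1/4"], rule conjI, simp, rule exI[of _ "1/4"], rule conjI, simp,
      intro allI impI, goal_cases)
    case (1 \<epsilon> \<kappa> D \<Lambda> d\<Lambda> K)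
    then have \<epsilon>: "0 < \<epsilon>" "\<epsilon> < 1/4" and \<kappa>: "0 < \<kappa>" "\<kappa> < 1/4" and Dsub: "D \<subseteq> Pi0"
      and WC: "whitney_C1 (hat_norm \<alpha>) D (\<lambda>\<omega>. diag (\<lambda>i. of_real (\<Lambda> \<omega> i) - odd_diag i))
            (\<lambda>m \<omega>. diag (\<lambda>i. of_real (d\<Lambda> m \<omega> i)))"
      and WN: "whitney_norm (hat_norm \<alpha>) D (\<lambda>\<omega>. diag (\<lambda>i. of_real (\<Lambda> \<omega> i) - odd_diag i))
            (\<lambda>m \<omega>. diag (\<lambda>i. of_real (d\<Lambda> m \<omega> i))) \<le> ennreal \<epsilon>"
      and K: "1 \<le> K"
      by auto
    interpret hat: mat_seminorm "hat_norm \<alpha>" by (rule mat_seminorm_hat)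
    \<comment> \<open>n \<le> K serves the measure and the size of S, K \<le> n + 1 the decay of the
      truncation error.\<close>
    define n where "n = nat \<lfloor>K\<rfloor>"
    have n: "n \<ge> 1" "real n \<le> K" "K \<le> real (n + 1)"
      using K unfolding n_def by linarith+
    define lam where "lam \<omega> i = \<Lambda> \<omega> i - (2 * real i + 1)" for \<omega> i
    have lam_eq: "of_real (\<Lambda> \<omega> i) - odd_diag i = of_real (lam \<omega> i)" for \<omega> i
      by (simp add: lam_def odd_diag_def)
    note LC = WC[unfolded lam_eq] and LN = WN[unfolded lam_eq]
    have e0: "\<epsilon> \<ge> 0" "\<epsilon> \<le> 1/4" "\<kappa> \<le> 1/4" using \<epsilon> \<kappa> by auto
    have dx: "(\<lambda>i j. diag (\<lambda>i. of_real (f i)) i j - diag (\<lambda>i. of_real (g i)) i j) = diag (\<lambda>i. of_real (f i - g i))" for f g :: "nat \<Rightarrow> real"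
      by (simp add: diag_def fun_eq_iff)
    have LN': "hat_norm \<alpha> (diag (\<lambda>i. of_real (lam x i))) \<le> ennreal \<epsilon>"
      "y \<in> D \<Longrightarrow> hat_norm \<alpha> (diag (\<lambda>i. of_real (lam x i - lam y i))) \<le> ennreal (\<epsilon> * l1 (x - y))" if "x \<in> D" for x y
      using LN that unfolding hat.whitney_norm_le_iff[OF e0(1)] dx by auto
    have re: "cmod (of_real a - of_real b) = \<bar>a - b\<bar>" for a b :: real
      by (simp only: of_real_diff[symmetric] norm_of_real)
    have lb: "lam_bound \<alpha> \<epsilon> D lam"
      using LN'(1) unfolding lam_bound_def hat_norm_diag_iff[OF e0(1)] re norm_of_real by blast
    have lb1: "\<bar>lam x i\<bar> \<le> \<epsilon>" and lb2: "real (i + 1) powr \<alpha> * \<bar>lam x (Suc i) - lam x i\<bar> \<le> \<epsilon>"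
      if "x \<in> D" for x i
      using lb that unfolding lam_bound_def by blast+
    have lip: "\<bar>lam x i - lam y i\<bar> \<le> \<epsilon> * l1 (x - y)" if "x \<in> D" "y \<in> D" for x y i
      using LN'(2)[OF that] e0(1) l1_nonneg[of "x - y"]
      unfolding hat_norm_diag_iff[OF mult_nonneg_nonneg[OF e0(1) l1_nonneg]] norm_of_real by blast
    have Dpi: "0 \<le> x $ m \<and> x $ m < 2 * pi" if "x \<in> D" for x m
      using that Dsub assms(2) by blast
    have Dabs: "D \<subseteq> {x. \<forall>m. \<bar>x $ m\<bar> \<le> 2 * pi}"
    proof clarify
      fix x m assume "x \<in> D"
      from Dpi[OF this, of m] show "\<bar>x $ m\<bar> \<le> 2 * pi" by simp
    qed
    define D' where "D' = nonresonant lam \<kappa> n D"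
    have D'D: "D' \<subseteq> D" by (auto simp: D'_def nonresonant_def)
    have meas: "D \<in> sets lebesgue \<longrightarrow> D' \<in> sets lebesgue"
      unfolding D'_def by (intro impI nonresonant_measurable[where \<epsilon> = \<epsilon>] lip)
    have small: "outer_measure_of lebesgue (D - D') \<le> ennreal (C * \<kappa> powr \<nu>1 * K powr \<nu>2)"
    proof -
      obtain U where U: "U \<in> lmeasurable" "D - D' \<subseteq> U"
        and mU: "measure lebesgue U \<le> real ((2 * n + 1) ^ ?N * (16 * ?N * n + 1)) *
          (576 * ?N * (2 * pi + 1) ^ ?N) * \<kappa> powr (\<alpha> / (\<alpha> + 2))"
        using nonresonant_cover[OF Dpi lb1 lip lb2 \<epsilon>(1) e0(2) \<kappa>(1) e0(3) \<alpha>, where n = n] unfolding D'_def by blast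
      \<comment> \<open>From n \<le> K and K \<ge> 1: 2 n + 1 \<le> 3 K and 16 N n + 1 \<le> 17 N K
        with N = \<open>CARD('n)\<close>, in total the power K^(N + 1), that is the exponent
        \<open>\<nu>2\<close>.\<close>
      have "real ((2 * n + 1) ^ ?N * (16 * ?N * n + 1)) \<le> (3 * K) ^ ?N * (17 * ?N * K)"
      proof -
        have N1: "real ?N \<ge> 1" by (simp add: Suc_le_eq)
        have "real ?N * real n \<le> real ?N * K" using n by (intro mult_left_mono) auto
        moreover have "1 \<le> real ?N * K" using mult_mono[OF N1 K] by simp
        ultimately have "16 * (real ?N * real n) + 1 \<le> 17 * (real ?N * K)" by linarith
        then have "real (16 * ?N * n + 1) \<le> 17 * ?N * K" by (simp add: mult.assoc)
        moreover have "real ((2 * n + 1) ^ ?N) \<le> (3 * K) ^ ?N"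
          using n K unfolding of_nat_power by (intro power_mono) auto
        ultimately show ?thesis unfolding of_nat_mult[of "(2 * n + 1) ^ ?N"] using K by (intro mult_mono) auto
      qed
      also have "\<dots> = 3 ^ ?N * 17 * ?N * K powr \<nu>2"
        using K by (simp add: assms(9) powr_add powr_realpow power_mult_distrib mult_ac)
      finally have "measure lebesgue U \<le> (3 ^ ?N * 17 * ?N * K powr \<nu>2) * (576 * ?N * (2 * pi + 1) ^ ?N) * \<kappa> powr (\<alpha> / (\<alpha> + 2))"
        by (intro order_trans[OF mU] mult_right_mono) auto
      also have "\<dots> = C1 * (\<kappa> powr \<nu>1 * K powr \<nu>2)"
        by (simp add: C1_def assms(8) mult_ac)
      also have "\<dots> \<le> C * (\<kappa> powr \<nu>1 * K powr \<nu>2)" using CC by (intro mult_right_mono) auto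
      finally have mU': "measure lebesgue U \<le> C * \<kappa> powr \<nu>1 * K powr \<nu>2" by (simp add: mult.assoc)
      have "outer_measure_of lebesgue (D - D') \<le> emeasure lebesgue U"
        unfolding outer_measure_of_def using U by (intro INF_lower) (auto simp: fmeasurableD)
      also have "\<dots> = ennreal (measure lebesgue U)" using U(1) by (rule emeasure_eq_measure2)
      also have "\<dots> \<le> ennreal (C * \<kappa> powr \<nu>1 * K powr \<nu>2)" using mU' by (rule ennreal_leI)
      finally show ?thesis .
    qed
    show ?case
    proof (intro exI[of _ D'] conjI D'D meas small allI impI, goal_cases)
      case A: (1 \<rho> \<rho>' P dP)
      \<comment> \<open>With half of the lost width, exp (-(n + 1) s) is at most exp (-K (\<rho> -
        \<open>\<rho>'\<close>) / 2).\<close>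
      define s where "s = (\<rho> - \<rho>') / 2"
      have s: "0 < \<rho>'" "0 < s" "\<rho> = \<rho>' + 2 * s" "s \<le> \<sigma>" using A by (auto simp: s_def field_simps)
      obtain M where M: "M \<ge> 0" "param_norm (hat_norm \<alpha>) D \<rho> P dP = ennreal M"
        using A by (cases "param_norm (hat_norm \<alpha>) D \<rho> P dP") auto
      have E: "1 / (1 - exp (- s)) \<le> 2 * (1 + \<sigma>) / (\<rho> - \<rho>')"
      proof -
        have "(1 + \<sigma>) / s = 2 * (1 + \<sigma>) / (\<rho> - \<rho>')" using s(2) by (simp add: s_def mult.commute)
        then show ?thesis using inverse_one_minus_exp_le[OF s(2,4)] by (simp only:)
      qed
      have E': "(c / (1 - exp (- s))) ^ ?N \<le> (2 * c * (1 + \<sigma>)) ^ ?N / (\<rho> - \<rho>') ^ ?N" if "c \<ge> 0" for c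
      proof -
        have "c * (1 / (1 - exp (- s))) \<le> c * (2 * (1 + \<sigma>) / (\<rho> - \<rho>'))" using E that by (rule mult_left_mono)
        then have "(c / (1 - exp (- s))) ^ ?N \<le> (2 * c * (1 + \<sigma>) / (\<rho> - \<rho>')) ^ ?N"
          using that s by (intro power_mono) (auto simp: mult_ac)
        then show ?thesis by (simp only: power_divide)
      qed
      have r0: "(\<rho> - \<rho>') ^ ?N > 0" using A by simp
      have bR: "?N * (5 / (1 - exp (- s))) ^ ?N * exp (- (real (n + 1) * s)) \<le> C * exp (- (K / 2) * (\<rho> - \<rho>')) / (\<rho> - \<rho>') ^ ?N"
      proof -
        have "exp (- (real (n + 1) * s)) \<le> exp (- (K / 2) * (\<rho> - \<rho>'))"
        proof -
          have "K / 2 * (\<rho> - \<rho>') = K * s" by (simp add: s_def)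
          also have "\<dots> \<le> real (n + 1) * s" using n(3) s(2) by (intro mult_right_mono) auto
          finally show ?thesis by (simp only: exp_le_cancel_iff minus_mult_left[symmetric] neg_le_iff_le)
        qed
        then have "?N * (5 / (1 - exp (- s))) ^ ?N * exp (- (real (n + 1) * s))
          \<le> ?N * ((2 * 5 * (1 + \<sigma>)) ^ ?N / (\<rho> - \<rho>') ^ ?N) * exp (- (K / 2) * (\<rho> - \<rho>'))"
          using s(2) r0 \<open>\<sigma> > 0\<close> by (intro mult_mono mult_left_mono E') auto
        also have "\<dots> = C2 * (exp (- (K / 2) * (\<rho> - \<rho>')) / (\<rho> - \<rho>') ^ ?N)"
          by (simp add: C2_def)
        also have "\<dots> \<le> C * (exp (- (K / 2) * (\<rho> - \<rho>')) / (\<rho> - \<rho>') ^ ?N)"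
          using CC r0 by (intro mult_right_mono) auto
        finally show ?thesis by simp
      qed
      have bS: "406 * ?N\<^sup>2 * n ^ 3 / \<kappa> ^ 4 * (4 / (1 - exp (- s))) ^ ?N \<le> C * K ^ 3 / (\<kappa> ^ 4 * (\<rho> - \<rho>') ^ ?N)"
      proof -
        have "real (406 * ?N\<^sup>2 * n ^ 3) / \<kappa> ^ 4 * (4 / (1 - exp (- s))) ^ ?N
          \<le> (406 * (real ?N)\<^sup>2 * K ^ 3 / \<kappa> ^ 4) * ((2 * 4 * (1 + \<sigma>)) ^ ?N / (\<rho> - \<rho>') ^ ?N)"
          using s(2) n \<kappa> K unfolding of_nat_mult of_nat_power of_nat_numeral
          by (intro mult_mono divide_right_mono mult_left_mono power_mono E') auto
        also have "\<dots> = C3 * (K ^ 3 / (\<kappa> ^ 4 * (\<rho> - \<rho>') ^ ?N))"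
          by (simp add: C3_def)
        also have "\<dots> \<le> C * (K ^ 3 / (\<kappa> ^ 4 * (\<rho> - \<rho>') ^ ?N))"
          using CC r0 \<kappa> K by (intro mult_right_mono) auto
        finally show ?thesis by simp
      qed
      have lift: "x \<le> ennreal b * param_norm (hat_norm \<alpha>) D \<rho> P dP"
        if "x \<le> ennreal (a * M)" "a \<le> b" "b \<ge> 0" for x a b
      proof -
        have "ennreal (a * M) \<le> ennreal (b * M)" using that M by (intro ennreal_leI mult_right_mono) auto
        then show ?thesis using that M by (simp add: ennreal_mult)
      qed
      have cd: "commutator_diag (\<lambda>i. of_real (\<Lambda> \<omega> i)) X i j
          = of_real (2 * (real i - real j) + (lam \<omega> i - lam \<omega> j)) * X i j" for \<omega> X i j
        by (simp add: commutator_diag_def lam_def)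
      have PA: "C1_analytic (hat_norm \<alpha>) D \<rho> P dP" "hermitian_map D P" using A by auto
      have Pn: "param_norm (hat_norm \<alpha>) D \<rho> P dP \<le> ennreal M" using M by simp
      have cb: "0 \<le> C * exp (- (K / 2) * (\<rho> - \<rho>')) / (\<rho> - \<rho>') ^ ?N" "0 \<le> C * K ^ 3 / (\<kappa> ^ 4 * (\<rho> - \<rho>') ^ ?N)"
        using CC r0 \<kappa> K by auto
      obtain A' dA' R dR S dS where sol:
        "whitney_C1 (hat_norm \<alpha>) D' A' dA'" "\<forall>\<omega>\<in>D'. is_diagonal (A' \<omega>)"
        "C1_analytic (hat_norm \<alpha>) D' \<rho>' R dR" "hermitian_map D' R"
        "C1_analytic (hat_plus_norm \<alpha>) D' \<rho>' S dS" "antihermitian_map D' S"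
        "\<forall>\<omega>\<in>D'. \<forall>\<theta>\<in>strip \<rho>'. \<forall>i j.
          of_real (2 * (real i - real j) + (lam \<omega> i - lam \<omega> j)) * S \<omega> \<theta> i j - \<i> * time_deriv S \<omega> \<theta> i j
            = A' \<omega> i j - P \<omega> \<theta> i j + R \<omega> \<theta> i j"
        "whitney_norm (hat_norm \<alpha>) D' A' dA' \<le> ennreal M"
        "param_norm (hat_norm \<alpha>) D' \<rho>' R dR
          \<le> ennreal (?N * (5 / (1 - exp (- s))) ^ ?N * exp (- (real (n + 1) * s)) * M)"
        "param_norm (hat_plus_norm \<alpha>) D' \<rho>' S dS
          \<le> ennreal (406 * ?N\<^sup>2 * n ^ 3 / \<kappa> ^ 4 * (4 / (1 - exp (- s))) ^ ?N * M)"
        using homological_equation[OF lb \<epsilon>(1) e0(2) \<kappa>(1) e0(3) less_imp_le[OF \<alpha>] Dabs LC LN n(1) s(1-3) PA(1) Pn M(1) PA(2), folded D'_def]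
        by (elim exE conjE) (rule that, assumption+)
      show ?case
        unfolding cd
        by (rule exI[of _ A'], rule exI[of _ dA'], rule exI[of _ R], rule exI[of _ dR], rule exI[of _ S], rule exI[of _ dS],
            intro conjI sol(1-7) lift[OF sol(9) bR cb(1)] lift[OF sol(10) bS cb(2)])
          (use sol(8) M(2) in simp)
    qed
  qed
qed

end
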